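(* Let $d\ge2$, $k\ge0$, $0<\nu\le1$, $f\in L^2(\Omega;\mathbb R^d)$ and $\phi\in L_0^2(\Omega)$. Let $(\sigma_h,u_h,p_h)\in\Sigma_h^{tn}\times\mathring{\mathbb V}_h^{\operatorname{div}}\times\mathring{\mathcal Q}_h$ satisfy $$\nu^{-1}(\sigma_h,\tau_h)+b_h(\tau_h,q_h;u_h)=0\quad\forall\tau_h\in\Sigma_h^{tn},\ q_h\in\mathring{\mathcal Q}_h,$$ $$b_h(\sigma_h,p_h;v_h)-(u_h,v_h)=-(f,v_h)\quad\forall v_h\in\mathring{\mathbb V}_h^{\operatorname{div}},$$ and let $(\sigma_h^\phi,u_h^\phi,p_h^\phi)$ in the same product space satisfy the same system with the second equation replaced by $$b_h(\sigma_h^\phi,p_h^\phi;v_h)-(u_h^\phi,v_h)=-(f,v_h)+(\phi,\operatorname{div}v_h)\quad\forall v_h\in\mathring{\mathbb V}_h^{\operatorname{div}}.$$ Then $\sigma_h^\phi=\sigma_h$, $u_h^\phi=u_h$ and $p_h^\phi=p_h-Q_{k,h}\phi$.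
   Context: Algebra. $\mathbb S,\mathbb K,\mathbb T$ are the symmetric, skew-symmetric and traceless matrices in $\mathbb R^{d\times d}$; $\operatorname{dev}\tau=\tau-\frac1d(\operatorname{tr}\tau)I$; $a\otimes b=ab^{\intercal}$; $(\operatorname{grad}v)_{ij}=\partial_jv_i$; matrix divergence is row-wise. $(\cdot,\cdot)_D$: $L^2(D)$ inner product ($D$ omitted if $D=\Omega$). $\mathbb P_m(D;\mathbb X)$: $\mathbb X$-valued polynomials of total degree $\le m$. $L_0^2(\Omega)$: $L^2$ functions with zero mean. Mesh. $\Omega\subset\mathbb R^d$ is a bounded connected polytope, $\mathcal T_h$ a simplicial mesh of $\Omega$ (from a shape-regular family). $\mathring{\mathcal F}_h$: interior facets; $\mathcal F(T)$: facets of $T$; $n=n_{\partial T}$: outward unit normal of $T$. Each $F=T^+\cap T^-\in\mathring{\mathcal F}_h$ has a fixed unit normal $n_F$; $[\![w]\!]=w^+-w^-$. $\Pi_Fw=(I-n_Fn_F^{\intercal})w|_F$. $Q_{k,h}$: $L^2$-orthogonal projection onto piecewise polynomials of degree $\le k$ on $\mathcal T_h$. Local stress space. For a simplex $T$ with vertices $\mathtt v_0,\dots,\mathtt v_d$ and barycentric coordinates $\lambda_i$, let $F_\ell$ be the facet opposite $\mathtt v_\ell$, $t_{j,\ell}=\mathtt v_\ell-\mathtt v_j$. $\mathbb B_m^{tn}(T;\mathbb T)=\{\tau\in\mathbb P_m(T;\mathbb T):\Pi_F(\tau n)=0\ \forall F\in\mathcal F(T)\}$ ($m\ge1$). For $k\ge1$: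 $\Sigma_k^+(T;\mathbb S\cap\mathbb T)=\{\tau\in\mathbb P_k(T;\mathbb T)+\mathbb B_{k+1}^{tn}(T;\mathbb T):(\tau,q)_T=0\ \forall q\in\mathbb P_k(T;\mathbb K)\}$. For $k=0$: for a facet $F$ with barycenter $x_F^c$ let $x_F=\Pi_F(x-x_F^c)$ (also its affine extension to $T$), $\mathbb K_F=\{A\in\mathbb K:An_F=0\}$; for each $\ell$ fix $j_\ell\ne\ell$, $I_\ell=\{0,\dots,d\}\setminus\{\ell,j_\ell\}$, and for $A\in\mathbb K_{F_\ell}$ put $E_{\ell,A}=\sum_{i\in I_\ell}(t_{i,j_\ell}^{\intercal}Ax_{F_\ell})\operatorname{dev}(\nabla\lambda_i\otimes t_{i,\ell})$; $\mathbb P_0^+(T;\mathbb T)=\mathbb P_0(T;\mathbb T)+\operatorname{span}\{E_{\ell,A}\}$ and $\Sigma_0^+(T;\mathbb S\cap\mathbb T)=\{\tau\in\mathbb P_0^+(T;\mathbb T)\oplus\mathbb B_1^{tn}(T;\mathbb T):(\tau,q)_T=0\ \forall q\in\mathbb P_0(T;\mathbb K)\}$. Global spaces. $\Sigma_h^{tn}=\{\tau_h\in\prod_{T}\Sigma_k^+(T;\mathbb S\cap\mathbb T):[\![\Pi_F\tau_hn_F]\!]=0\ \forall F\in\mathring{\mathcal F}_h\}$; $\mathring{\mathbb V}_h^{\operatorname{div}}=\{v_h\in H_0(\operatorname{div},\Omega):v_h|_T\in\mathbb P_{k+1}(T;\mathbb R^d)\ \forall T\}$, where $H_0(\operatorname{div},\Omega)$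 are the $L^2$ vector fields with $L^2$ divergence and zero normal trace on $\partial\Omega$; $\mathring{\mathcal Q}_h=\{q_h\in L_0^2(\Omega):q_h|_T\in\mathbb P_k(T)\ \forall T\}$. Form. $b_h(\tau,q;v)=\sum_T[(\operatorname{div}\tau,v)_T-(n^{\intercal}\tau n,v\cdot n)_{\partial T}]-(\operatorname{div}v,q)=\sum_T[-(\tau,\operatorname{dev}\operatorname{grad}v)_T+\sum_{F\in\mathcal F(T)}(\Pi_F\tau n,\Pi_Fv)_F]-(\operatorname{div}v,q)$. *)

theory Defs
  imports "HOL-Analysis.Analysis"
begin

section \<open>Matrices\<close>

definition skew_mats :: "(real^'d^'d) set" where
  "skew_mats = {A. transpose A = - A}"

definition traceless_mats :: "(real^'d^'d) set" where
  "traceless_mats = {A. trace A = 0}"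

definition dev :: "real^'d^'d \<Rightarrow> real^'d^'d" where
  "dev A = A - (trace A / real CARD('d)) *\<^sub>R mat 1"

definition outer :: "real^'d \<Rightarrow> real^'d \<Rightarrow> real^'d^'d" where
  "outer a b = (\<chi> i j. a $ i * b $ j)"

definition tang_proj :: "real^'d \<Rightarrow> real^'d \<Rightarrow> real^'d" where
  "tang_proj n w = w - (n \<bullet> w) *\<^sub>R n"


section \<open>Classical derivatives and test functions\<close>

definition grad :: "(real^'d \<Rightarrow> real) \<Rightarrow> real^'d \<Rightarrow> real^'d" where
  "grad f x = (\<chi> i. frechet_derivative f (at x) (axis i 1))"

definition mat_div :: "(real^'d \<Rightarrow> real^'d^'d) \<Rightarrow> real^'d \<Rightarrow> real^'d" where
  "mat_div \<tau> x = (\<chi> i. \<Sum>j\<in>UNIV. grad (\<lambda>y. \<tau> y $ i $ j) x $ j)"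

primrec C_times :: "nat \<Rightarrow> (real^'d \<Rightarrow> real) \<Rightarrow> bool" where
  "C_times 0 f = continuous_on UNIV f"
| "C_times (Suc m) f =
     ((\<forall>x. f differentiable (at x)) \<and> (\<forall>i. C_times m (\<lambda>x. grad f x $ i)))"

text \<open>The smooth functions with compact support contained in \<open>U\<close>.\<close>

definition test_functions :: "(real^'d) set \<Rightarrow> (real^'d \<Rightarrow> real) set" where
  "test_functions U = {w. (\<forall>m. C_times m w) \<and> compact (closure {x. w x \<noteq> 0})
                          \<and> closure {x. w x \<noteq> 0} \<subseteq> U}"


section \<open>Square integrable functions and \<open>H(div)\<close>\<close>

text \<open>
  Elements of \<open>L\<^sup>2\<close> are represented by functions; equality of elements is equality
  almost everywhere. On matrices, \<open>\<bullet>\<close> is the Frobenius product.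
\<close>

definition L2 :: "(real^'d) set \<Rightarrow> (real^'d \<Rightarrow> 'b::euclidean_space) set" where
  "L2 D = {f. f \<in> borel_measurable (lebesgue_on D) \<and>
              integrable (lebesgue_on D) (\<lambda>x. (norm (f x))\<^sup>2)}"

definition ip :: "(real^'d) set \<Rightarrow> (real^'d \<Rightarrow> 'b::euclidean_space) \<Rightarrow> (real^'d \<Rightarrow> 'b) \<Rightarrow> real" where
  "ip D f g = (LINT x|lebesgue_on D. f x \<bullet> g x)"

definition L2_mean_zero :: "(real^'d) set \<Rightarrow> (real^'d \<Rightarrow> real) set" where
  "L2_mean_zero D = {q \<in> L2 D. (LINT x|lebesgue_on D. q x) = 0}"

definition is_weak_div :: "(real^'d) set \<Rightarrow> (real^'d \<Rightarrow> real^'d) \<Rightarrow> (real^'d \<Rightarrow> real) \<Rightarrow> bool" where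
  "is_weak_div \<Omega> v g \<longleftrightarrow> g \<in> L2 \<Omega> \<and> (\<forall>w\<in>test_functions \<Omega>. ip \<Omega> g w = - ip \<Omega> v (grad w))"

definition weak_div :: "(real^'d) set \<Rightarrow> (real^'d \<Rightarrow> real^'d) \<Rightarrow> real^'d \<Rightarrow> real" where
  "weak_div \<Omega> v = (SOME g. is_weak_div \<Omega> v g)"

definition H_div :: "(real^'d) set \<Rightarrow> (real^'d \<Rightarrow> real^'d) set" where
  "H_div \<Omega> = {v \<in> L2 \<Omega>. \<exists>g. is_weak_div \<Omega> v g}"

text \<open>
  The normal trace of \<open>v\<close> on the boundary of \<open>\<Omega>\<close> is the functional given by Green's
  formula; it is tested with restrictions to \<open>\<Omega>\<close> of compactly supported smooth functions on
  the whole space, which are dense in \<open>H\<^sup>1\<close> of the domains considered.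
\<close>

definition normal_trace :: "(real^'d) set \<Rightarrow> (real^'d \<Rightarrow> real^'d) \<Rightarrow> (real^'d \<Rightarrow> real) \<Rightarrow> real" where
  "normal_trace \<Omega> v w = ip \<Omega> v (grad w) + ip \<Omega> (weak_div \<Omega> v) w"

definition H0_div :: "(real^'d) set \<Rightarrow> (real^'d \<Rightarrow> real^'d) set" where
  "H0_div \<Omega> = {v \<in> H_div \<Omega>. \<forall>w\<in>test_functions UNIV. normal_trace \<Omega> v w = 0}"


section \<open>Meshes\<close>

text \<open>
  A polytope need not be convex here; the domain is the open set underlying it, and
  regularity (\<open>interior (closure \<Omega>) = \<Omega>\<close>) excludes slits.
\<close>

definition polytopal_domain :: "(real^'d) set \<Rightarrow> bool" where
  "polytopal_domain \<Omega> \<longleftrightarrow> open \<Omega> \<and> \<Omega> \<noteq> {} \<and> bounded \<Omega> \<and> connected \<Omega> \<and>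
     interior (closure \<Omega>) = \<Omega> \<and>
     (\<exists>\<P>. finite \<P> \<and> (\<forall>P\<in>\<P>. polytope P) \<and> closure \<Omega> = \<Union>\<P>)"

definition simplicial_mesh :: "(real^'d) set \<Rightarrow> (real^'d) set set \<Rightarrow> bool" where
  "simplicial_mesh \<Omega> \<T> \<longleftrightarrow> triangulation \<T> \<and> (\<forall>T\<in>\<T>. int CARD('d) simplex T) \<and> \<Union>\<T> = closure \<Omega>"

definition facets :: "(real^'d) set \<Rightarrow> (real^'d) set set" where
  "facets T = {F. F facet_of T}"

definition interior_facets :: "(real^'d) set set \<Rightarrow> (real^'d) set set" where
  "interior_facets \<T> = {F. \<exists>T\<in>\<T>. \<exists>T'\<in>\<T>. T \<noteq> T' \<and> F = T \<inter> T' \<and> F \<in> facets T \<and> F \<in> facets T'}"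

definition unit_normal :: "(real^'d) set \<Rightarrow> real^'d \<Rightarrow> bool" where
  "unit_normal F n \<longleftrightarrow> norm n = 1 \<and> (\<forall>x\<in>F. \<forall>y\<in>F. n \<bullet> (y - x) = 0)"

definition outer_normal :: "(real^'d) set \<Rightarrow> (real^'d) set \<Rightarrow> real^'d" where
  "outer_normal T F = (THE n. norm n = 1 \<and> (\<forall>x\<in>F. \<forall>y\<in>T. n \<bullet> (y - x) \<le> 0))"

text \<open>
  The surface integral over a flat facet \<open>F\<close>: a prism of height \<open>1\<close> is erected on \<open>F\<close> in the
  direction of the unit normal \<open>n\<close>, and the integrand is extended constantly along \<open>n\<close>.
  By Fubini this is the integral against the \<open>(d-1)\<close>-dimensional measure on \<open>F\<close>.
\<close>

definition facet_integral :: "(real^'d) set \<Rightarrow> real^'d \<Rightarrow> (real^'d \<Rightarrow> real) \<Rightarrow> real" where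
  "facet_integral F n g =
     (LINT x|lebesgue_on {y + s *\<^sub>R n | y s. y \<in> F \<and> 0 \<le> s \<and> s \<le> 1}.
        g (closest_point (affine hull F) x))"

definition verts :: "(real^'d) set \<Rightarrow> (real^'d) set" where
  "verts T = {v. v extreme_point_of T}"

definition bary :: "(real^'d) set \<Rightarrow> real^'d \<Rightarrow> real^'d \<Rightarrow> real" where
  "bary T v x = (THE l. \<exists>u. sum u (verts T) = 1 \<and> (\<Sum>w\<in>verts T. u w *\<^sub>R w) = x \<and> l = u v)"

definition opp_facet :: "(real^'d) set \<Rightarrow> real^'d \<Rightarrow> (real^'d) set" where
  "opp_facet T v = convex hull (verts T - {v})"

definition barycenter :: "(real^'d) set \<Rightarrow> real^'d" where
  "barycenter F = (1 / real (card (verts F))) *\<^sub>R (\<Sum>v\<in>verts F. v)"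


section \<open>Polynomials\<close>

text \<open>
  A polynomial on a simplex is represented by the unique polynomial function on the whole
  space that extends it.
\<close>

definition Polys :: "nat \<Rightarrow> 'b::real_vector set \<Rightarrow> (real^'d \<Rightarrow> 'b) set" where
  "Polys m X = {p. (\<forall>x. p x \<in> X) \<and>
     (\<exists>c. \<forall>x. p x = (\<Sum>\<alpha>\<in>{\<alpha>::'d \<Rightarrow> nat. sum \<alpha> UNIV \<le> m}. (\<Prod>i\<in>UNIV. x $ i ^ \<alpha> i) *\<^sub>R c \<alpha>))}"

definition restr_in :: "(real^'d) set \<Rightarrow> (real^'d \<Rightarrow> 'b) \<Rightarrow> (real^'d \<Rightarrow> 'b) set \<Rightarrow> bool" where
  "restr_in T f S \<longleftrightarrow> (\<exists>p\<in>S. AE x in lebesgue_on T. f x = p x)"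

text \<open>
  For \<open>f\<close> piecewise polynomial, \<open>poly_on T f\<close> is the polynomial \<open>f|\<^sub>T\<close>; traces of \<open>f|\<^sub>T\<close> on
  facets of \<open>T\<close> are values of it.
\<close>

definition poly_on :: "(real^'d) set \<Rightarrow> (real^'d \<Rightarrow> 'b::real_vector) \<Rightarrow> real^'d \<Rightarrow> 'b" where
  "poly_on T f = (SOME p. (\<exists>m. p \<in> Polys m UNIV) \<and> (AE x in lebesgue_on T. f x = p x))"

definition fun_span :: "('a \<Rightarrow> 'b::real_vector) set \<Rightarrow> ('a \<Rightarrow> 'b) set" where
  "fun_span B = {\<lambda>x. \<Sum>b\<in>S. c b *\<^sub>R b x | S c. finite S \<and> S \<subseteq> B}"

definition fun_sum :: "('a \<Rightarrow> 'b::real_vector) set \<Rightarrow> ('a \<Rightarrow> 'b) set \<Rightarrow> ('a \<Rightarrow> 'b) set" where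
  "fun_sum A B = {\<lambda>x. a x + b x | a b. a \<in> A \<and> b \<in> B}"


section \<open>Local stress spaces\<close>

text \<open>
  The tangential projection and the condition \<open>A *v n = 0\<close> do not depend on the sign of the
  unit normal, so on a single simplex the outward normal is used throughout.
\<close>

definition B_tn :: "nat \<Rightarrow> (real^'d) set \<Rightarrow> (real^'d \<Rightarrow> real^'d^'d) set" where
  "B_tn m T = {\<tau> \<in> Polys m traceless_mats. \<forall>F\<in>facets T. \<forall>x\<in>F.
                 tang_proj (outer_normal T F) (\<tau> x *v outer_normal T F) = 0}"

definition skew_facet :: "(real^'d) set \<Rightarrow> (real^'d) set \<Rightarrow> (real^'d^'d) set" where
  "skew_facet T F = {A \<in> skew_mats. A *v outer_normal T F = 0}"

definition x_facet :: "(real^'d) set \<Rightarrow> (real^'d) set \<Rightarrow> real^'d \<Rightarrow> real^'d" where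
  "x_facet T F x = tang_proj (outer_normal T F) (x - barycenter F)"

text \<open>
  Vertices themselves serve as indices, so \<open>t\<^bsub>i,l\<^esub>\<close> is \<open>l - i\<close>; \<open>j l\<close> is the chosen vertex
  different from \<open>l\<close>.
\<close>

definition E_fun :: "(real^'d \<Rightarrow> real^'d) \<Rightarrow> (real^'d) set \<Rightarrow> real^'d \<Rightarrow> real^'d^'d
    \<Rightarrow> real^'d \<Rightarrow> real^'d^'d" where
  "E_fun j T l A x = (\<Sum>i\<in>verts T - {l, j l}.
     ((j l - i) \<bullet> (A *v x_facet T (opp_facet T l) x)) *\<^sub>R dev (outer (grad (bary T i) x) (l - i)))"

definition P0_plus :: "(real^'d \<Rightarrow> real^'d) \<Rightarrow> (real^'d) set \<Rightarrow> (real^'d \<Rightarrow> real^'d^'d) set" where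
  "P0_plus j T = fun_sum (Polys 0 traceless_mats)
     (fun_span {E_fun j T l A | l A. l \<in> verts T \<and> A \<in> skew_facet T (opp_facet T l)})"

text \<open>
  Symmetry is imposed only weakly, against skew polynomials of degree \<open>k\<close>. The choice \<open>j\<close> is
  only relevant in the lowest order case.
\<close>

definition Sigma_plus :: "nat \<Rightarrow> (real^'d \<Rightarrow> real^'d) \<Rightarrow> (real^'d) set
    \<Rightarrow> (real^'d \<Rightarrow> real^'d^'d) set" where
  "Sigma_plus k j T =
     {\<tau> \<in> fun_sum (if k = 0 then P0_plus j T else Polys k traceless_mats) (B_tn (k + 1) T).
        \<forall>q\<in>Polys k skew_mats. ip T \<tau> q = 0}"


section \<open>Global spaces, bilinear form and projection\<close>

text \<open>
  Ordered pairs of neighbours are quantified over, so both labellings of the two sides of a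
  facet occur; the vanishing of the jump does not depend on it.
\<close>

definition Sigma_h :: "nat \<Rightarrow> ((real^'d) set \<Rightarrow> real^'d \<Rightarrow> real^'d) \<Rightarrow> ((real^'d) set \<Rightarrow> real^'d)
    \<Rightarrow> (real^'d) set set \<Rightarrow> (real^'d \<Rightarrow> real^'d^'d) set" where
  "Sigma_h k j nF \<T> = {\<tau>. (\<forall>T\<in>\<T>. restr_in T \<tau> (Sigma_plus k (j T) T)) \<and>
     (\<forall>F\<in>interior_facets \<T>. \<forall>T\<in>\<T>. \<forall>T'\<in>\<T>. T \<noteq> T' \<longrightarrow> F = T \<inter> T' \<longrightarrow>
        (\<forall>x\<in>F. tang_proj (nF F) (poly_on T \<tau> x *v nF F)
                - tang_proj (nF F) (poly_on T' \<tau> x *v nF F) = 0))}"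

definition V_h :: "nat \<Rightarrow> (real^'d) set \<Rightarrow> (real^'d) set set \<Rightarrow> (real^'d \<Rightarrow> real^'d) set" where
  "V_h k \<Omega> \<T> = {v \<in> H0_div \<Omega>. \<forall>T\<in>\<T>. restr_in T v (Polys (k + 1) UNIV)}"

definition Q_h :: "nat \<Rightarrow> (real^'d) set \<Rightarrow> (real^'d) set set \<Rightarrow> (real^'d \<Rightarrow> real) set" where
  "Q_h k \<Omega> \<T> = {q \<in> L2_mean_zero \<Omega>. \<forall>T\<in>\<T>. restr_in T q (Polys k UNIV)}"

definition b_h :: "(real^'d) set \<Rightarrow> (real^'d) set set \<Rightarrow> (real^'d \<Rightarrow> real^'d^'d) \<Rightarrow> (real^'d \<Rightarrow> real)
    \<Rightarrow> (real^'d \<Rightarrow> real^'d) \<Rightarrow> real" where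
  "b_h \<Omega> \<T> \<tau> q v =
     (\<Sum>T\<in>\<T>. ip T (mat_div (poly_on T \<tau>)) v
        - (\<Sum>F\<in>facets T. let n = outer_normal T F in
             facet_integral F n (\<lambda>x. (n \<bullet> (poly_on T \<tau> x *v n)) * (poly_on T v x \<bullet> n))))
     - ip \<Omega> (weak_div \<Omega> v) q"

definition broken_polys :: "nat \<Rightarrow> (real^'d) set \<Rightarrow> (real^'d) set set \<Rightarrow> (real^'d \<Rightarrow> real) set" where
  "broken_polys k \<Omega> \<T> = {q \<in> L2 \<Omega>. \<forall>T\<in>\<T>. restr_in T q (Polys k UNIV)}"

definition Q_proj :: "nat \<Rightarrow> (real^'d) set \<Rightarrow> (real^'d) set set \<Rightarrow> (real^'d \<Rightarrow> real) \<Rightarrow> real^'d \<Rightarrow> real" where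
  "Q_proj k \<Omega> \<T> \<phi> = (SOME r. r \<in> broken_polys k \<Omega> \<T> \<and>
     (\<forall>q\<in>broken_polys k \<Omega> \<T>. ip \<Omega> (\<lambda>x. \<phi> x - r x) q = 0))"

end

theory Submission
  imports Defs
begin

text \<open>
  The data \<open>\<phi>\<close> act on test fields only through \<open>(\<phi>, div v)\<close>, so they should be absorbed by the
  pressure. The proof has an energy half and a pressure half.

  Energy. Varying \<open>q\<close> in the first equation gives \<open>(div u, q) = 0\<close> for every discrete pressure \<open>q\<close>.
  Since \<open>div u\<close> is itself a piecewise polynomial of degree \<open>k\<close>, it is a constant, and mean-zero data are
  orthogonal to it (\<open>weak_div_orthogonal_mean_zero\<close>). Both solutions therefore see the same load when
  they are tested with \<open>u\<close> and \<open>u\<phi>\<close>. Adding up the first equations for the two stresses and the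
  second ones for the two velocities with the appropriate signs cancels the form and the load, and
  what remains is \<open>\<nu>\<^sup>-\<^sup>1 \<parallel>\<sigma>\<phi> - \<sigma>\<parallel>\<^sup>2 + \<parallel>u\<phi> - u\<parallel>\<^sup>2 = 0\<close>.

  Pressure. With the stresses and velocities equal, the second equations leave
  \<open>(div v, r) = 0\<close> for all discrete \<open>v\<close>, where \<open>r = p\<phi> - p + Q \<phi>\<close>; here \<open>div v\<close> is again a piecewise
  polynomial, so \<open>\<phi>\<close> may be replaced by its projection. It remains to see that the discrete
  divergences exhaust the discrete pressures. This is done by duality, with explicit fields.
  On a simplex with vertices \<open>a, b\<close> the bubble \<open>\<lambda>\<^sub>a \<lambda>\<^sub>b g (b - a)\<close> has no normal trace; the choice
  \<open>g = \<nabla>r \<bullet> (b - a)\<close> makes the derivatives of \<open>r\<close> along all edges vanish, so \<open>r\<close> is constant on each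
  simplex (\<open>orthogonal_to_div_locally_constant\<close>). The lowest order Raviart-Thomas field of an
  interior facet equates the constants of its two neighbours (\<open>orthogonal_to_div_across_facet\<close>).
  A generic segment crosses the mesh only through facets (\<open>constant_on_mesh\<close>), hence \<open>r\<close> is
  constant on the connected domain, and zero because its mean is zero.

  Green's formula. That these fields belong to \<open>H\<^sub>0(div)\<close> rests on one volume identity
  (\<open>cone_divergence\<close>): if \<open>G\<close> vanishes on the base of a cone with apex \<open>a\<close>, then
  \<open>div ((x - a) G)\<close> has integral zero. It is the derivative of the integral of \<open>G\<close> under dilations
  centred at \<open>a\<close>. Two apexes give fields of constant direction, and an affine map that fixes a
  facet pointwise and takes one opposite vertex to the other gives the flux balance across the facet
  (\<open>shared_facet_flux\<close>). Since the weak divergence is a choice among almost everywhere equal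
  functions, it is identified through the fundamental lemma of the calculus of variations.
\<close>

section \<open>Smooth bump functions\<close>

lemma grad_nth_eq:
  assumes "(f has_derivative f') (at x)"
  shows "grad f x $ i = f' (axis i 1)"
  using frechet_derivative_at[OF assms] by (simp add: grad_def)

lemma C_times_Suc_imp: "C_times (Suc m) f \<Longrightarrow> C_times m f"
proof (induction m arbitrary: f)
  case 0
  then show ?case
    by (simp add: continuous_at_imp_continuous_on differentiable_imp_continuous_within)
next
  case (Suc m)
  have d: "\<forall>x. f differentiable at x" and g: "\<forall>i. C_times (Suc m) (\<lambda>x. grad f x $ i)"
    using Suc.prems unfolding C_times.simps(2)[of "Suc m" f] by blast+
  have "\<forall>i. C_times m (\<lambda>x. grad f x $ i)" using g Suc.IH by blast
  with d show ?case by simp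
qed

lemma C_times_const: "C_times m (\<lambda>x :: real^'d. c)"
proof (induction m arbitrary: c)
  case (Suc m)
  have "grad (\<lambda>x. c) x $ i = 0" for x :: "real^'d" and i
    by (subst grad_nth_eq[where f' = "\<lambda>x. 0"]) auto
  then show ?case using Suc by auto
qed auto

lemma C_times_add: "C_times m f \<Longrightarrow> C_times m g \<Longrightarrow> C_times m (\<lambda>x. f x + g x)"
proof (induction m arbitrary: f g)
  case (Suc m)
  have "grad (\<lambda>x. f x + g x) x $ i = grad f x $ i + grad g x $ i" for x i
    using Suc.prems
    by (subst grad_nth_eq[OF has_derivative_add[OF frechet_derivative_works[THEN iffD1] frechet_derivative_works[THEN iffD1]]])
       (auto simp: grad_def)
  then show ?case using Suc by auto
qed (auto intro: continuous_intros)

lemma C_times_mult: "C_times m f \<Longrightarrow> C_times m g \<Longrightarrow> C_times m (\<lambda>x. f x * g x)"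
proof (induction m arbitrary: f g)
  case (Suc m)
  have "grad (\<lambda>x. f x * g x) x $ i = f x * grad g x $ i + grad f x $ i * g x" for x i
    using Suc.prems
    by (subst grad_nth_eq[OF has_derivative_mult[OF frechet_derivative_works[THEN iffD1] frechet_derivative_works[THEN iffD1]]])
       (auto simp: grad_def)
  moreover have "C_times m f" "C_times m g"
    using Suc.prems C_times_Suc_imp by blast+
  ultimately show ?case using Suc by (auto intro!: C_times_add)
qed (auto intro: continuous_intros)

lemma C_times_diff: "C_times m f \<Longrightarrow> C_times m g \<Longrightarrow> C_times m (\<lambda>x. f x - g x)"
  using C_times_add[of m f "\<lambda>x. (-1) * g x"] C_times_mult[OF C_times_const[of m "-1"], of g] by simp

lemma C_times_prod: "finite I \<Longrightarrow> (\<And>i. i \<in> I \<Longrightarrow> C_times m (f i)) \<Longrightarrow> C_times m (\<lambda>x. \<Prod>i\<in>I. f i x)"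
  by (induction I rule: finite_induct) (auto intro: C_times_const C_times_mult)

text \<open>
  The classical function \<open>exp (-1/t)\<close> is multiplied by all powers of \<open>1/t\<close>: this enlarged family is
  closed under differentiation up to linear combinations, which turns smoothness into an induction.
\<close>

definition ramp :: "nat \<Rightarrow> real \<Rightarrow> real" where
  "ramp j t = (if t \<le> 0 then 0 else exp (- inverse t) * inverse t ^ j)"

lemma ramp_at_right_0: "(ramp j \<longlongrightarrow> 0) (at_right 0)"
proof -
  have "((\<lambda>t. inverse t ^ j / exp (inverse t)) \<longlongrightarrow> (0::real)) (at_right 0)"
    by (rule filterlim_compose[OF tendsto_power_div_exp_0 filterlim_inverse_at_top_right])
  moreover have "\<forall>\<^sub>F t in at_right 0. inverse t ^ j / exp (inverse t) = ramp j t"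
    by (auto simp: eventually_at_filter ramp_def exp_minus field_simps intro!: always_eventually)
  ultimately show ?thesis by (rule Lim_transform_eventually)
qed

lemma ramp_has_derivative:
  "(ramp j has_real_derivative (ramp (j + 2) t - real j * ramp (j + 1) t)) (at t)"
proof -
  consider "t < 0" | "t = 0" | "t > 0" by linarith
  then show ?thesis
  proof cases
    case 1
    have "((\<lambda>t. 0) has_real_derivative (ramp (j + 2) t - real j * ramp (j + 1) t)) (at t)"
      using 1 by (simp add: ramp_def)
    then show ?thesis
      by (rule DERIV_cong_ev[THEN iffD1, rotated 3])
         (use 1 in \<open>auto simp: ramp_def intro!: eventually_mono[OF eventually_nhds_in_open[of "{..<0}"]]\<close>)
  next
    case 2
    have r: "((\<lambda>h. ramp j h / h) \<longlongrightarrow> 0) (at_right 0)"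
    proof (rule Lim_transform_eventually[OF ramp_at_right_0[of "j + 1"]])
      show "\<forall>\<^sub>F x in at_right 0. ramp (j + 1) x = ramp j x / x"
        by (auto simp: eventually_at_filter ramp_def field_simps intro!: always_eventually)
    qed
    have l: "((\<lambda>h. ramp j h / h) \<longlongrightarrow> 0) (at_left 0)"
    proof (rule Lim_transform_eventually[OF tendsto_const])
      show "\<forall>\<^sub>F x in at_left 0. 0 = ramp j x / x"
        by (auto simp: eventually_at_filter ramp_def intro!: always_eventually)
    qed
    have "((\<lambda>h. ramp j h / h) \<longlongrightarrow> 0) (at 0)"
      using l r by (simp add: filterlim_split_at)
    then show ?thesis using 2 by (simp add: has_field_derivative_iff ramp_def)
  next
    case 3
    have "((\<lambda>t. exp (- inverse t) * inverse t ^ j) has_real_derivative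
             (ramp (j + 2) t - real j * ramp (j + 1) t)) (at t)"
      using 3 by (auto intro!: derivative_eq_intros simp: ramp_def field_simps power2_eq_square)
         (cases j; simp add: field_simps)
    then show ?thesis
      by (rule DERIV_cong_ev[THEN iffD1, rotated 3])
         (use 3 in \<open>auto simp: ramp_def intro!: eventually_mono[OF eventually_nhds_in_open[of "{0<..}"]]\<close>)
  qed
qed

lemma C_times_ramp: "C_times m (\<lambda>x. ramp j (s * (x $ i) + c))"
proof (induction m arbitrary: j)
  case 0
  have "continuous_on UNIV (ramp j)"
    by (meson DERIV_continuous continuous_at_imp_continuous_on ramp_has_derivative)
  then show ?case
    by (auto intro!: continuous_intros continuous_on_compose2[of UNIV "ramp j"])
next
  case (Suc m)
  let ?D = "\<lambda>x. ramp (j + 2) (s * (x $ i) + c) - real j * ramp (j + 1) (s * (x $ i) + c)"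
  have d: "((\<lambda>x. ramp j (s * (x $ i) + c)) has_derivative (\<lambda>h. ?D x * (s * (h $ i)))) (at x)" for x
    by (rule has_derivative_compose[of "\<lambda>x. s * (x $ i) + c" "\<lambda>h. s * (h $ i)" x UNIV "ramp j"
          "\<lambda>h. ?D x * h"])
       (auto simp del: add_2_eq_Suc' add_Suc_right One_nat_def intro!: derivative_eq_intros
         bounded_linear_imp_has_derivative bounded_linear_vec_nth
         ramp_has_derivative[of j "s * (x $ i) + c", unfolded has_field_derivative_def])
  have "grad (\<lambda>x. ramp j (s * (x $ i) + c)) x $ l = (if l = i then s else 0) *
      (ramp (j + 2) (s * (x $ i) + c) - real j * ramp (j + 1) (s * (x $ i) + c))" for x l
    by (subst grad_nth_eq[OF d]) (simp add: axis_def)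
  moreover have "(\<lambda>x. ramp j (s * (x $ i) + c)) differentiable at x" for x
    using d unfolding differentiable_def by blast
  ultimately show ?case
    using Suc by (auto intro!: C_times_mult C_times_const C_times_diff)
qed

text \<open>
  A product of rescaled ramps, positive exactly on the open box between \<open>a\<close> and \<open>b\<close>. The scaling
  \<open>n + 1\<close> steepens the ramps, so that the limit is the indicator of the box.
\<close>

definition bump :: "real^'d \<Rightarrow> real^'d \<Rightarrow> nat \<Rightarrow> real^'d \<Rightarrow> real" where
  "bump a b n x = (\<Prod>i\<in>UNIV. ramp 0 (real (Suc n) * (x $ i) + - (real (Suc n) * a $ i)) *
                     ramp 0 (- real (Suc n) * (x $ i) + real (Suc n) * b $ i))"

lemma ramp_pos_iff: "ramp 0 t \<noteq> 0 \<longleftrightarrow> t > 0"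
  by (auto simp: ramp_def)

lemma ramp_range: "0 \<le> ramp 0 t" "ramp 0 t \<le> 1"
  by (auto simp: ramp_def)

lemma bump_nonzero: "{x :: real^'d. bump a b n x \<noteq> 0} = box a b"
proof -
  have "real (Suc n) * (x $ i) + - (real (Suc n) * a $ i) > 0 \<longleftrightarrow> a $ i < x $ i"
       "- real (Suc n) * (x $ i) + real (Suc n) * b $ i > 0 \<longleftrightarrow> x $ i < b $ i" for x :: "real^'d" and i
    by (auto simp del: of_nat_Suc)
  then have "bump a b n x \<noteq> 0 \<longleftrightarrow> (\<forall>i. a $ i < x $ i \<and> x $ i < b $ i)" for x
    unfolding bump_def prod_zero_iff[OF finite] mult_eq_0_iff using ramp_pos_iff by blast
  then show ?thesis by (auto simp: mem_box_cart)
qed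

lemma bump_range: "0 \<le> bump a b n x" "bump a b n x \<le> 1"
  unfolding bump_def by (auto intro!: prod_nonneg prod_le_1 mult_nonneg_nonneg mult_le_one ramp_range)

lemma bump_test_function:
  assumes "cbox a b \<subseteq> U" shows "bump a b n \<in> test_functions U"
proof -
  have "C_times m (bump a b n)" for m
    unfolding bump_def by (intro C_times_prod C_times_mult C_times_ramp) auto
  moreover have "closure (box a b) \<subseteq> cbox a b"
    by (rule closure_minimal[OF box_subset_cbox closed_cbox])
  moreover have "compact (closure (box a b))" by (simp add: bounded_box)
  ultimately show ?thesis using assms by (auto simp: test_functions_def bump_nonzero)
qed

lemma ramp_scale_tendsto:
  assumes "t > 0" shows "(\<lambda>n. ramp 0 (real (Suc n) * t)) \<longlonglongrightarrow> 1"
proof -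
  have "(\<lambda>n. exp (- (inverse (real (Suc n)) * inverse t))) \<longlonglongrightarrow> exp (- (0 * inverse t))"
    by (intro tendsto_intros LIMSEQ_inverse_real_of_nat)
  moreover have "ramp 0 (real (Suc n) * t) = exp (- (inverse (real (Suc n)) * inverse t))" for n
    using assms by (simp add: ramp_def mult_le_0_iff)
  ultimately show ?thesis by simp
qed

lemma bump_tendsto: "(\<lambda>n. bump a b n x) \<longlonglongrightarrow> indicator (box a b) x"
proof (cases "x \<in> box a b")
  case True
  then have l: "a $ i < x $ i" "x $ i < b $ i" for i by (auto simp: mem_box_cart)
  have "bump a b n x = (\<Prod>i\<in>UNIV. ramp 0 (real (Suc n) * (x $ i - a $ i)) * ramp 0 (real (Suc n) * (b $ i - x $ i)))" for n
    unfolding bump_def by (simp add: algebra_simps)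
  moreover have "(\<lambda>n. \<Prod>i\<in>UNIV. ramp 0 (real (Suc n) * (x $ i - a $ i)) * ramp 0 (real (Suc n) * (b $ i - x $ i)))
       \<longlonglongrightarrow> (\<Prod>i\<in>(UNIV::'a set). 1 * 1)"
    by (intro tendsto_prod tendsto_mult ramp_scale_tendsto) (use l in auto)
  ultimately show ?thesis using True by simp
next
  case False
  then have "bump a b n x = 0" for n using bump_nonzero by blast
  then show ?thesis using False by simp
qed

section \<open>Lebesgue integrals on subsets of Euclidean space\<close>

lemma AE_lebesgue_on_iff_negligible:
  fixes S :: "'a::euclidean_space set"
  assumes "S \<in> sets lebesgue"
  shows "(AE x in lebesgue_on S. P x) \<longleftrightarrow> negligible {x \<in> S. \<not> P x}"
proof -
  have "(AE x in lebesgue_on S. P x) \<longleftrightarrow> (AE x in lebesgue. x \<in> S \<longrightarrow> P x)"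
    by (rule AE_restrict_space_iff) (use assms in simp)
  also have "\<dots> \<longleftrightarrow> {x. \<not> (x \<in> S \<longrightarrow> P x)} \<in> null_sets lebesgue"
  proof
    assume "AE x in lebesgue. x \<in> S \<longrightarrow> P x"
    then obtain N where "N \<in> null_sets lebesgue" "{x. \<not> (x \<in> S \<longrightarrow> P x)} \<subseteq> N"
      by (auto simp: eventually_ae_filter)
    then show "{x. \<not> (x \<in> S \<longrightarrow> P x)} \<in> null_sets lebesgue"
      by (metis negligible_iff_null_sets negligible_subset)
  next
    assume "{x. \<not> (x \<in> S \<longrightarrow> P x)} \<in> null_sets lebesgue"
    then show "AE x in lebesgue. x \<in> S \<longrightarrow> P x" by (rule AE_I') auto
  qed
  finally show ?thesis by (simp add: negligible_iff_null_sets conj_commute)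
qed

lemma LINT_lebesgue_on_eq:
  fixes f :: "'a::euclidean_space \<Rightarrow> 'b::{banach, second_countable_topology}"
  assumes "S \<in> sets lebesgue"
  shows "(LINT x|lebesgue_on S. f x) = (LINT x|lebesgue. indicator S x *\<^sub>R f x)"
  by (rule integral_restrict_space) (use assms in simp)

lemma integrable_lebesgue_on_eq:
  fixes f :: "'a::euclidean_space \<Rightarrow> 'b::{banach, second_countable_topology}"
  assumes "S \<in> sets lebesgue"
  shows "integrable (lebesgue_on S) f \<longleftrightarrow> integrable lebesgue (\<lambda>x. indicator S x *\<^sub>R f x)"
  by (rule integrable_restrict_space) (use assms in simp)

lemma LINT_lebesgue_on_lborel:
  fixes f :: "'a::euclidean_space \<Rightarrow> 'b::{banach, second_countable_topology}"
  assumes "S \<in> sets borel" "f \<in> borel_measurable borel"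
  shows "(LINT x|lebesgue_on S. f x) = (LINT x|lborel. indicator S x *\<^sub>R f x)"
  using assms by (simp add: LINT_lebesgue_on_eq integral_completion)

lemma integrable_on_compact:
  fixes f :: "'a::euclidean_space \<Rightarrow> 'b::euclidean_space"
  assumes "compact S" "continuous_on S f"
  shows "integrable (lebesgue_on S) f"
proof -
  have "integrable lborel (\<lambda>x. indicator S x *\<^sub>R f x)"
    using assms by (rule borel_integrable_compact)
  then have "integrable lebesgue (\<lambda>x. indicator S x *\<^sub>R f x)"
    using integrable_completion borel_measurable_integrable by blast
  then show ?thesis
    using assms(1) by (subst integrable_lebesgue_on_eq) (auto dest: borel_compact)
qed

lemma LINT_support:
  fixes f :: "'a::euclidean_space \<Rightarrow> real"
  assumes "U \<subseteq> S" "U \<in> sets lebesgue" "S \<in> sets lebesgue" "\<And>x. x \<notin> U \<Longrightarrow> f x = 0"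
  shows "(LINT x|lebesgue_on S. f x) = (LINT x|lebesgue_on U. f x)"
proof -
  have "indicator S x *\<^sub>R f x = indicator U x *\<^sub>R f x" for x
    using assms(1,4) by (auto simp: indicator_def)
  then show ?thesis using assms by (simp only: LINT_lebesgue_on_eq)
qed

section \<open>The fundamental lemma of the calculus of variations\<close>

lemma enn2real_eq_imp_eq: "enn2real a = enn2real b \<Longrightarrow> a \<noteq> top \<Longrightarrow> b \<noteq> top \<Longrightarrow> a = b"
  by (cases a; cases b) auto

text \<open>
  The positive and the negative part of \<open>h\<close> are the densities of two finite measures that agree on
  the boxes, a generator stable under intersections; hence they are equal.
\<close>

lemma AE_zero_if_box_integrals_zero:
  fixes h :: "'a::euclidean_space \<Rightarrow> real"
  assumes h: "integrable lborel h" and box: "\<And>a b. (LINT x|lborel. indicator (box a b) x * h x) = 0"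
  shows "AE x in lborel. h x = 0"
proof -
  have [measurable]: "h \<in> borel_measurable borel" using h by auto
  define fp where "fp x = ennreal (h x)" for x
  define fm where "fm x = ennreal (- h x)" for x
  have [measurable]: "fp \<in> borel_measurable borel" "fm \<in> borel_measurable borel"
    unfolding fp_def fm_def by measurable
  have fin: "(\<integral>\<^sup>+x. fp x \<partial>lborel) \<noteq> \<infinity>"
    using h unfolding fp_def real_integrable_def by auto
  \<comment> \<open>The integral is the difference of the integrals of the two parts, both finite.\<close>
  have eq: "emeasure (density lborel fp) (box a b) = emeasure (density lborel fm) (box a b)" for a b :: 'a
  proof -
    let ?g = "\<lambda>x. indicator (box a b) x * h x"
    have gi: "integrable lborel ?g"
      using integrable_mult_indicator[OF _ h, of "box a b"] by simp
    have "enn2real (\<integral>\<^sup>+x. ennreal (?g x) \<partial>lborel) = enn2real (\<integral>\<^sup>+x. ennreal (- ?g x) \<partial>lborel)"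
      using box[of a b] real_lebesgue_integral_def[OF gi] by simp
    then have "(\<integral>\<^sup>+x. ennreal (?g x) \<partial>lborel) = (\<integral>\<^sup>+x. ennreal (- ?g x) \<partial>lborel)"
      by (rule enn2real_eq_imp_eq) (use gi in \<open>simp_all add: real_integrable_def\<close>)
    moreover have "(\<integral>\<^sup>+x. ennreal (?g x) \<partial>lborel) = (\<integral>\<^sup>+x. fp x * indicator (box a b) x \<partial>lborel)"
      by (rule nn_integral_cong) (auto simp: fp_def indicator_def)
    moreover have "(\<integral>\<^sup>+x. ennreal (- ?g x) \<partial>lborel) = (\<integral>\<^sup>+x. fm x * indicator (box a b) x \<partial>lborel)"
      by (rule nn_integral_cong) (auto simp: fm_def indicator_def)
    ultimately show ?thesis by (simp add: emeasure_density)
  qed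
  have "density lborel fp = density lborel fm"
  proof (rule measure_eqI_generator_eq)
    let ?E = "range (\<lambda>(a, b). box a b::'a set)"
    let ?A = "\<lambda>n::nat. box (- (real n *\<^sub>R One)) (real n *\<^sub>R One) :: 'a set"
    show "Int_stable ?E" by (auto simp: Int_stable_def box_Int_box)
    show "?E \<subseteq> Pow UNIV" "sets (density lborel fp) = sigma_sets UNIV ?E" "sets (density lborel fm) = sigma_sets UNIV ?E"
      by (simp_all add: borel_eq_box)
    show "range ?A \<subseteq> ?E" "(\<Union>i. ?A i) = UNIV"
      unfolding UN_box_eq_UNIV by auto
    show "emeasure (density lborel fp) (?A i) \<noteq> \<infinity>" for i
    proof -
      have "emeasure (density lborel fp) (?A i) \<le> (\<integral>\<^sup>+x. fp x \<partial>lborel)"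
        by (auto simp: emeasure_density intro!: nn_integral_mono simp: indicator_def)
      then show ?thesis using fin by (auto simp: top_unique)
    qed
    show "emeasure (density lborel fp) X = emeasure (density lborel fm) X" if "X \<in> ?E" for X
      using that eq by auto
  qed
  then have "AE x in lborel. fp x = fm x"
    using finite_density_unique[of fp lborel fm] fin by simp
  then show ?thesis
  proof eventually_elim
    case (elim x)
    then show ?case
      by (cases "h x" "0 :: real" rule: linorder_cases)
         (auto simp: fp_def fm_def ennreal_neg ennreal_eq_0_iff)
  qed
qed

lemma test_functions_borel_measurable:
  assumes "w \<in> test_functions U" shows "w \<in> borel_measurable borel"
proof -
  have "C_times 0 w" using assms unfolding test_functions_def by blast
  then show ?thesis by (simp add: borel_measurable_continuous_onI)
qed

text \<open>
  Bumps converge boundedly to indicators of boxes, so all integrals of \<open>h\<close> over boxes compactly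
  contained in \<open>U\<close> vanish, and countably many closed boxes exhaust \<open>U\<close>.
\<close>

theorem fundamental_lemma_variations:
  fixes h :: "real^'d \<Rightarrow> real"
  assumes U: "open U" and h: "integrable (lebesgue_on U) h"
    and test: "\<And>w. w \<in> test_functions U \<Longrightarrow> (LINT x|lebesgue_on U. h x * w x) = 0"
  shows "AE x in lebesgue_on U. h x = 0"
proof -
  have Us [measurable]: "U \<in> sets borel" and Ul: "U \<in> sets lebesgue" using U by auto
  have hi: "integrable lebesgue (\<lambda>x. indicator U x * h x)"
    using h Ul by (simp add: integrable_lebesgue_on_eq)
  obtain g where g [measurable]: "g \<in> borel_measurable lborel"
      and gh: "AE x in lborel. indicator U x * h x = g x"
    using completion_ex_borel_measurable_real[OF borel_measurable_integrable[OF hi]] by auto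
  have gh': "AE x in lebesgue. indicator U x * h x = g x"
    using gh by (rule AE_completion)
  have "integrable lebesgue g"
    using integrable_cong_AE_imp[OF hi _ gh'] g by (simp add: measurable_completion)
  then have gi: "integrable lborel g" using g by (simp add: integrable_completion)
  have box: "(LINT x|lborel. indicator (box a b) x * g x) = 0" if ab: "cbox a b \<subseteq> U" for a b
  proof -
    have "(\<lambda>n. LINT x|lborel. bump a b n x * g x) \<longlonglongrightarrow> (LINT x|lborel. indicator (box a b) x * g x)"
    proof (rule integral_dominated_convergence[where w = "\<lambda>x. \<bar>g x\<bar>"])
      show "(\<lambda>x. bump a b n x * g x) \<in> borel_measurable lborel" for n
      proof -
        have [measurable]: "bump a b n \<in> borel_measurable borel"
          by (rule test_functions_borel_measurable[OF bump_test_function[OF ab, of n]])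
        show ?thesis by simp
      qed
      show "AE x in lborel. (\<lambda>n. bump a b n x * g x) \<longlonglongrightarrow> indicator (box a b) x * g x"
        by (auto intro!: tendsto_intros bump_tendsto)
      show "AE x in lborel. norm (bump a b n x * g x) \<le> \<bar>g x\<bar>" for n
        by (auto simp: abs_mult bump_range mult_left_le_one_le)
    qed (use gi in auto)
    moreover have "(LINT x|lborel. bump a b n x * g x) = 0" for n
    proof -
      have [measurable]: "bump a b n \<in> borel_measurable borel"
        by (rule test_functions_borel_measurable[OF bump_test_function[OF ab, of n]])
      have "(LINT x|lborel. bump a b n x * g x) = (LINT x|lebesgue. bump a b n x * g x)"
        by (subst integral_completion) auto
      also have "\<dots> = (LINT x|lebesgue. indicator U x *\<^sub>R (h x * bump a b n x))"
      proof (rule integral_cong_AE)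
        show "AE x in lebesgue. bump a b n x * g x = indicator U x *\<^sub>R (h x * bump a b n x)"
          using gh' by eventually_elim (auto simp: mult_ac)
        have "(\<lambda>x. (indicator U x * h x) * bump a b n x) \<in> borel_measurable lebesgue"
          by (intro borel_measurable_times borel_measurable_integrable[OF hi] measurable_completion) auto
        then show "(\<lambda>x. indicator U x *\<^sub>R (h x * bump a b n x)) \<in> borel_measurable lebesgue"
          by (simp add: mult_ac)
        show "(\<lambda>x. bump a b n x * g x) \<in> borel_measurable lebesgue"
          by (intro borel_measurable_times measurable_completion) auto
      qed
      also have "\<dots> = 0"
        using test[OF bump_test_function[OF ab]] Ul by (simp add: LINT_lebesgue_on_eq)
      finally show ?thesis .
    qed
    ultimately show ?thesis by (simp add: LIMSEQ_const_iff)
  qed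
  have null: "negligible {x \<in> cbox a b. h x \<noteq> 0}" if ab: "cbox a b \<subseteq> U" for a b
  proof -
    have "AE x in lborel. indicator (box a b) x * g x = 0"
    proof (rule AE_zero_if_box_integrals_zero)
      show "integrable lborel (\<lambda>x. indicator (box a b) x * g x)"
        using integrable_mult_indicator[OF _ gi, of "box a b"] by simp
      fix c d :: "real^'d"
      obtain e f where ef: "cbox a b \<inter> cbox c d = cbox e f" using Int_interval by blast
      then have "interior (cbox a b) \<inter> interior (cbox c d) = interior (cbox e f)"
        by (metis interior_Int)
      then have "box a b \<inter> box c d = box e f" by (simp only: interior_cbox)
      then have "indicator (box c d) x * (indicator (box a b) x * g x) = indicator (box e f) x * g x" for x
        by (auto simp: indicator_def set_eq_iff)
      then have "(LINT x|lborel. indicator (box c d) x * (indicator (box a b) x * g x)) =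
          (LINT x|lborel. indicator (box e f) x * g x)"
        by (rule Bochner_Integration.integral_cong[OF refl])
      then show "(LINT x|lborel. indicator (box c d) x * (indicator (box a b) x * g x)) = 0"
        using box[of e f] ef ab by auto
    qed
    then have "AE x in lebesgue. indicator (box a b) x * g x = 0" by (rule AE_completion)
    with gh' have "AE x in lebesgue. x \<in> box a b \<longrightarrow> h x = 0"
      by eventually_elim (use ab box_subset_cbox[of a b] in \<open>auto simp: indicator_def subset_iff split: if_splits\<close>)
    then have "AE x in lebesgue_on (box a b). h x = 0" by (subst AE_restrict_space_iff) auto
    then have "negligible {x \<in> box a b. h x \<noteq> 0}" by (subst (asm) AE_lebesgue_on_iff_negligible) auto
    moreover have "negligible (cbox a b - box a b)" by (rule negligible_frontier_interval)
    ultimately show ?thesis by (rule negligible_subset[OF negligible_Un]) auto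
  qed
  obtain D where D: "countable D" "D \<subseteq> Pow U" "\<And>X. X \<in> D \<Longrightarrow> \<exists>a b. X = cbox a b" "\<Union>D = U"
    using open_countable_Union_open_cbox[OF U] by metis
  have "negligible (\<Union>X\<in>D. {x \<in> X. h x \<noteq> 0})"
  proof (rule negligible_countable_Union)
    show "countable ((\<lambda>X. {x \<in> X. h x \<noteq> 0}) ` D)" using D by auto
    show "negligible S" if "S \<in> (\<lambda>X. {x \<in> X. h x \<noteq> 0}) ` D" for S
      proof -
        obtain X where X: "X \<in> D" "S = {x \<in> X. h x \<noteq> 0}" using \<open>S \<in> _\<close> by blast
        obtain a b where "X = cbox a b" using D(3)[OF X(1)] by blast
        then show ?thesis using X D(2) null[of a b] by auto
      qed
  qed
  moreover have "(\<Union>X\<in>D. {x \<in> X. h x \<noteq> 0}) = {x \<in> U. h x \<noteq> 0}" using D(4) by auto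
  ultimately show ?thesis using Ul by (simp add: AE_lebesgue_on_iff_negligible)
qed

section \<open>Linear changes of variables\<close>

text \<open>
  The image \<open>N\<close> of Lebesgue measure under a linear isomorphism is translation invariant, and such a
  measure is a multiple of Lebesgue measure: comparing \<open>\<integral>\<integral> f(x) g(x + y) dx dN(y)\<close> in
  the two orders of integration gives \<open>\<integral> g dN \<cdot> \<integral> f = \<integral> g \<cdot> \<integral> f dN\<close>
  for even \<open>f\<close>. The constant is the absolute value of the determinant of \<open>L\<close>.
\<close>

lemma lborel_linear_image:
  fixes L :: "'a::euclidean_space \<Rightarrow> 'a"
  assumes L: "linear L" and inj: "inj L"
  obtains c where "c > 0" "\<And>f :: 'a \<Rightarrow> real. f \<in> borel_measurable borel \<Longrightarrow>
      (LINT x|lborel. f x) = c * (LINT x|lborel. f (L x))"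
proof -
  define N where "N = distr lborel borel L"
  have cL: "continuous_on UNIV L" using L linear_continuous_on linear_conv_bounded_linear by blast
  have [measurable]: "L \<in> borel_measurable borel" by (rule borel_measurable_continuous_onI[OF cL])
  have bij: "bij L" using L inj by (simp add: linear_injective_imp_surjective bij_def)
  \<comment> \<open>A translation by \<open>t = L s\<close> after \<open>L\<close> is \<open>L\<close> after a translation by \<open>s\<close>.\<close>
  have shift: "distr N borel (\<lambda>x. t + x) = N" for t
  proof -
    obtain s where s: "t = L s" using bij by (meson bij_pointE)
    have "distr N borel (\<lambda>x. t + x) = distr lborel borel (\<lambda>x. L (s + x))"
      unfolding N_def s by (subst distr_distr) (auto simp: comp_def linear_add[OF L])
    also have "\<dots> = distr (distr lborel borel (\<lambda>x. s + x)) borel L"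
      by (subst distr_distr) (auto simp: comp_def)
    also have "\<dots> = N" unfolding N_def by (simp only: lborel_distr_plus)
    finally show ?thesis .
  qed
  have sN [measurable_cong]: "sets N = sets borel" and spN: "space N = UNIV" by (simp_all add: N_def)
  have Nball: "emeasure N (ball 0 r) < \<infinity>" for r
  proof -
    have "bounded (L -` ball 0 r)"
    proof -
      obtain g where g: "linear g" "g \<circ> L = id" using linear_injective_left_inverse[OF L inj] by blast
      have "L -` ball 0 r \<subseteq> g ` ball 0 r"
      proof
        fix x assume "x \<in> L -` ball 0 r"
        moreover have "g (L x) = x" using g(2) by (metis comp_apply id_apply)
        ultimately show "x \<in> g ` ball 0 r" by (metis imageI vimage_eq)
      qed
      then show ?thesis using bounded_linear_image[OF bounded_ball] g(1) linear_conv_bounded_linear bounded_subset by blast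
    qed
    then show ?thesis
      using emeasure_bounded_finite[of "L -` ball 0 r"] unfolding N_def by (subst emeasure_distr) auto
  qed
  interpret N: sigma_finite_measure N
  proof
    show "\<exists>A. countable A \<and> A \<subseteq> sets N \<and> \<Union>A = space N \<and> (\<forall>a\<in>A. emeasure N a \<noteq> \<infinity>)"
    proof (intro exI[of _ "range (\<lambda>n::nat. ball 0 (real n))"] conjI)
      show "\<Union>(range (\<lambda>n::nat. ball (0::'a) (real n))) = space N"
        unfolding spN using reals_Archimedean2 by (auto simp: set_eq_iff)
      show "\<forall>a\<in>range (\<lambda>n. ball 0 (real n)). emeasure N a \<noteq> \<infinity>"
        using Nball by (auto simp: less_top)
    qed auto
  qed
  interpret P: pair_sigma_finite lborel N ..
  define f :: "'a \<Rightarrow> ennreal" where "f = indicator (ball 0 1)"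
  have [measurable]: "f \<in> borel_measurable borel"
    unfolding f_def by (intro borel_measurable_indicator) auto
  have f_sym: "f (- x) = f x" for x by (simp add: f_def indicator_def)
  have fl: "emeasure lborel (ball (0::'a) 1) \<noteq> 0" "emeasure lborel (ball (0::'a) 1) \<noteq> \<infinity>"
  proof -
    show "emeasure lborel (ball (0::'a) 1) \<noteq> 0"
      using emeasure_ball[of 1 "0::'a"] unit_ball_vol_pos[OF of_nat_0_le_iff[of "DIM('a)"]] by (simp add: less_le)
    show "emeasure lborel (ball (0::'a) 1) \<noteq> \<infinity>" using emeasure_lborel_ball_finite[of "0::'a" 1] by auto
  qed
  have shiftN: "(\<integral>\<^sup>+y. h (x + y) \<partial>N) = (\<integral>\<^sup>+y. h y \<partial>N)" if [measurable]: "h \<in> borel_measurable borel" for h x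
    by (subst (2) shift[of x, symmetric], subst nn_integral_distr) auto
  have shiftl: "(\<integral>\<^sup>+y. h (x + y) \<partial>lborel) = (\<integral>\<^sup>+y. h y \<partial>lborel)"
    if [measurable]: "h \<in> borel_measurable borel" for h and x :: 'a
    by (subst (2) lborel_distr_plus[of x, symmetric], subst nn_integral_distr) auto
  have key: "(\<integral>\<^sup>+y. g y \<partial>N) * (\<integral>\<^sup>+x. f x \<partial>lborel) = (\<integral>\<^sup>+x. g x \<partial>lborel) * (\<integral>\<^sup>+y. f y \<partial>N)"
    if [measurable]: "g \<in> borel_measurable borel" for g
  proof -
    have "(\<integral>\<^sup>+y. g y \<partial>N) * (\<integral>\<^sup>+x. f x \<partial>lborel) = (\<integral>\<^sup>+x. f x * (\<integral>\<^sup>+y. g y \<partial>N) \<partial>lborel)"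
      by (subst nn_integral_multc) (auto simp: mult.commute)
    also have "\<dots> = (\<integral>\<^sup>+x. \<integral>\<^sup>+y. f x * g (x + y) \<partial>N \<partial>lborel)"
      by (intro nn_integral_cong, subst nn_integral_cmult) (auto simp: shiftN)
    also have "\<dots> = (\<integral>\<^sup>+y. \<integral>\<^sup>+x. f x * g (x + y) \<partial>lborel \<partial>N)"
      using P.Fubini[of "\<lambda>(x, y). f x * g (x + y)"] by simp
    also have "\<dots> = (\<integral>\<^sup>+y. \<integral>\<^sup>+x. f (x - y) * g x \<partial>lborel \<partial>N)"
    proof (rule nn_integral_cong)
      fix y
      show "(\<integral>\<^sup>+x. f x * g (x + y) \<partial>lborel) = (\<integral>\<^sup>+x. f (x - y) * g x \<partial>lborel)"
        using shiftl[of "\<lambda>x. f (x - y) * g x" y] by (simp add: add.commute)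
    qed
    also have "\<dots> = (\<integral>\<^sup>+x. \<integral>\<^sup>+y. f (x - y) * g x \<partial>N \<partial>lborel)"
      using P.Fubini[of "\<lambda>(x, y). f (x - y) * g x"] by simp
    also have "\<dots> = (\<integral>\<^sup>+x. (\<integral>\<^sup>+y. f y \<partial>N) * g x \<partial>lborel)"
    proof (rule nn_integral_cong)
      fix x
      have "(\<integral>\<^sup>+y. f (x - y) * g x \<partial>N) = (\<integral>\<^sup>+y. f (x - y) \<partial>N) * g x"
        by (rule nn_integral_multc) auto
      also have "(\<integral>\<^sup>+y. f (x - y) \<partial>N) = (\<integral>\<^sup>+y. f y \<partial>N)"
        using shiftN[of "\<lambda>y. f (x - y)" x] by (simp add: f_sym)
      finally show "(\<integral>\<^sup>+y. f (x - y) * g x \<partial>N) = (\<integral>\<^sup>+y. f y \<partial>N) * g x" .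
    qed
    also have "\<dots> = (\<integral>\<^sup>+x. g x \<partial>lborel) * (\<integral>\<^sup>+y. f y \<partial>N)"
      by (subst nn_integral_cmult) (auto simp: mult.commute)
    finally show ?thesis .
  qed
  obtain b where b: "b > 0" "emeasure lborel (ball (0::'a) 1) = ennreal b"
    using fl by (cases "emeasure lborel (ball (0::'a) 1)") auto
  obtain n where n: "n > 0" "emeasure N (ball (0::'a) 1) = ennreal n"
  proof -
    have "emeasure N (ball (0::'a) 1) \<noteq> 0"
    proof
      assume "emeasure N (ball (0::'a) 1) = 0"
      then have "(\<integral>\<^sup>+y. indicator UNIV y \<partial>N) * ennreal b = 0"
        using key[of "\<lambda>x. indicator UNIV x"] b by (simp add: f_def)
      then have "emeasure N UNIV = 0" using b by (simp add: spN)
      then have "emeasure lborel (UNIV :: 'a set) = 0" unfolding N_def by (subst (asm) emeasure_distr) auto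
      then show False by simp
    qed
    then show ?thesis using that Nball[of 1] by (cases "emeasure N (ball (0::'a) 1)") auto
  qed
  have N_eq: "N = density lborel (\<lambda>_. ennreal (n / b))"
  proof (rule measure_eqI)
    fix A assume "A \<in> sets N"
    then have [measurable]: "A \<in> sets borel" by (simp add: sN)
    have "emeasure N A * ennreal b = emeasure lborel A * ennreal n"
      using key[of "indicator A"] b n by (simp add: f_def)
    then have "emeasure N A * (ennreal b * ennreal (1 / b)) = emeasure lborel A * (ennreal n * ennreal (1 / b))"
      by (simp add: mult.assoc[symmetric])
    then show "emeasure N A = emeasure (density lborel (\<lambda>_. ennreal (n / b))) A"
      using b n by (simp add: emeasure_density nn_integral_cmult_indicator nn_integral_multc mult.commute flip: ennreal_mult)
  qed (simp add: sN)
  show ?thesis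
  proof
    show "b / n > 0" using b n by simp
    fix f :: "'a \<Rightarrow> real" assume [measurable]: "f \<in> borel_measurable borel"
    have "(LINT x|lborel. f (L x)) = (LINT x|N. f x)" unfolding N_def by (subst integral_distr) auto
    also have "\<dots> = (n / b) * (LINT x|lborel. f x)"
      unfolding N_eq using b n by (subst integral_density) auto
    finally show "(LINT x|lborel. f x) = b / n * (LINT x|lborel. f (L x))" using b n by simp
  qed
qed

section \<open>A divergence identity on cones\<close>

definition apex_cone :: "'a::real_vector \<Rightarrow> 'a set \<Rightarrow> 'a set" where
  "apex_cone a Z = (\<lambda>(r, y). a + r *\<^sub>R (y - a)) ` ({0..1} \<times> Z)"

lemma compact_cone: "compact Z \<Longrightarrow> compact (apex_cone a Z)" for a :: "'a::real_normed_vector"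
  unfolding apex_cone_def
  by (intro compact_continuous_image compact_Times compact_Icc)
     (auto simp: case_prod_unfold intro!: continuous_intros)

lemma cone_contract:
  assumes "x \<in> apex_cone a Z" "0 \<le> s" "s \<le> 1" shows "a + s *\<^sub>R (x - a) \<in> apex_cone a Z"
proof -
  obtain r y where "y \<in> Z" "0 \<le> r" "r \<le> 1" "x = a + r *\<^sub>R (y - a)"
    using assms(1) by (auto simp: apex_cone_def)
  then show ?thesis
    unfolding apex_cone_def using assms(2,3)
    by (intro image_eqI[where x = "(s * r, y)"]) (auto simp: mult_le_one)
qed

lemma lborel_integral_contract:
  fixes f :: "'a::euclidean_space \<Rightarrow> real"
  assumes "s > 0" and [measurable]: "f \<in> borel_measurable borel"
  shows "(LINT x|lborel. f x) = s ^ DIM('a) * (LINT x|lborel. f (a + s *\<^sub>R (x - a)))"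
proof -
  have "(LINT x|lborel. f x) = s ^ DIM('a) * (LINT x|lborel. f ((a - s *\<^sub>R a) + s *\<^sub>R x))"
    using assms(1)
    by (subst lborel_affine[of s "a - s *\<^sub>R a"])
       (simp_all add: integral_density integral_distr)
  then show ?thesis by (simp add: algebra_simps)
qed

lemma has_derivative_imp_continuous_on:
  "(\<And>x. (f has_derivative f' x) (at x)) \<Longrightarrow> continuous_on UNIV f"
  by (intro continuous_at_imp_continuous_on ballI has_derivative_continuous)

lemma has_derivative_along_ray:
  assumes "\<And>x. (G has_derivative (\<lambda>h. G' x \<bullet> h)) (at x)"
  shows "((\<lambda>s. G (a + s *\<^sub>R (x - a))) has_real_derivative G' (a + s *\<^sub>R (x - a)) \<bullet> (x - a)) (at s)"
proof -
  have "((\<lambda>s. G (a + s *\<^sub>R (x - a))) has_derivative (\<lambda>h. G' (a + s *\<^sub>R (x - a)) \<bullet> (h *\<^sub>R (x - a)))) (at s)"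
    by (rule has_derivative_compose[OF _ assms]) (auto intro!: derivative_eq_intros)
  then show ?thesis by (simp add: has_field_derivative_def mult_commute_abs)
qed

lemma compact_continuous_bound:
  fixes f :: "'a::topological_space \<Rightarrow> 'b::real_normed_vector"
  assumes "compact S" "continuous_on UNIV f"
  obtains B where "\<And>x. x \<in> S \<Longrightarrow> norm (f x) \<le> B" "B \<ge> 0"
proof -
  obtain B where "\<And>x. x \<in> S \<Longrightarrow> norm (f x) \<le> B"
    using compact_imp_bounded[OF compact_continuous_image[OF continuous_on_subset[OF assms(2) subset_UNIV] assms(1)]]
    unfolding bounded_iff by auto
  then show ?thesis using that[of "max B 0"] by force
qed

text \<open>
  The integrand is the divergence of \<open>(x - a) G(x)\<close>. It is also the derivative at \<open>s = 1\<close> of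
  \<open>s\<^sup>d G(a + s (x - a))\<close>, whose integral over the cone \<open>S\<close> is that of \<open>G\<close> over the
  contracted cone. The difference quotient is thus the integral of \<open>G\<close> over a thin shell at the base,
  divided by its thickness; since \<open>G\<close> vanishes on the base, it is small on the shell, and the quotient
  tends to zero.
\<close>

theorem cone_divergence:
  fixes a :: "'a::euclidean_space" and G :: "'a \<Rightarrow> real"
  assumes Z: "compact Z"
    and G: "\<And>x. (G has_derivative (\<lambda>h. G' x \<bullet> h)) (at x)" and G': "continuous_on UNIV G'"
    and G0: "\<And>y. y \<in> Z \<Longrightarrow> G y = 0"
  shows "(LINT x|lebesgue_on (apex_cone a Z). real DIM('a) * G x + G' x \<bullet> (x - a)) = 0"
proof -
  define S where "S = apex_cone a Z"
  define d where "d = DIM('a)"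
  have cS: "compact S" unfolding S_def using Z by (rule compact_cone)
  have cG: "continuous_on UNIV G"
    by (rule has_derivative_imp_continuous_on[OF G])
  have [measurable]: "S \<in> sets borel" using cS by (rule borel_compact)
  have [measurable]: "G \<in> borel_measurable borel" "G' \<in> borel_measurable borel"
    using cG G' by (auto intro: borel_measurable_continuous_onI)
  obtain B where B: "\<And>x. x \<in> S \<Longrightarrow> \<bar>G x\<bar> \<le> B" "B \<ge> 0"
    using compact_continuous_bound[OF cS cG] by auto
  obtain B' where B': "\<And>x. x \<in> S \<Longrightarrow> norm (G' x) \<le> B'" "B' \<ge> 0"
    using compact_continuous_bound[OF cS G'] by auto
  have "continuous_on UNIV (\<lambda>x. x - a)" by (intro continuous_intros)
  then obtain D where D: "\<And>x. x \<in> S \<Longrightarrow> norm (x - a) \<le> D" "D \<ge> 0"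
    using compact_continuous_bound[OF cS] by blast
  have ZS: "y \<in> S" if "y \<in> Z" for y
    using that unfolding S_def apex_cone_def by (intro image_eqI[where x = "(1, y)"]) auto
  have contract: "a + s *\<^sub>R (x - a) \<in> S" if "x \<in> S" "0 \<le> s" "s \<le> 1" for x s
    using cone_contract that unfolding S_def by blast
  define \<psi> where "\<psi> x s = s ^ d * G (a + s *\<^sub>R (x - a))" for x s
  define \<psi>' where "\<psi>' x s = real d * s ^ (d - 1) * G (a + s *\<^sub>R (x - a)) + s ^ d * (G' (a + s *\<^sub>R (x - a)) \<bullet> (x - a))" for x s
  note Gline = has_derivative_along_ray[of G G' a, OF G]
  have d\<psi>: "(\<psi> x has_real_derivative \<psi>' x s) (at s)" for x s
    unfolding \<psi>_def[abs_def] \<psi>'_def by (auto intro!: derivative_eq_intros Gline)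
  \<comment> \<open>The offset \<open>2\<close> keeps \<open>s n = 1 - e n\<close> strictly between \<open>0\<close> and \<open>1\<close>.\<close>
  define e where "e n = 1 / real (n + 2)" for n
  define s where "s n = 1 - e n" for n
  have e: "0 < e n" "e n < 1" for n unfolding e_def by auto
  have e0: "e \<longlonglongrightarrow> 0" unfolding e_def by real_asymp
  have s: "0 < s n" "s n < 1" for n using e[of n] by (auto simp: s_def)
  define q where "q n x = (\<psi> x 1 - \<psi> x (s n)) / e n" for n x
  have lim: "(\<lambda>n. q n x) \<longlonglongrightarrow> real d * G x + G' x \<bullet> (x - a)" for x
  proof -
    have "((\<lambda>h. (\<psi> x (1 + h) - \<psi> x 1) / h) \<longlongrightarrow> \<psi>' x 1) (at 0)"
      using d\<psi>[of x 1] by (simp add: DERIV_def)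
    moreover have "filterlim (\<lambda>n. - e n) (at 0) sequentially"
      using tendsto_minus[OF e0] e by (auto simp: filterlim_at intro!: always_eventually) (metis less_irrefl)
    ultimately have "(\<lambda>n. (\<psi> x (1 + - e n) - \<psi> x 1) / - e n) \<longlonglongrightarrow> \<psi>' x 1"
      by (rule filterlim_compose)
    moreover have "(\<psi> x (1 + - e n) - \<psi> x 1) / - e n = q n x" for n
      by (simp add: q_def s_def minus_divide_left)
    ultimately show ?thesis by (simp add: \<psi>'_def)
  qed
  have bound: "\<bar>q n x\<bar> \<le> real d * B + B' * D" if x: "x \<in> S" for n x
  proof -
    obtain z where z: "s n < z" "z < 1" "\<psi> x 1 - \<psi> x (s n) = (1 - s n) * \<psi>' x z"
      using MVT2[of "s n" 1 "\<psi> x" "\<psi>' x"] s d\<psi> by blast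
    then have "q n x = \<psi>' x z" using e[of n] by (simp add: q_def s_def)
    moreover have "\<bar>\<psi>' x z\<bar> \<le> real d * 1 * B + 1 * (B' * D)"
      unfolding \<psi>'_def
    proof (rule order_trans[OF abs_triangle_ineq add_mono])
      have z0: "0 \<le> z" "z \<le> 1" using z s[of n] by auto
      have zS: "a + z *\<^sub>R (x - a) \<in> S" by (rule contract[OF x z0])
      show "\<bar>real d * z ^ (d - 1) * G (a + z *\<^sub>R (x - a))\<bar> \<le> real d * 1 * B"
        unfolding abs_mult using z0 B(1)[OF zS] by (intro mult_mono) (auto simp: power_le_one)
      have "\<bar>G' (a + z *\<^sub>R (x - a)) \<bullet> (x - a)\<bar> \<le> B' * D"
        by (rule order_trans[OF Cauchy_Schwarz_ineq2 mult_mono]) (use B'(1)[OF zS] B'(2) D(1)[OF x] in auto)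
      then show "\<bar>z ^ d * (G' (a + z *\<^sub>R (x - a)) \<bullet> (x - a))\<bar> \<le> 1 * (B' * D)"
        unfolding abs_mult using z0 by (intro mult_mono) (auto simp: power_le_one)
    qed
    ultimately show ?thesis by simp
  qed
  have int: "integrable lborel (\<lambda>x. indicator S x * f x)" if "continuous_on UNIV f" for f :: "'a \<Rightarrow> real"
    using borel_integrable_compact[OF cS continuous_on_subset[OF that subset_UNIV]] by simp
  have shell: "\<bar>LINT x|lborel. indicator S x * q n x\<bar> \<le> e n * (B' * D * real d * (LINT x|lborel. indicator S x))" for n
  proof -
    define Sn where "Sn = (\<lambda>x. a + s n *\<^sub>R (x - a)) ` S"
    have "compact Sn" unfolding Sn_def using cS by (intro compact_continuous_image continuous_intros)
    then have [measurable]: "Sn \<in> sets borel" by (rule borel_compact)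
    have SnS: "Sn \<subseteq> S" unfolding Sn_def using contract s[of n] by auto
    have ind: "indicator Sn (a + s n *\<^sub>R (x - a)) = (indicator S x :: real)" for x
      using s[of n] by (auto simp: Sn_def indicator_def image_iff)
    have cc: "continuous_on UNIV (\<lambda>x. G (a + s n *\<^sub>R (x - a)))"
      by (rule continuous_on_compose2[OF cG]) (auto intro!: continuous_intros)
    have iSn: "integrable lborel (\<lambda>x. indicator Sn x * f x)" if "continuous_on UNIV f" for f :: "'a \<Rightarrow> real"
      using borel_integrable_compact[OF \<open>compact Sn\<close> continuous_on_subset[OF that subset_UNIV]] by simp
    have A: "(LINT x|lborel. indicator S x * q n x) = (LINT x|lborel. (indicator S x - indicator Sn x) * G x) / e n"
    proof -
      have "(LINT x|lborel. indicator S x * q n x) =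
          (LINT x|lborel. (indicator S x * G x - s n ^ d * (indicator S x * G (a + s n *\<^sub>R (x - a)))) / e n)"
        by (rule Bochner_Integration.integral_cong) (auto simp: q_def \<psi>_def algebra_simps)
      also have "\<dots> = ((LINT x|lborel. indicator S x * G x) - s n ^ d * (LINT x|lborel. indicator S x * G (a + s n *\<^sub>R (x - a)))) / e n"
        using int[OF cG] int[OF cc] by simp
      also have "s n ^ d * (LINT x|lborel. indicator S x * G (a + s n *\<^sub>R (x - a))) = (LINT x|lborel. indicator Sn x * G x)"
        using lborel_integral_contract[of "s n" "\<lambda>x. indicator Sn x * G x" a] s[of n] by (simp add: ind d_def)
      also have "(LINT x|lborel. indicator S x * G x) - \<dots> = (LINT x|lborel. (indicator S x - indicator Sn x) * G x)"
        using int[OF cG] iSn[OF cG] by (simp add: left_diff_distrib)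
      finally show ?thesis .
    qed
    \<comment> \<open>A point of the shell lies on a ray to a point \<open>y\<close> of the base, at a parameter \<open>r > s n\<close>; the mean
      value theorem along the rest of the ray bounds \<open>G\<close> by the thickness.\<close>
    have small: "\<bar>G x\<bar> \<le> e n * (B' * D)" if x: "x \<in> S" "x \<notin> Sn" for x
    proof -
      obtain r y where y: "y \<in> Z" "0 \<le> r" "r \<le> 1" "x = a + r *\<^sub>R (y - a)"
        using x(1) by (auto simp: S_def apex_cone_def)
      have rs: "r > s n"
      proof (rule ccontr)
        assume "\<not> r > s n"
        then have "a + (r / s n) *\<^sub>R (y - a) \<in> S" using contract[OF ZS[OF y(1)], of "r / s n"] y s[of n] by simp
        moreover have "x = a + s n *\<^sub>R ((a + (r / s n) *\<^sub>R (y - a)) - a)" using y s[of n] by simp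
        ultimately show False using x(2) unfolding Sn_def by blast
      qed
      show ?thesis
      proof (cases "r = 1")
        case True
        then show ?thesis using y G0[OF y(1)] e[of n] B' D by simp
      next
        case False
        then have "r < 1" using y by simp
        then obtain z where z: "r < z" "z < 1" "G (a + 1 *\<^sub>R (y - a)) - G (a + r *\<^sub>R (y - a)) = (1 - r) * (G' (a + z *\<^sub>R (y - a)) \<bullet> (y - a))"
          using MVT2[of r 1 "\<lambda>s. G (a + s *\<^sub>R (y - a))" "\<lambda>s. G' (a + s *\<^sub>R (y - a)) \<bullet> (y - a)"] Gline by blast
        then have "G x = - ((1 - r) * (G' (a + z *\<^sub>R (y - a)) \<bullet> (y - a)))"
          using G0[OF y(1)] y by simp
        then have "\<bar>G x\<bar> = (1 - r) * \<bar>G' (a + z *\<^sub>R (y - a)) \<bullet> (y - a)\<bar>"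
          using \<open>r < 1\<close> by (simp add: abs_mult)
        also have "\<dots> \<le> e n * (B' * D)"
        proof (rule mult_mono)
          show "1 - r \<le> e n" using rs by (simp add: s_def)
          have "a + z *\<^sub>R (y - a) \<in> S" using contract[OF ZS[OF y(1)], of z] z y by simp
          then show "\<bar>G' (a + z *\<^sub>R (y - a)) \<bullet> (y - a)\<bar> \<le> B' * D"
            using B' D(1)[OF ZS[OF y(1)]] by (intro order_trans[OF Cauchy_Schwarz_ineq2 mult_mono]) auto
        qed (use e[of n] in auto)
        finally show ?thesis .
      qed
    qed
    have i1: "integrable lborel (\<lambda>x. indicator S x :: real)" "integrable lborel (\<lambda>x. indicator Sn x :: real)"
      using int[of "\<lambda>_. 1"] iSn[of "\<lambda>_. 1"] by auto
    define m where "m = (LINT x|lborel. indicator S x :: real)"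
    have m0: "m \<ge> 0" unfolding m_def by (intro Bochner_Integration.integral_nonneg) auto
    have mn: "(LINT x|lborel. indicator Sn x) = s n ^ d * m"
      using lborel_integral_contract[of "s n" "indicator Sn" a] s[of n] by (simp add: ind d_def m_def)
    have "\<bar>LINT x|lborel. (indicator S x - indicator Sn x) * G x\<bar> \<le> (LINT x|lborel. \<bar>(indicator S x - indicator Sn x) * G x\<bar>)"
      by (rule integral_abs_bound)
    also have "\<dots> \<le> (LINT x|lborel. (indicator S x - indicator Sn x) * (e n * (B' * D)))"
    proof (rule integral_mono)
      have "integrable lborel (\<lambda>x. (indicator S x - indicator Sn x) * G x)"
        using int[OF cG] iSn[OF cG] by (simp add: left_diff_distrib)
      then show "integrable lborel (\<lambda>x. \<bar>(indicator S x - indicator Sn x) * G x\<bar>)" by (rule integrable_abs)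
      show "integrable lborel (\<lambda>x. (indicator S x - indicator Sn x) * (e n * (B' * D)))"
        using i1 by simp
      show "\<bar>(indicator S x - indicator Sn x) * G x\<bar> \<le> (indicator S x - indicator Sn x) * (e n * (B' * D))" for x
        using small[of x] SnS by (auto simp: indicator_def)
    qed
    also have "\<dots> = (1 - s n ^ d) * m * (e n * (B' * D))"
      using i1 mn by (simp add: m_def algebra_simps)
    also have "\<dots> \<le> (real d * e n) * m * (e n * (B' * D))"
    proof -
      \<comment> \<open>Bernoulli: the volume of the shell is at most proportional to its thickness.\<close>
      have "1 + real d * (- e n) \<le> (1 + (- e n)) ^ d"
        using e[of n] by (intro Bernoulli_inequality) auto
      then show ?thesis using m0 e[of n] B' D by (intro mult_right_mono) (auto simp: s_def)
    qed
    finally have "\<bar>LINT x|lborel. (indicator S x - indicator Sn x) * G x\<bar> \<le> (real d * e n) * m * (e n * (B' * D))" .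
    then have "\<bar>LINT x|lborel. (indicator S x - indicator Sn x) * G x\<bar> / e n \<le> (real d * e n) * m * (e n * (B' * D)) / e n"
      by (rule divide_right_mono) (use e[of n] in auto)
    then show ?thesis unfolding A using e[of n] by (simp add: m_def mult_ac)
  qed
  have "(\<lambda>n. LINT x|lborel. indicator S x * q n x) \<longlonglongrightarrow> (LINT x|lborel. indicator S x * (real d * G x + G' x \<bullet> (x - a)))"
  proof (rule integral_dominated_convergence[where w = "\<lambda>x. indicator S x * (real d * B + B' * D)"])
    have "continuous_on UNIV (\<lambda>x. G (a + s n *\<^sub>R (x - a)))" for n
      by (rule continuous_on_compose2[OF cG]) (auto intro!: continuous_intros)
    then have [measurable]: "(\<lambda>x. G (a + s n *\<^sub>R (x - a))) \<in> borel_measurable borel" for n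
      by (rule borel_measurable_continuous_onI)
    show "(\<lambda>x. indicator S x * q n x) \<in> borel_measurable lborel" for n
      unfolding q_def \<psi>_def by simp
    show "integrable lborel (\<lambda>x. indicator S x * (real d * B + B' * D))" by (rule int) auto
    show "AE x in lborel. (\<lambda>n. indicator S x * q n x) \<longlonglongrightarrow> indicator S x * (real d * G x + G' x \<bullet> (x - a))"
      by (intro AE_I2 tendsto_intros lim)
    show "AE x in lborel. norm (indicator S x * q n x) \<le> indicator S x * (real d * B + B' * D)" for n
      using bound by (auto simp: indicator_def)
  qed auto
  moreover have "(\<lambda>n. LINT x|lborel. indicator S x * q n x) \<longlonglongrightarrow> 0"
  proof (rule Lim_null_comparison)
    show "\<forall>\<^sub>F n in sequentially. norm (LINT x|lborel. indicator S x * q n x) \<le> e n * (B' * D * real d * (LINT x|lborel. indicator S x))"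
      using shell by (intro always_eventually) auto
    show "(\<lambda>n. e n * (B' * D * real d * (LINT x|lborel. indicator S x))) \<longlonglongrightarrow> 0"
      by (rule tendsto_mult_left_zero[OF e0])
  qed
  ultimately have "(LINT x|lborel. indicator S x * (real d * G x + G' x \<bullet> (x - a))) = 0"
    using LIMSEQ_unique by blast
  then show ?thesis
    unfolding S_def[symmetric] d_def[symmetric]
    by (subst LINT_lebesgue_on_lborel) auto
qed

section \<open>Polynomials\<close>

definition monomial :: "('d::finite \<Rightarrow> nat) \<Rightarrow> real^'d \<Rightarrow> real" where
  "monomial \<alpha> x = (\<Prod>i\<in>UNIV. x $ i ^ \<alpha> i)"

lemma finite_exponents [simp]: "finite {\<alpha>::'d::finite \<Rightarrow> nat. sum \<alpha> UNIV \<le> m}"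
proof (rule finite_subset)
  show "{\<alpha>::'d \<Rightarrow> nat. sum \<alpha> UNIV \<le> m} \<subseteq> PiE UNIV (\<lambda>_. {..m})"
    by (auto simp: PiE_UNIV_domain) (meson UNIV_I finite_class.finite_UNIV le_trans member_le_sum zero_le)
qed (auto intro: finite_PiE)

lemma Polys_UNIV_iff:
  "p \<in> Polys m UNIV \<longleftrightarrow> (\<exists>c. p = (\<lambda>x. \<Sum>\<alpha>\<in>{\<alpha>. sum \<alpha> UNIV \<le> m}. monomial \<alpha> x *\<^sub>R c \<alpha>))"
  by (auto simp: Polys_def monomial_def fun_eq_iff)

lemma Polys_subset_UNIV: "p \<in> Polys m X \<Longrightarrow> p \<in> Polys m UNIV"
  by (auto simp: Polys_def)

lemma Polys_add: "p \<in> Polys m UNIV \<Longrightarrow> q \<in> Polys m UNIV \<Longrightarrow> (\<lambda>x. p x + q x) \<in> Polys m UNIV"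
proof -
  assume "p \<in> Polys m UNIV" "q \<in> Polys m UNIV"
  then obtain c d where "p = (\<lambda>x. \<Sum>\<alpha>\<in>{\<alpha>. sum \<alpha> UNIV \<le> m}. monomial \<alpha> x *\<^sub>R c \<alpha>)"
      "q = (\<lambda>x. \<Sum>\<alpha>\<in>{\<alpha>. sum \<alpha> UNIV \<le> m}. monomial \<alpha> x *\<^sub>R d \<alpha>)"
    unfolding Polys_UNIV_iff by blast
  then show ?thesis unfolding Polys_UNIV_iff
    by (intro exI[of _ "\<lambda>\<alpha>. c \<alpha> + d \<alpha>"]) (simp add: scaleR_add_right sum.distrib)
qed

lemma Polys_linear:
  assumes "linear L" "p \<in> Polys m UNIV" shows "(\<lambda>x. L (p x)) \<in> Polys m UNIV"
proof -
  obtain c where "p = (\<lambda>x. \<Sum>\<alpha>\<in>{\<alpha>. sum \<alpha> UNIV \<le> m}. monomial \<alpha> x *\<^sub>R c \<alpha>)"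
    using assms(2) unfolding Polys_UNIV_iff by blast
  then show ?thesis unfolding Polys_UNIV_iff
    by (intro exI[of _ "\<lambda>\<alpha>. L (c \<alpha>)"]) (simp add: linear_sum[OF assms(1)] linear_cmul[OF assms(1)])
qed

lemma Polys_mono: "m \<le> n \<Longrightarrow> p \<in> Polys m UNIV \<Longrightarrow> p \<in> Polys n UNIV"
proof -
  assume "m \<le> n" "p \<in> Polys m UNIV"
  then obtain c where c: "p = (\<lambda>x. \<Sum>\<alpha>\<in>{\<alpha>. sum \<alpha> UNIV \<le> m}. monomial \<alpha> x *\<^sub>R c \<alpha>)"
    unfolding Polys_UNIV_iff by blast
  show ?thesis unfolding Polys_UNIV_iff c
  proof (intro exI[of _ "\<lambda>\<alpha>. if sum \<alpha> UNIV \<le> m then c \<alpha> else 0"] ext sum.mono_neutral_cong_left)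
  qed (use \<open>m \<le> n\<close> in auto)
qed

lemma Polys_zero: "(\<lambda>x. 0) \<in> Polys m UNIV"
  unfolding Polys_UNIV_iff by (intro exI[of _ "\<lambda>_. 0"]) simp

lemma Polys_sum: "finite I \<Longrightarrow> (\<And>i. i \<in> I \<Longrightarrow> f i \<in> Polys m UNIV) \<Longrightarrow> (\<lambda>x. \<Sum>i\<in>I. f i x) \<in> Polys m UNIV"
  by (induction I rule: finite_induct) (auto intro: Polys_zero Polys_add)

lemma Polys_monomial: "sum \<alpha> UNIV \<le> m \<Longrightarrow> (\<lambda>x. monomial \<alpha> x *\<^sub>R c) \<in> Polys m UNIV"
  unfolding Polys_UNIV_iff
  by (intro exI[of _ "\<lambda>\<beta>. if \<beta> = \<alpha> then c else 0"]) (simp add: if_distrib sum.delta cong: if_cong)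

lemma Polys_const: "(\<lambda>x. c) \<in> Polys m UNIV"
  using Polys_monomial[of "\<lambda>_. 0" m c] by (simp add: monomial_def)

lemma Polys_mult:
  assumes "p \<in> Polys m UNIV" "q \<in> Polys n UNIV" shows "(\<lambda>x. p x *\<^sub>R q x) \<in> Polys (m + n) UNIV"
proof -
  obtain c d where cd: "p = (\<lambda>x. \<Sum>\<alpha>\<in>{\<alpha>. sum \<alpha> UNIV \<le> m}. monomial \<alpha> x *\<^sub>R c \<alpha>)"
      "q = (\<lambda>x. \<Sum>\<alpha>\<in>{\<alpha>. sum \<alpha> UNIV \<le> n}. monomial \<alpha> x *\<^sub>R d \<alpha>)"
    using assms unfolding Polys_UNIV_iff by blast
  have "(\<lambda>x. p x *\<^sub>R q x) = (\<lambda>x. \<Sum>\<alpha>\<in>{\<alpha>. sum \<alpha> UNIV \<le> m}. \<Sum>\<beta>\<in>{\<beta>. sum \<beta> UNIV \<le> n}.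
      monomial (\<lambda>i. \<alpha> i + \<beta> i) x *\<^sub>R (c \<alpha> *\<^sub>R d \<beta>))"
    unfolding cd
    by (intro ext, subst scaleR_sum_left, intro sum.cong refl, subst scaleR_sum_right, intro sum.cong refl)
       (simp add: monomial_def power_add prod.distrib mult_ac)
  also have "\<dots> \<in> Polys (m + n) UNIV"
    by (intro Polys_sum Polys_monomial finite_exponents) (auto simp: sum.distrib)
  finally show ?thesis .
qed

lemma Polys_inner_left: "(\<lambda>x. n \<bullet> x) \<in> Polys 1 UNIV"
proof -
  have "(\<lambda>x. n \<bullet> x) = (\<lambda>x. \<Sum>i\<in>UNIV. monomial (\<lambda>j. if j = i then 1 else 0) x *\<^sub>R (n $ i))"
    by (simp add: monomial_def inner_vec_def fun_eq_iff if_distrib prod.delta mult.commute cong: if_cong)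
  also have "\<dots> \<in> Polys 1 UNIV"
    by (intro Polys_sum Polys_monomial finite) auto
  finally show ?thesis .
qed

lemma continuous_on_Polys:
  fixes p :: "real^'d \<Rightarrow> 'b::real_normed_vector"
  assumes "p \<in> Polys m X" shows "continuous_on UNIV p"
proof -
  obtain c where "p = (\<lambda>x. \<Sum>\<alpha>\<in>{\<alpha>. sum \<alpha> UNIV \<le> m}. monomial \<alpha> x *\<^sub>R c \<alpha>)"
    using Polys_subset_UNIV[OF assms] unfolding Polys_UNIV_iff by blast
  then show ?thesis by (auto simp: monomial_def intro!: continuous_intros)
qed

text \<open>
  For \<open>\<alpha> i = 0\<close> the exponent \<open>\<alpha> i - 1\<close> is truncated to \<open>0\<close>, which is harmless because the factor
  \<open>real (\<alpha> i)\<close> removes the summand.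
\<close>

lemma monomial_has_derivative:
  "(monomial \<alpha> has_derivative (\<lambda>h. (\<Sum>i\<in>UNIV. monomial (\<alpha>(i := \<alpha> i - 1)) x *\<^sub>R (real (\<alpha> i) *\<^sub>R axis i 1)) \<bullet> h)) (at x)"
proof -
  have 1: "((\<lambda>x. \<Prod>i\<in>UNIV. x $ i ^ \<alpha> i) has_derivative
      (\<lambda>h. \<Sum>i\<in>UNIV. (real (\<alpha> i) * (h $ i) * x $ i ^ (\<alpha> i - 1)) * (\<Prod>j\<in>UNIV - {i}. x $ j ^ \<alpha> j))) (at x)"
    by (intro has_derivative_prod has_derivative_power bounded_linear_imp_has_derivative bounded_linear_vec_nth)
  have 2: "monomial (\<alpha>(i := \<alpha> i - 1)) x = x $ i ^ (\<alpha> i - 1) * (\<Prod>j\<in>UNIV - {i}. x $ j ^ \<alpha> j)" for i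
    unfolding monomial_def by (subst prod.remove[of UNIV i]) (auto intro!: prod.cong)
  have 3: "monomial \<alpha> = (\<lambda>x. \<Prod>i\<in>UNIV. x $ i ^ \<alpha> i)" by (rule ext) (simp add: monomial_def)
  show ?thesis
    by (subst 3, rule has_derivative_eq_rhs[OF 1])
       (auto simp: fun_eq_iff 2[simplified] inner_sum_left inner_axis' mult_ac intro!: sum.cong)
qed

lemma Polys_has_gradient:
  fixes p :: "real^'d \<Rightarrow> real"
  assumes "p \<in> Polys m UNIV"
  obtains p' where "p' \<in> Polys (m - 1) UNIV" "\<And>x. (p has_derivative (\<lambda>h. p' x \<bullet> h)) (at x)"
proof -
  obtain c where c: "p = (\<lambda>x. \<Sum>\<alpha>\<in>{\<alpha>. sum \<alpha> UNIV \<le> m}. monomial \<alpha> x * c \<alpha>)"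
    using assms unfolding Polys_UNIV_iff by auto
  define p' :: "real^'d \<Rightarrow> real^'d" where "p' x = (\<Sum>\<alpha>\<in>{\<alpha>. sum \<alpha> UNIV \<le> m}. \<Sum>i\<in>UNIV.
      monomial (\<alpha>(i := \<alpha> i - 1)) x *\<^sub>R ((c \<alpha> * real (\<alpha> i)) *\<^sub>R axis i 1))" for x
  show ?thesis
  proof
    show "p' \<in> Polys (m - 1) UNIV"
      unfolding p'_def
    proof (intro Polys_sum finite_exponents finite)
      fix \<alpha> :: "'d \<Rightarrow> nat" and i :: 'd assume "\<alpha> \<in> {\<alpha>. sum \<alpha> UNIV \<le> m}"
      then have s: "sum \<alpha> UNIV \<le> m" by simp
      show "(\<lambda>x. monomial (\<alpha>(i := \<alpha> i - 1)) x *\<^sub>R ((c \<alpha> * real (\<alpha> i)) *\<^sub>R (axis i 1 :: real^'d))) \<in> Polys (m - 1) UNIV"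
      proof (cases "\<alpha> i = 0")
        case True
        then show ?thesis by (simp add: Polys_zero)
      next
        case False
        have "sum (\<alpha>(i := \<alpha> i - 1)) UNIV = (\<alpha> i - 1) + sum \<alpha> (UNIV - {i})"
          by (subst sum.remove[of UNIV i]) (auto intro!: sum.cong)
        moreover have "sum \<alpha> UNIV = \<alpha> i + sum \<alpha> (UNIV - {i})" by (subst sum.remove[of UNIV i]) auto
        ultimately show ?thesis using s False by (intro Polys_monomial) auto
      qed
    qed
    fix x
    have "(p has_derivative (\<lambda>h. \<Sum>\<alpha>\<in>{\<alpha>. sum \<alpha> UNIV \<le> m}.
        ((\<Sum>i\<in>UNIV. monomial (\<alpha>(i := \<alpha> i - 1)) x *\<^sub>R (real (\<alpha> i) *\<^sub>R axis i 1)) \<bullet> h) * c \<alpha>)) (at x)"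
      unfolding c by (intro has_derivative_sum has_derivative_mult_left monomial_has_derivative)
    then show "(p has_derivative (\<lambda>h. p' x \<bullet> h)) (at x)"
      by (rule has_derivative_eq_rhs)
         (auto simp: p'_def fun_eq_iff inner_sum_left sum_distrib_right sum_distrib_left mult_ac intro!: sum.cong)
  qed
qed

section \<open>Square integrable functions\<close>

lemma continuous_in_L2:
  fixes f :: "real^'d \<Rightarrow> 'b::euclidean_space"
  assumes "compact S" "continuous_on S f" shows "f \<in> L2 S"
proof -
  have "integrable (lebesgue_on S) f" "integrable (lebesgue_on S) (\<lambda>x. (norm (f x))\<^sup>2)"
    using assms by (auto intro!: integrable_on_compact continuous_intros)
  then show ?thesis by (simp add: L2_def)
qed

lemma L2_inner_integrable:
  assumes "f \<in> L2 S" "g \<in> L2 S" shows "integrable (lebesgue_on S) (\<lambda>x. f x \<bullet> g x)"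
proof (rule Bochner_Integration.integrable_bound)
  show "integrable (lebesgue_on S) (\<lambda>x. (norm (f x))\<^sup>2 + (norm (g x))\<^sup>2)"
    using assms by (simp add: L2_def)
  show "(\<lambda>x. f x \<bullet> g x) \<in> borel_measurable (lebesgue_on S)"
    using assms by (intro borel_measurable_inner) (auto simp: L2_def)
  show "AE x in lebesgue_on S. norm (f x \<bullet> g x) \<le> norm ((norm (f x))\<^sup>2 + (norm (g x))\<^sup>2)"
  proof (rule AE_I2)
    fix x
    have "norm (f x \<bullet> g x) \<le> norm (f x) * norm (g x)" by (simp add: Cauchy_Schwarz_ineq2)
    also have "\<dots> \<le> (norm (f x))\<^sup>2 + (norm (g x))\<^sup>2"
    proof -
      have "0 \<le> norm (f x) * norm (g x)" by simp
      with sum_squares_bound[of "norm (f x)" "norm (g x)"] show ?thesis by linarith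
    qed
    finally show "norm (f x \<bullet> g x) \<le> norm ((norm (f x))\<^sup>2 + (norm (g x))\<^sup>2)" by simp
  qed
qed

lemma L2_add:
  assumes "f \<in> L2 S" "g \<in> L2 S" shows "(\<lambda>x. f x + g x) \<in> L2 S"
proof -
  have "integrable (lebesgue_on S) (\<lambda>x. (norm (f x))\<^sup>2 + (norm (g x))\<^sup>2 + 2 * (f x \<bullet> g x))"
    using assms L2_inner_integrable[OF assms]
    by (intro Bochner_Integration.integrable_add integrable_mult_right) (auto simp: L2_def)
  moreover have "(norm (f x))\<^sup>2 + (norm (g x))\<^sup>2 + 2 * (f x \<bullet> g x) = (norm (f x + g x))\<^sup>2" for x
    by (simp add: power2_norm_eq_inner inner_add_left inner_add_right inner_commute)
  ultimately show ?thesis using assms by (auto simp: L2_def intro: borel_measurable_add)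
qed

lemma L2_scaleR: "f \<in> L2 S \<Longrightarrow> (\<lambda>x. c *\<^sub>R f x) \<in> L2 S"
  by (auto simp: L2_def power_mult_distrib)

lemma L2_cmult: "f \<in> L2 S \<Longrightarrow> (\<lambda>x. c * f x) \<in> L2 S" for f :: "real^'d \<Rightarrow> real"
  using L2_scaleR[of f S c] by simp

lemma L2_diff: "f \<in> L2 S \<Longrightarrow> g \<in> L2 S \<Longrightarrow> (\<lambda>x. f x - g x) \<in> L2 S"
  using L2_add[of f S "\<lambda>x. (-1) *\<^sub>R g x"] L2_scaleR[of g S "-1"] by simp

lemma L2_zero: "(\<lambda>x. 0) \<in> L2 S"
  by (simp add: L2_def)

lemma L2_sum: "finite I \<Longrightarrow> (\<And>i. i \<in> I \<Longrightarrow> f i \<in> L2 S) \<Longrightarrow> (\<lambda>x. \<Sum>i\<in>I. f i x) \<in> L2 S"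
  by (induction I rule: finite_induct) (auto intro: L2_zero L2_add)

lemma L2_const:
  fixes c :: "'b::euclidean_space" assumes "S \<in> lmeasurable" shows "(\<lambda>x :: real^'d. c) \<in> L2 S"
  using finite_measure.integrable_const[OF finite_measure_lebesgue_on[OF assms]] by (simp add: L2_def)

lemma L2_integrable:
  fixes f :: "real^'d \<Rightarrow> real"
  assumes "S \<in> lmeasurable" "f \<in> L2 S" shows "integrable (lebesgue_on S) f"
  using L2_inner_integrable[OF assms(2) L2_const[OF assms(1), of 1]] by simp

lemma L2_cong_AE:
  assumes "f \<in> L2 S" and eq: "AE x in lebesgue_on S. g x = f x" and S: "S \<in> sets lebesgue"
  shows "g \<in> L2 S"
proof -
  have f: "f \<in> borel_measurable (lebesgue_on S)" and i: "integrable (lebesgue_on S) (\<lambda>x. (norm (f x))\<^sup>2)"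
    using assms(1) by (auto simp: L2_def)
  have "(\<lambda>x. indicator S x *\<^sub>R f x) \<in> borel_measurable lebesgue"
    using f S by (subst (asm) borel_measurable_restrict_space_iff) auto
  moreover have "AE x in lebesgue. x \<in> S \<longrightarrow> g x = f x"
    using eq S by (subst (asm) AE_restrict_space_iff) auto
  then have "AE x in lebesgue. indicator S x *\<^sub>R f x = indicator S x *\<^sub>R g x"
    by eventually_elim (auto simp: indicator_def)
  ultimately have "(\<lambda>x. indicator S x *\<^sub>R g x) \<in> borel_measurable lebesgue"
    by (rule borel_measurable_AE)
  then have g: "g \<in> borel_measurable (lebesgue_on S)"
    using S by (subst borel_measurable_restrict_space_iff) auto
  have "integrable (lebesgue_on S) (\<lambda>x. (norm (g x))\<^sup>2)"
  proof (rule integrable_cong_AE_imp[OF i])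
    show "(\<lambda>x. (norm (g x))\<^sup>2) \<in> borel_measurable (lebesgue_on S)" using g by measurable
    show "AE x in lebesgue_on S. (norm (f x))\<^sup>2 = (norm (g x))\<^sup>2" using eq by eventually_elim simp
  qed
  then show ?thesis using g by (simp add: L2_def)
qed

lemma ip_commute: "ip S f g = ip S g f"
  by (simp add: ip_def inner_commute)

lemma ip_add_left: "f \<in> L2 S \<Longrightarrow> g \<in> L2 S \<Longrightarrow> h \<in> L2 S \<Longrightarrow> ip S (\<lambda>x. f x + g x) h = ip S f h + ip S g h"
  unfolding ip_def by (simp add: inner_add_left L2_inner_integrable)

lemma ip_diff_left: "f \<in> L2 S \<Longrightarrow> g \<in> L2 S \<Longrightarrow> h \<in> L2 S \<Longrightarrow> ip S (\<lambda>x. f x - g x) h = ip S f h - ip S g h"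
  unfolding ip_def by (simp add: inner_diff_left L2_inner_integrable)

lemma ip_diff_right: "f \<in> L2 S \<Longrightarrow> g \<in> L2 S \<Longrightarrow> h \<in> L2 S \<Longrightarrow> ip S h (\<lambda>x. f x - g x) = ip S h f - ip S h g"
  unfolding ip_def by (simp add: inner_diff_right L2_inner_integrable)

lemma ip_scaleR_left: "ip S (\<lambda>x. c *\<^sub>R f x) h = c * ip S f h"
  unfolding ip_def by simp

lemma ip_sum_right:
  "finite I \<Longrightarrow> (\<And>i. i \<in> I \<Longrightarrow> f i \<in> L2 S) \<Longrightarrow> h \<in> L2 S \<Longrightarrow> ip S h (\<lambda>x. \<Sum>i\<in>I. f i x) = (\<Sum>i\<in>I. ip S h (f i))"
  unfolding ip_def by (simp add: inner_sum_right L2_inner_integrable)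

lemma ip_cong_AE:
  assumes "AE x in lebesgue_on S. f x = f' x" "AE x in lebesgue_on S. g x = g' x"
    "f \<in> L2 S" "f' \<in> L2 S" "g \<in> L2 S" "g' \<in> L2 S"
  shows "ip S f g = ip S f' g'"
  unfolding ip_def
proof (rule integral_cong_AE)
  show "AE x in lebesgue_on S. f x \<bullet> g x = f' x \<bullet> g' x" using assms(1,2) by eventually_elim simp
qed (use assms(3-) in \<open>auto simp: L2_def intro!: borel_measurable_inner\<close>)

lemma ip_self_nonneg: "ip S f f \<ge> 0"
  unfolding ip_def by (intro Bochner_Integration.integral_nonneg) auto

lemma ip_self_zero_imp_AE_zero:
  assumes "f \<in> L2 S" "ip S f f = 0" shows "AE x in lebesgue_on S. f x = 0"
proof -
  have "AE x in lebesgue_on S. f x \<bullet> f x = 0"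
    using integral_nonneg_eq_0_iff_AE[OF L2_inner_integrable[OF assms(1) assms(1)]] assms(2)
    by (simp add: ip_def)
  then show ?thesis by simp
qed

text \<open>
  Gram-Schmidt, one function at a time. A new function is first made orthogonal to the previous ones;
  the coefficient \<open>t\<close> of the remainder is a quotient that is \<open>0\<close> by convention when the remainder
  has norm zero, in which case there is nothing to subtract.
\<close>

lemma ex_orthogonal_projection:
  fixes B :: "(real^'d \<Rightarrow> real) set"
  assumes "finite B" "B \<subseteq> L2 S" "\<phi> \<in> L2 S"
  shows "\<exists>c. \<forall>b\<in>B. ip S (\<lambda>x. \<phi> x - (\<Sum>b\<in>B. c b * b x)) b = 0"
  using assms
proof (induction B arbitrary: \<phi> rule: finite_induct)
  case (insert b0 B)
  have b0: "b0 \<in> L2 S" and B: "B \<subseteq> L2 S" using insert.prems by auto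
  have comb: "(\<lambda>x. \<Sum>b\<in>B. a b * b x) \<in> L2 S" for a
    by (rule L2_sum[OF insert.hyps(1)]) (use B L2_cmult in blast)
  obtain c where c: "\<And>b. b \<in> B \<Longrightarrow> ip S (\<lambda>x. \<phi> x - (\<Sum>b\<in>B. c b * b x)) b = 0"
    using insert.IH[OF B insert.prems(2)] by blast
  obtain e where e: "\<And>b. b \<in> B \<Longrightarrow> ip S (\<lambda>x. b0 x - (\<Sum>b\<in>B. e b * b x)) b = 0"
    using insert.IH[OF B b0] by blast
  define r where "r x = \<phi> x - (\<Sum>b\<in>B. c b * b x)" for x
  define b' where "b' x = b0 x - (\<Sum>b\<in>B. e b * b x)" for x
  define t where "t = ip S r b' / ip S b' b'"
  have rL: "r \<in> L2 S" unfolding r_def[abs_def] by (intro L2_diff insert.prems comb)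
  have bL: "b' \<in> L2 S" unfolding b'_def[abs_def] by (intro L2_diff b0 comb)
  define r' where "r' x = r x - t *\<^sub>R b' x" for x
  have r'L: "r' \<in> L2 S" unfolding r'_def[abs_def] by (intro L2_diff L2_scaleR rL bL)
  have r'B: "ip S r' b = 0" if "b \<in> B" for b
  proof -
    have "ip S r' b = ip S r b - t * ip S b' b"
      unfolding r'_def[abs_def] using rL bL that B
      by (subst ip_diff_left) (auto intro: L2_cmult simp: ip_scaleR_left[of S t b', simplified])
    then show ?thesis using c[OF that] e[OF that] by (simp add: r_def[abs_def] b'_def[abs_def])
  qed
  have r'b': "ip S r' b' = 0"
  proof -
    have "ip S r' b' = ip S r b' - t * ip S b' b'"
      unfolding r'_def[abs_def] using rL bL
      by (subst ip_diff_left) (auto intro: L2_cmult simp: ip_scaleR_left[of S t b', simplified])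
    also have "\<dots> = 0"
    proof (cases "ip S b' b' = 0")
      case True
      have "ip S r b' = ip S r (\<lambda>x. 0)"
        by (rule ip_cong_AE) (use ip_self_zero_imp_AE_zero[OF bL True] rL bL L2_zero in auto)
      then show ?thesis using True by (simp add: ip_def)
    qed (simp add: t_def)
    finally show ?thesis .
  qed
  have r'b0: "ip S r' b0 = 0"
  proof -
    have "ip S r' b0 - ip S r' (\<lambda>x. \<Sum>b\<in>B. e b * b x) = 0"
      using r'b' ip_diff_right[OF b0 comb[of e] r'L] by (simp add: b'_def[abs_def])
    moreover have "ip S r' (\<lambda>x. \<Sum>b\<in>B. e b * b x) = (\<Sum>b\<in>B. ip S r' (\<lambda>x. e b * b x))"
      using insert.hyps B r'L by (intro ip_sum_right) (auto intro: L2_cmult)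
    moreover have "\<dots> = 0"
      using r'B ip_scaleR_left[of S _ _ r'] by (intro sum.neutral ballI) (simp add: ip_commute[of S r'])
    ultimately show ?thesis by simp
  qed
  define a where "a b = (if b = b0 then t else c b - t * e b)" for b
  have "(\<lambda>x. \<phi> x - (\<Sum>b\<in>insert b0 B. a b * b x)) = r'"
  proof
    fix x
    have "(\<Sum>b\<in>insert b0 B. a b * b x) = t * b0 x + (\<Sum>b\<in>B. (c b - t * e b) * b x)"
      using insert.hyps by (auto simp: a_def intro!: sum.cong)
    then show "\<phi> x - (\<Sum>b\<in>insert b0 B. a b * b x) = r' x"
      by (simp add: r'_def r_def b'_def algebra_simps sum_subtractf sum_distrib_left)
  qed
  then show ?case using r'B r'b0 by (intro exI[of _ a]) auto
qed auto

section \<open>Gradients of test functions\<close>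

lemma test_function_gradient:
  fixes w :: "real^'d \<Rightarrow> real"
  assumes "w \<in> test_functions U"
  shows "(w has_derivative (\<lambda>h. grad w x \<bullet> h)) (at x)" "continuous_on UNIV (grad w)"
    "compact (closure {x. w x \<noteq> 0})" "closure {x. w x \<noteq> 0} \<subseteq> U"
proof -
  have C: "C_times m w" for m using assms by (simp add: test_functions_def)
  have dw: "w differentiable at x" for x using C[of 1] by simp
  show "(w has_derivative (\<lambda>h. grad w x \<bullet> h)) (at x)"
  proof -
    have l: "linear (frechet_derivative w (at x))" by (rule linear_frechet_derivative[OF dw])
    have "frechet_derivative w (at x) = (\<lambda>h. grad w x \<bullet> h)"
    proof
      fix h
      have "frechet_derivative w (at x) h = frechet_derivative w (at x) (\<Sum>i\<in>UNIV. h $ i *\<^sub>R axis i 1)"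
        using basis_expansion[of h] by (simp add: scalar_mult_eq_scaleR)
      also have "\<dots> = grad w x \<bullet> h"
        by (simp add: linear_sum[OF l] linear_cmul[OF l] grad_def inner_vec_def mult.commute)
      finally show "frechet_derivative w (at x) h = grad w x \<bullet> h" .
    qed
    then show ?thesis using frechet_derivative_works[THEN iffD1, OF dw[of x]] by simp
  qed
  have "continuous_on UNIV (\<lambda>x. \<chi> i. grad w x $ i)"
    using C[of 1] by (intro continuous_on_vec_lambda) auto
  then show "continuous_on UNIV (grad w)" by simp
  show "compact (closure {x. w x \<noteq> 0})" "closure {x. w x \<noteq> 0} \<subseteq> U" using assms by (auto simp: test_functions_def)
qed

lemma cball_eq_cone:
  fixes a :: "'a::euclidean_space"
  assumes "R > 0" shows "cball a R = apex_cone a (sphere a R)"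
proof
  show "apex_cone a (sphere a R) \<subseteq> cball a R"
    by (auto simp: apex_cone_def dist_norm norm_minus_commute mult_left_le_one_le)
  show "cball a R \<subseteq> apex_cone a (sphere a R)"
  proof
    fix x assume x: "x \<in> cball a R"
    show "x \<in> apex_cone a (sphere a R)"
    proof (cases "x = a")
      case True
      obtain y where "y \<in> sphere a R" using vector_choose_dist[of R a] assms by (auto simp: sphere_def)
      then show ?thesis unfolding apex_cone_def True by (intro image_eqI[where x = "(0, y)"]) auto
    next
      case False
      define y where "y = a + (R / norm (x - a)) *\<^sub>R (x - a)"
      have "y \<in> sphere a R" using False assms by (simp add: y_def dist_norm)
      moreover have "x = a + (norm (x - a) / R) *\<^sub>R (y - a)" using False assms by (simp add: y_def)
      moreover have "norm (x - a) / R \<in> {0..1}" using x assms by (simp add: dist_norm norm_minus_commute)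
      ultimately show ?thesis unfolding apex_cone_def by (intro image_eqI[where x = "(norm (x - a) / R, y)"]) auto
    qed
  qed
qed

text \<open>
  The fields \<open>x - a\<close> and \<open>x - b\<close> differ by a constant vector, so subtracting the cone identities for
  the apexes \<open>a\<close> and \<open>b\<close> leaves the derivative in the direction \<open>b - a\<close>. For a simplex with vertices
  \<open>a, b\<close> the two bases are the facets that do not contain the edge.
\<close>

lemma cone_gradient_two_apexes:
  fixes a b :: "'a::euclidean_space" and G :: "'a \<Rightarrow> real"
  assumes Z: "compact Z" "compact W" "S = apex_cone a Z" "S = apex_cone b W"
    and G: "\<And>x. (G has_derivative (\<lambda>h. G' x \<bullet> h)) (at x)" and G': "continuous_on UNIV G'"
    and G0: "\<And>y. y \<in> Z \<union> W \<Longrightarrow> G y = 0"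
  shows "(LINT x|lebesgue_on S. G' x \<bullet> (b - a)) = 0"
proof -
  have cS: "compact S" using Z compact_cone by blast
  have cG: "continuous_on UNIV G"
    by (rule has_derivative_imp_continuous_on[OF G])
  have i: "integrable (lebesgue_on S) (\<lambda>x. real DIM('a) * G x + G' x \<bullet> (x - c))" for c
    by (intro integrable_on_compact cS continuous_intros continuous_on_subset[OF cG] continuous_on_subset[OF G']) auto
  have "(LINT x|lebesgue_on S. real DIM('a) * G x + G' x \<bullet> (x - a)) = 0"
    unfolding Z(3) by (rule cone_divergence[OF Z(1) G G']) (use G0 in auto)
  moreover have "(LINT x|lebesgue_on S. real DIM('a) * G x + G' x \<bullet> (x - b)) = 0"
    unfolding Z(4) by (rule cone_divergence[OF Z(2) G G']) (use G0 in auto)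
  ultimately have "(LINT x|lebesgue_on S. (real DIM('a) * G x + G' x \<bullet> (x - a)) - (real DIM('a) * G x + G' x \<bullet> (x - b))) = 0"
    using Bochner_Integration.integral_diff[OF i i, of a b] by simp
  then show ?thesis by (simp add: inner_diff_right)
qed

lemma gradient_zero_outside:
  assumes "closed K" "\<And>x. x \<notin> K \<Longrightarrow> G x = 0" "(G has_derivative (\<lambda>h. G' \<bullet> h)) (at x)" "x \<notin> K"
  shows "G' = (0 :: 'a::euclidean_space)"
proof -
  have "((\<lambda>x. 0 :: real) has_derivative (\<lambda>h. G' \<bullet> h)) (at x)"
    by (rule has_derivative_transform_within_open[OF assms(3), of "- K"]) (use assms in auto)
  then have "(\<lambda>h. G' \<bullet> h) = (\<lambda>h. 0)" using has_derivative_const has_derivative_unique by blast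
  then show ?thesis by (metis inner_eq_zero_iff)
qed

text \<open>
  Two balls with different centres that both contain the support are cones over their spheres, so the
  difference of the two cone identities applies here as well.
\<close>

lemma gradient_integral_compact_support:
  fixes G :: "'a::euclidean_space \<Rightarrow> real"
  assumes K: "compact K" "\<And>x. x \<notin> K \<Longrightarrow> G x = 0"
    and G: "\<And>x. (G has_derivative (\<lambda>h. G' x \<bullet> h)) (at x)" and G': "continuous_on UNIV G'"
    and S: "S \<in> sets borel" "K \<subseteq> S"
  shows "(LINT x|lebesgue_on S. G' x \<bullet> t) = 0"
proof -
  let ?I = "\<lambda>D c. LINT x|lebesgue_on D. real DIM('a) * G x + G' x \<bullet> (x - c)"
  have G'0: "G' x = 0" if "x \<notin> K" for x
    by (rule gradient_zero_outside[OF compact_imp_closed[OF K(1)] K(2) G that])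
  have cG: "continuous_on UNIV G"
    by (rule has_derivative_imp_continuous_on[OF G])
  obtain R where R: "R > 0" "K \<subseteq> ball 0 R"
    using bounded_subset_ballD[OF compact_imp_bounded[OF K(1)]] by blast
  \<comment> \<open>Large enough for the ball around \<open>t\<close> to contain the support as well.\<close>
  define R' where "R' = R + norm t"
  have R': "R' > 0" "K \<subseteq> ball 0 R'" "K \<subseteq> ball t R'"
  proof -
    show "R' > 0" "K \<subseteq> ball 0 R'" using R norm_ge_zero[of t] by (auto simp: R'_def subset_iff intro: add_pos_nonneg less_le_trans)
    show "K \<subseteq> ball t R'"
    proof
      fix x assume "x \<in> K"
      then have "norm x < R" using R by auto
      then show "x \<in> ball t R'" using norm_triangle_ineq4[of t x] by (simp add: R'_def dist_norm)
    qed
  qed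
  have on_K: "?I D c = ?I K c" if "K \<subseteq> D" "D \<in> sets borel" for D c
    by (rule LINT_support) (use that K(2) G'0 borel_compact[OF K(1)] in auto)
  have *: "?I K c = 0" if c: "K \<subseteq> ball c R'" for c
  proof -
    have "?I (apex_cone c (sphere c R')) c = 0"
      by (rule cone_divergence[OF _ G G']) (use K(2) c in \<open>auto simp: subset_iff\<close>)
    then show ?thesis
      using on_K[of "cball c R'" c] c R'(1) by (simp add: cball_eq_cone[symmetric]) (metis ball_subset_cball order_trans)
  qed
  have i: "integrable (lebesgue_on K) (\<lambda>x. real DIM('a) * G x + G' x \<bullet> (x - c))" for c
    by (intro integrable_on_compact K continuous_intros continuous_on_subset[OF cG] continuous_on_subset[OF G']) auto
  have "(LINT x|lebesgue_on K. (real DIM('a) * G x + G' x \<bullet> (x - 0)) - (real DIM('a) * G x + G' x \<bullet> (x - t))) = 0"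
    using Bochner_Integration.integral_diff[OF i i, of 0 t] *[of 0] *[of t] R' by simp
  then have "(LINT x|lebesgue_on K. G' x \<bullet> t) = 0" by (simp add: inner_diff_right)
  moreover have "(LINT x|lebesgue_on S. G' x \<bullet> t) = (LINT x|lebesgue_on K. G' x \<bullet> t)"
    by (rule LINT_support) (use S G'0 borel_compact[OF K(1)] in auto)
  ultimately show ?thesis by simp
qed

section \<open>Geometry of the mesh\<close>

lemma negligible_if_aff_dim_less:
  fixes S :: "'a::euclidean_space set"
  assumes "aff_dim S < int DIM('a)" shows "negligible S"
proof -
  obtain a b where "a \<noteq> 0" "S \<subseteq> {x. a \<bullet> x = b}" using aff_lowdim_subset_hyperplane[OF assms] by blast
  then show ?thesis using negligible_hyperplane[of a b] negligible_subset by blast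
qed

text \<open>
  Equality almost everywhere extends to every point, because a nonempty open set is not negligible and
  the interior of \<open>T\<close> is dense in \<open>T\<close>.
\<close>

lemma continuous_AE_eq_imp_eq:
  fixes f g :: "'a::euclidean_space \<Rightarrow> 'b::real_normed_vector"
  assumes T: "convex T" "interior T \<noteq> {}" "T \<in> sets lebesgue"
    and c: "continuous_on UNIV f" "continuous_on UNIV g"
    and ae: "AE x in lebesgue_on T. f x = g x" and x: "x \<in> T"
  shows "f x = g x"
proof -
  have cl: "closed {x. f x = g x}" by (rule closed_Collect_eq[OF c])
  have "open (interior T \<inter> - {x. f x = g x})" using cl by auto
  moreover have "negligible (interior T \<inter> - {x. f x = g x})"
    using ae T(3) interior_subset[of T]
    by (auto simp: AE_lebesgue_on_iff_negligible elim!: negligible_subset)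
  ultimately have "interior T \<inter> - {x. f x = g x} = {}" using open_not_negligible by blast
  then have "interior T \<subseteq> {x. f x = g x}" by auto
  then have "closure (interior T) \<subseteq> {x. f x = g x}" using cl by (rule closure_minimal)
  moreover have "x \<in> closure (interior T)"
    using convex_closure_interior[OF T(1,2)] x closure_subset by auto
  ultimately show ?thesis by auto
qed

lemma negligible_finite_UN: "finite I \<Longrightarrow> (\<And>i. i \<in> I \<Longrightarrow> negligible (A i)) \<Longrightarrow> negligible (\<Union>i\<in>I. A i)"
  by (rule negligible_Union) auto

locale mesh =
  fixes \<Omega> :: "(real^'d) set" and \<T> :: "(real^'d) set set"
  assumes domain: "polytopal_domain \<Omega>" and mesh: "simplicial_mesh \<Omega> \<T>"
begin

lemma finite_mesh: "finite \<T>"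
  and simplex_T: "T \<in> \<T> \<Longrightarrow> int CARD('d) simplex T"
  and face_Int: "T \<in> \<T> \<Longrightarrow> T' \<in> \<T> \<Longrightarrow> (T \<inter> T') face_of T"
  and Union_T: "\<Union>\<T> = closure \<Omega>"
  using mesh unfolding simplicial_mesh_def triangulation_def by blast+

lemma open_domain: "open \<Omega>" and bounded_domain: "bounded \<Omega>" and connected_domain: "connected \<Omega>"
  and domain_nonempty: "\<Omega> \<noteq> {}" and domain_regular: "interior (closure \<Omega>) = \<Omega>"
  using domain unfolding polytopal_domain_def by blast+

lemma domain_measurable [simp]: "\<Omega> \<in> lmeasurable" "\<Omega> \<in> sets lebesgue"
  using open_domain bounded_domain by (auto intro: lmeasurable_open)

lemma compact_T: "T \<in> \<T> \<Longrightarrow> compact T" and convex_T: "T \<in> \<T> \<Longrightarrow> convex T"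
  using simplex_T compact_simplex convex_simplex by blast+

lemma measurable_T: "T \<in> \<T> \<Longrightarrow> T \<in> sets borel" "T \<in> \<T> \<Longrightarrow> T \<in> sets lebesgue"
  using borel_compact[OF compact_T] by auto

lemma interior_T_nonempty: assumes "T \<in> \<T>" shows "interior T \<noteq> {}"
proof -
  have "aff_dim T = int DIM(real^'d)" using aff_dim_simplex[OF simplex_T[OF assms]] by simp
  moreover from this have "rel_interior T \<noteq> {}"
    using convex_T[OF assms] rel_interior_eq_empty by (metis aff_dim_empty_eq of_nat_0_le_iff neg_0_le_iff_le not_one_le_zero)
  ultimately show ?thesis by (simp add: interior_rel_interior_gen)
qed

lemma interior_T_subset: "T \<in> \<T> \<Longrightarrow> interior T \<subseteq> \<Omega>"
  using interior_mono[of T "closure \<Omega>"] Union_T domain_regular by blast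

lemma negligible_boundary_T: "T \<in> \<T> \<Longrightarrow> negligible (T - interior T)"
  using negligible_convex_frontier[OF convex_T, of T] compact_imp_closed[OF compact_T, of T]
  by (simp add: frontier_def)

lemma aff_dim_T_Int:
  assumes "T \<in> \<T>" "T' \<in> \<T>" "T \<noteq> T'" shows "aff_dim (T \<inter> T') < int CARD('d)"
proof -
  have *: "aff_dim (A \<inter> B) < int CARD('d)" if "A \<in> \<T>" "B \<in> \<T>" "A \<inter> B \<noteq> A" for A B
    using face_of_aff_dim_lt[OF convex_T[OF that(1)] face_Int[OF that(1,2)] that(3)]
      aff_dim_simplex[OF simplex_T[OF that(1)]] by simp
  have "T \<inter> T' \<noteq> T \<or> T' \<inter> T \<noteq> T'" using assms(3) by blast
  then show ?thesis using *[of T T'] *[of T' T] assms by (auto simp: Int_commute)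
qed

lemma negligible_T_Int: "T \<in> \<T> \<Longrightarrow> T' \<in> \<T> \<Longrightarrow> T \<noteq> T' \<Longrightarrow> negligible (T \<inter> T')"
  using aff_dim_T_Int by (intro negligible_if_aff_dim_less) simp

lemma negligible_T_minus_domain: "T \<in> \<T> \<Longrightarrow> negligible (T - \<Omega>)"
  using negligible_boundary_T interior_T_subset by (meson Diff_mono negligible_subset order_refl)

lemma domain_covered: "\<Omega> \<subseteq> \<Union>\<T>"
  using Union_T closure_subset by auto

text \<open>
  Simplices may stick out of the open domain only along their boundaries, which are negligible.
\<close>

lemma AE_domain_iff: "(AE x in lebesgue_on \<Omega>. P x) \<longleftrightarrow> (\<forall>T\<in>\<T>. AE x in lebesgue_on T. P x)"
proof
  assume l: "AE x in lebesgue_on \<Omega>. P x"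
  show "\<forall>T\<in>\<T>. AE x in lebesgue_on T. P x"
  proof
    fix T assume T: "T \<in> \<T>"
    have "negligible ({x \<in> \<Omega>. \<not> P x} \<union> (T - \<Omega>))"
      using l negligible_T_minus_domain[OF T] by (simp add: AE_lebesgue_on_iff_negligible)
    then have "negligible {x \<in> T. \<not> P x}" by (rule negligible_subset) blast
    then show "AE x in lebesgue_on T. P x" using measurable_T[OF T] by (simp add: AE_lebesgue_on_iff_negligible)
  qed
next
  assume r: "\<forall>T\<in>\<T>. AE x in lebesgue_on T. P x"
  have "negligible (\<Union>T\<in>\<T>. {x \<in> T. \<not> P x})"
    using r measurable_T by (intro negligible_finite_UN finite_mesh) (auto simp: AE_lebesgue_on_iff_negligible)
  then have "negligible {x \<in> \<Omega>. \<not> P x}" by (rule negligible_subset) (use domain_covered in blast)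
  then show "AE x in lebesgue_on \<Omega>. P x" by (simp add: AE_lebesgue_on_iff_negligible)
qed

lemma LINT_T:
  fixes f :: "real^'d \<Rightarrow> real"
  assumes T: "T \<in> \<T>" and f: "integrable (lebesgue_on T) f"
  shows "integrable (lebesgue_on \<Omega>) (\<lambda>x. indicator T x * f x)"
    "(LINT x|lebesgue_on \<Omega>. indicator T x * f x) = (LINT x|lebesgue_on T. f x)"
proof -
  have i: "integrable lebesgue (\<lambda>x. indicator T x * f x)"
    using f measurable_T[OF T] by (simp add: integrable_lebesgue_on_eq)
  have ae: "AE x in lebesgue. indicator T x * f x = indicator \<Omega> x * (indicator T x * f x)"
  proof (rule AE_I')
    show "T - \<Omega> \<in> null_sets lebesgue" using negligible_T_minus_domain[OF T] by (simp add: negligible_iff_null_sets)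
  qed (auto simp: indicator_def split: if_splits)
  have m: "(\<lambda>x. indicator \<Omega> x * (indicator T x * f x)) \<in> borel_measurable lebesgue"
    by (intro borel_measurable_times borel_measurable_integrable[OF i] borel_measurable_indicator) simp
  have "integrable lebesgue (\<lambda>x. indicator \<Omega> x * (indicator T x * f x))"
    by (rule integrable_cong_AE_imp[OF i m ae])
  then show "integrable (lebesgue_on \<Omega>) (\<lambda>x. indicator T x * f x)"
    by (simp add: integrable_lebesgue_on_eq)
  have "(LINT x|lebesgue. indicator T x * f x) = (LINT x|lebesgue. indicator \<Omega> x * (indicator T x * f x))"
    by (rule integral_cong_AE[OF borel_measurable_integrable[OF i] m ae])
  then show "(LINT x|lebesgue_on \<Omega>. indicator T x * f x) = (LINT x|lebesgue_on T. f x)"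
    using measurable_T[OF T] by (simp add: LINT_lebesgue_on_eq)
qed

abbreviation glue :: "((real^'d) set \<Rightarrow> real^'d \<Rightarrow> 'b::real_vector) \<Rightarrow> real^'d \<Rightarrow> 'b" where
  "glue P x \<equiv> \<Sum>T\<in>\<T>. indicator T x *\<^sub>R P T x"

lemma glue_L2:
  fixes P :: "(real^'d) set \<Rightarrow> real^'d \<Rightarrow> 'b::euclidean_space"
  assumes "\<And>T. T \<in> \<T> \<Longrightarrow> continuous_on UNIV (P T)"
  shows "glue P \<in> L2 \<Omega>"
proof (rule L2_sum[OF finite_mesh])
  fix T assume T: "T \<in> \<T>"
  have "integrable (lebesgue_on T) (\<lambda>x. (norm (P T x))\<^sup>2)"
    by (intro integrable_on_compact compact_T T continuous_intros continuous_on_subset[OF assms[OF T]]) auto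
  from LINT_T(1)[OF T this] have "integrable (lebesgue_on \<Omega>) (\<lambda>x. (norm (indicator T x *\<^sub>R P T x))\<^sup>2)"
    by (rule Bochner_Integration.integrable_cong[THEN iffD1, rotated 2]) (auto simp: indicator_def)
  moreover have "(\<lambda>x. indicator T x *\<^sub>R P T x) \<in> borel_measurable (lebesgue_on \<Omega>)"
  proof -
    have [measurable]: "P T \<in> borel_measurable borel" "T \<in> sets borel"
      using assms[OF T] measurable_T[OF T] by (auto intro: borel_measurable_continuous_onI)
    have "(\<lambda>x. indicator T x *\<^sub>R P T x) \<in> borel_measurable lebesgue"
      by (rule measurable_completion) simp
    then show ?thesis by (rule measurable_restrict_space1)
  qed
  ultimately show "(\<lambda>x. indicator T x *\<^sub>R P T x) \<in> L2 \<Omega>" by (simp add: L2_def)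
qed

text \<open>
  The simplices overlap in null sets, so gluing by indicators recovers each piece almost everywhere.
\<close>

lemma glue_AE:
  fixes P :: "(real^'d) set \<Rightarrow> real^'d \<Rightarrow> 'b::real_vector"
  assumes T: "T \<in> \<T>"
  shows "AE x in lebesgue_on T. glue P x = P T x"
proof -
  have "negligible (\<Union>S\<in>\<T> - {T}. T \<inter> S)"
    using T finite_mesh negligible_T_Int by (intro negligible_finite_UN) auto
  moreover have "{x \<in> T. glue P x \<noteq> P T x} \<subseteq> (\<Union>S\<in>\<T> - {T}. T \<inter> S)"
  proof (rule subsetI, rule ccontr)
    fix x assume x: "x \<in> {x \<in> T. glue P x \<noteq> P T x}" "x \<notin> (\<Union>S\<in>\<T> - {T}. T \<inter> S)"
    have "glue P x = indicator T x *\<^sub>R P T x + (\<Sum>S\<in>\<T> - {T}. indicator S x *\<^sub>R P S x)"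
      by (rule sum.remove[OF finite_mesh T])
    also have "(\<Sum>S\<in>\<T> - {T}. indicator S x *\<^sub>R P S x) = 0"
      using x by (intro sum.neutral) auto
    finally show False using x by auto
  qed
  ultimately show ?thesis
    using measurable_T[OF T] by (simp add: AE_lebesgue_on_iff_negligible negligible_subset)
qed

lemma piecewise_continuous_L2:
  fixes f :: "real^'d \<Rightarrow> 'b::euclidean_space"
  assumes "\<And>T. T \<in> \<T> \<Longrightarrow> \<exists>p. continuous_on UNIV p \<and> (AE x in lebesgue_on T. f x = p x)"
  shows "f \<in> L2 \<Omega>"
proof -
  obtain P where P: "\<And>T. T \<in> \<T> \<Longrightarrow> continuous_on UNIV (P T)" "\<And>T. T \<in> \<T> \<Longrightarrow> AE x in lebesgue_on T. f x = P T x"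
    using assms by metis
  have "AE x in lebesgue_on \<Omega>. f x = glue P x"
    unfolding AE_domain_iff
  proof
    fix T assume T: "T \<in> \<T>"
    show "AE x in lebesgue_on T. f x = glue P x"
      using P(2)[OF T] glue_AE[OF T, of P] by eventually_elim simp
  qed
  from L2_cong_AE[OF glue_L2[of P, OF P(1)] this domain_measurable(2)] show ?thesis .
qed

lemma L2_restrict:
  fixes q :: "real^'d \<Rightarrow> 'b::euclidean_space"
  assumes T: "T \<in> \<T>" and q: "q \<in> L2 \<Omega>" shows "q \<in> L2 T"
proof -
  have m: "(\<lambda>x. indicator \<Omega> x *\<^sub>R q x) \<in> borel_measurable lebesgue"
    using q by (subst borel_measurable_restrict_space_iff[symmetric]) (auto simp: L2_def)
  have ae: "AE x in lebesgue. indicator T x *\<^sub>R (indicator \<Omega> x *\<^sub>R q x) = indicator T x *\<^sub>R q x"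
  proof (rule AE_I')
    show "T - \<Omega> \<in> null_sets lebesgue" using negligible_T_minus_domain[OF T] by (simp add: negligible_iff_null_sets)
  qed (auto simp: indicator_def split: if_splits)
  have "(\<lambda>x. indicator T x *\<^sub>R (indicator \<Omega> x *\<^sub>R q x)) \<in> borel_measurable lebesgue"
    using measurable_T[OF T] by (intro borel_measurable_scaleR borel_measurable_indicator m)
  from borel_measurable_AE[OF this ae] have mT: "q \<in> borel_measurable (lebesgue_on T)"
    using measurable_T[OF T] by (subst borel_measurable_restrict_space_iff) auto
  have i: "integrable lebesgue (\<lambda>x. indicator \<Omega> x *\<^sub>R (norm (q x))\<^sup>2)"
    using q by (subst integrable_lebesgue_on_eq[symmetric]) (auto simp: L2_def)
  have "integrable lebesgue (\<lambda>x. indicator T x *\<^sub>R (indicator \<Omega> x *\<^sub>R (norm (q x))\<^sup>2))"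
    using measurable_T[OF T] by (intro integrable_mult_indicator i)
  then have "integrable lebesgue (\<lambda>x. indicator T x *\<^sub>R (norm (q x))\<^sup>2)"
  proof (rule integrable_cong_AE_imp)
    show "AE x in lebesgue. indicator T x *\<^sub>R (indicator \<Omega> x *\<^sub>R (norm (q x))\<^sup>2) = indicator T x *\<^sub>R (norm (q x))\<^sup>2"
      using ae by eventually_elim (auto simp: indicator_def split: if_splits)
    have "(\<lambda>x. (norm (q x))\<^sup>2) \<in> borel_measurable (lebesgue_on T)" using mT by measurable
    then show "(\<lambda>x. indicator T x *\<^sub>R (norm (q x))\<^sup>2) \<in> borel_measurable lebesgue"
      using measurable_T[OF T] by (subst (asm) borel_measurable_restrict_space_iff) auto
  qed
  then show ?thesis
    using mT measurable_T[OF T] by (simp add: L2_def integrable_lebesgue_on_eq)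
qed

lemma ip_glue:
  fixes P :: "(real^'d) set \<Rightarrow> real^'d \<Rightarrow> 'b::euclidean_space"
  assumes "\<And>T. T \<in> \<T> \<Longrightarrow> continuous_on UNIV (P T)" and q: "q \<in> L2 \<Omega>"
  shows "ip \<Omega> (glue P) q = (\<Sum>T\<in>\<T>. ip T (P T) q)"
proof -
  have i: "integrable (lebesgue_on T) (\<lambda>x. P T x \<bullet> q x)" if "T \<in> \<T>" for T
    by (rule L2_inner_integrable[OF continuous_in_L2[OF compact_T[OF that]
          continuous_on_subset[OF assms(1)[OF that] subset_UNIV]] L2_restrict[OF that q]])
  have "ip \<Omega> (glue P) q = (LINT x|lebesgue_on \<Omega>. (\<Sum>T\<in>\<T>. indicator T x * (P T x \<bullet> q x)))"
    unfolding ip_def by (simp add: inner_sum_left)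
  also have "\<dots> = (\<Sum>T\<in>\<T>. LINT x|lebesgue_on \<Omega>. indicator T x * (P T x \<bullet> q x))"
    by (rule Bochner_Integration.integral_sum) (use LINT_T(1) i in auto)
  also have "\<dots> = (\<Sum>T\<in>\<T>. ip T (P T) q)"
    unfolding ip_def using LINT_T(2) i by (intro sum.cong) auto
  finally show ?thesis .
qed

section \<open>Weak divergences of piecewise polynomials\<close>

lemma grad_test_L2: "w \<in> test_functions U \<Longrightarrow> grad w \<in> L2 \<Omega>" and test_L2: "w \<in> test_functions U \<Longrightarrow> w \<in> L2 \<Omega>"
proof -
  assume w: "w \<in> test_functions U"
  have c: "continuous_on UNIV w"
    by (rule has_derivative_imp_continuous_on[OF test_function_gradient(1)[OF w]])
  show "w \<in> L2 \<Omega>" by (rule piecewise_continuous_L2) (use c in \<open>auto intro!: exI[of _ w]\<close>)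
  show "grad w \<in> L2 \<Omega>"
    by (rule piecewise_continuous_L2) (use test_function_gradient(2)[OF w] in \<open>auto intro!: exI[of _ "grad w"]\<close>)
qed

lemma is_weak_div_unique:
  assumes "is_weak_div \<Omega> v g" "is_weak_div \<Omega> v g'" shows "AE x in lebesgue_on \<Omega>. g x = g' x"
proof -
  have L: "g \<in> L2 \<Omega>" "g' \<in> L2 \<Omega>" using assms by (auto simp: is_weak_div_def)
  have "AE x in lebesgue_on \<Omega>. g x - g' x = 0"
  proof (rule fundamental_lemma_variations[OF open_domain])
    show "integrable (lebesgue_on \<Omega>) (\<lambda>x. g x - g' x)" by (intro L2_integrable L2_diff L) simp
    fix w assume w: "w \<in> test_functions \<Omega>"
    have "ip \<Omega> (\<lambda>x. g x - g' x) w = ip \<Omega> g w - ip \<Omega> g' w" by (rule ip_diff_left[OF L test_L2[OF w]])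
    also have "\<dots> = 0" using assms w by (simp add: is_weak_div_def)
    finally show "(LINT x|lebesgue_on \<Omega>. (g x - g' x) * w x) = 0" by (simp add: ip_def)
  qed
  then show ?thesis by simp
qed

lemma is_weak_div_weak_div: "is_weak_div \<Omega> v g \<Longrightarrow> is_weak_div \<Omega> v (weak_div \<Omega> v)"
  unfolding weak_div_def by (rule someI[where P = "is_weak_div \<Omega> v"])

lemma test_functions_mono: "U \<subseteq> V \<Longrightarrow> test_functions U \<subseteq> test_functions V"
  by (auto simp: test_functions_def)

text \<open>
  A criterion for membership in \<open>V_h\<close> that never mentions traces: it suffices that \<open>D\<close> satisfies
  Green's formula against all smooth functions, not only those supported in \<open>\<Omega>\<close>. The formula then
  expresses at once that \<open>D\<close> is the weak divergence and that the normal trace is zero.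
\<close>

lemma V_h_glue:
  assumes P: "\<And>T. T \<in> \<T> \<Longrightarrow> P T \<in> Polys (k + 1) UNIV" and D: "\<And>T. T \<in> \<T> \<Longrightarrow> continuous_on UNIV (D T)"
    and test: "\<And>w. w \<in> test_functions UNIV \<Longrightarrow> (\<Sum>T\<in>\<T>. LINT x|lebesgue_on T. P T x \<bullet> grad w x + D T x * w x) = 0"
  defines "v \<equiv> glue P"
  shows "v \<in> V_h k \<Omega> \<T>" "\<And>q. q \<in> L2 \<Omega> \<Longrightarrow> ip \<Omega> (weak_div \<Omega> v) q = (\<Sum>T\<in>\<T>. ip T (D T) q)"
proof -
  have cP: "continuous_on UNIV (P T)" if "T \<in> \<T>" for T using continuous_on_Polys[OF P[OF that]] .
  define g where "g x = glue D x" for x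
  have vL: "v \<in> L2 \<Omega>" unfolding v_def by (rule glue_L2[OF cP])
  have gL: "g \<in> L2 \<Omega>" unfolding g_def[abs_def] by (rule glue_L2[OF D])
  have green: "ip \<Omega> v (grad w) + ip \<Omega> g w = 0" if w: "w \<in> test_functions UNIV" for w
  proof -
    have "ip \<Omega> v (grad w) + ip \<Omega> g w = (\<Sum>T\<in>\<T>. ip T (P T) (grad w) + ip T (D T) w)"
      unfolding v_def g_def[abs_def] using ip_glue[OF cP grad_test_L2[OF w]] ip_glue[OF D test_L2[OF w]]
      by (simp add: sum.distrib)
    also have "\<dots> = (\<Sum>T\<in>\<T>. LINT x|lebesgue_on T. P T x \<bullet> grad w x + D T x * w x)"
    proof (rule sum.cong[OF refl])
      fix T assume T: "T \<in> \<T>"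
      have "integrable (lebesgue_on T) (\<lambda>x. P T x \<bullet> grad w x)" "integrable (lebesgue_on T) (\<lambda>x. D T x \<bullet> w x)"
        by (intro L2_inner_integrable L2_restrict[OF T] grad_test_L2[OF w] test_L2[OF w] continuous_in_L2 compact_T T
              continuous_on_subset[OF cP[OF T]] continuous_on_subset[OF D[OF T]]; simp)+
      then show "ip T (P T) (grad w) + ip T (D T) w = (LINT x|lebesgue_on T. P T x \<bullet> grad w x + D T x * w x)"
        by (simp add: ip_def)
    qed
    finally show ?thesis using test[OF w] by simp
  qed
  have wd: "is_weak_div \<Omega> v g"
    unfolding is_weak_div_def using gL green test_functions_mono[of \<Omega> UNIV]
    by (auto simp: eq_neg_iff_add_eq_0 add.commute)
  have ae: "AE x in lebesgue_on \<Omega>. weak_div \<Omega> v x = g x"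
    using is_weak_div_unique[OF is_weak_div_weak_div[OF wd] wd] .
  have wL: "weak_div \<Omega> v \<in> L2 \<Omega>" using is_weak_div_weak_div[OF wd] by (simp add: is_weak_div_def)
  have eq: "ip \<Omega> (weak_div \<Omega> v) q = ip \<Omega> g q" if "q \<in> L2 \<Omega>" for q
    by (rule ip_cong_AE[OF ae _ wL gL that that]) simp
  then show "ip \<Omega> (weak_div \<Omega> v) q = (\<Sum>T\<in>\<T>. ip T (D T) q)" if "q \<in> L2 \<Omega>" for q
    using ip_glue[OF D that] that by (simp add: g_def[abs_def])
  have "v \<in> H0_div \<Omega>"
    unfolding H0_div_def H_div_def normal_trace_def using vL wd green eq test_L2 by auto
  moreover have "restr_in T v (Polys (k + 1) UNIV)" if "T \<in> \<T>" for T
    unfolding restr_in_def v_def using glue_AE[OF that, of P] P[OF that] by blast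
  ultimately show "v \<in> V_h k \<Omega> \<T>" by (simp add: V_h_def)
qed

end

lemma integrable_compact_support:
  fixes f :: "'a::euclidean_space \<Rightarrow> real"
  assumes "compact K" "continuous_on UNIV f" "\<And>x. x \<notin> K \<Longrightarrow> f x = 0" "S \<in> sets lebesgue"
  shows "integrable (lebesgue_on S) f"
proof -
  have "integrable (lebesgue_on K) f"
    by (intro integrable_on_compact assms(1) continuous_on_subset[OF assms(2)]) simp
  then have "integrable lebesgue (\<lambda>x. indicator K x *\<^sub>R f x)"
    using borel_compact[OF assms(1)] by (subst (asm) integrable_lebesgue_on_eq) auto
  moreover have "(\<lambda>x. indicator K x *\<^sub>R f x) = f" using assms(3) by (auto simp: indicator_def fun_eq_iff)
  ultimately have "integrable lebesgue f" by (simp only:)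
  then have "integrable lebesgue (\<lambda>x. indicator S x *\<^sub>R f x)"
    by (rule integrable_mult_indicator[OF assms(4)])
  then show ?thesis using assms(4) by (simp add: integrable_lebesgue_on_eq)
qed

lemma test_function_support:
  assumes w: "w \<in> test_functions U" and x: "x \<notin> closure {x. w x \<noteq> 0}"
  shows "w x = 0" "grad w x = 0"
proof -
  have *: "w y = 0" if "y \<notin> closure {x. w x \<noteq> 0}" for y
    using that closure_subset[of "{x. w x \<noteq> 0}"] by auto
  show "w x = 0" by (rule *[OF x])
  show "grad w x = 0"
    by (rule gradient_zero_outside[OF closed_closure * test_function_gradient(1)[OF w] x])
qed

text \<open>
  Integration by parts against functions supported inside \<open>U\<close>, one coordinate direction at a time. The
  degree of the divergence drops by one; this is what keeps \<open>div V_h\<close> inside the pressure space.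
\<close>

lemma Polys_divergence:
  fixes p :: "real^'d \<Rightarrow> real^'d"
  assumes p: "p \<in> Polys m UNIV"
  obtains D where "D \<in> Polys (m - 1) UNIV"
    "\<And>U w. open U \<Longrightarrow> w \<in> test_functions U \<Longrightarrow> (LINT x|lebesgue_on U. p x \<bullet> grad w x + D x * w x) = 0"
proof -
  have "\<exists>p'. p' \<in> Polys (m - 1) UNIV \<and> (\<forall>x. ((\<lambda>x. p x $ i) has_derivative (\<lambda>h. p' x \<bullet> h)) (at x))" for i
    by (rule Polys_has_gradient[OF Polys_linear[OF bounded_linear.linear[OF bounded_linear_vec_nth] p], of i]) blast
  then obtain p' where p': "\<And>i. p' i \<in> Polys (m - 1) UNIV"
      "\<And>i x. ((\<lambda>x. p x $ i) has_derivative (\<lambda>h. p' i x \<bullet> h)) (at x)" by metis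
  define D where "D x = (\<Sum>i\<in>UNIV. p' i x $ i)" for x
  show ?thesis
  proof
    show "D \<in> Polys (m - 1) UNIV"
      unfolding D_def using Polys_linear[OF bounded_linear.linear[OF bounded_linear_vec_nth] p'(1)]
      by (intro Polys_sum) auto
    fix U :: "(real^'d) set" and w assume U: "open U" and w: "w \<in> test_functions U"
    note gw = test_function_gradient[OF w]
    have cw: "continuous_on UNIV w"
      by (rule has_derivative_imp_continuous_on[OF gw(1)])
    have cp: "continuous_on UNIV (\<lambda>x. p x $ i)" for i
      by (intro continuous_intros continuous_on_Polys[OF p])
    have "(LINT x|lebesgue_on U. (p x $ i *\<^sub>R grad w x + w x *\<^sub>R p' i x) \<bullet> axis i 1) = 0" for i
    proof (rule gradient_integral_compact_support[OF gw(3)])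
      show "p x $ i * w x = 0" if "x \<notin> closure {x. w x \<noteq> 0}" for x
        using that closure_subset[of "{x. w x \<noteq> 0}"] by auto
      show "((\<lambda>x. p x $ i * w x) has_derivative (\<lambda>h. (p x $ i *\<^sub>R grad w x + w x *\<^sub>R p' i x) \<bullet> h)) (at x)" for x
        by (rule has_derivative_eq_rhs[OF has_derivative_mult[OF p'(2) gw(1)]])
           (auto simp: inner_add_left algebra_simps)
      show "continuous_on UNIV (\<lambda>x. p x $ i *\<^sub>R grad w x + w x *\<^sub>R p' i x)"
        by (intro continuous_intros cp gw(2) cw continuous_on_Polys[OF p'(1)])
    qed (use U gw(4) in auto)
    moreover have "integrable (lebesgue_on U) (\<lambda>x. (p x $ i *\<^sub>R grad w x + w x *\<^sub>R p' i x) \<bullet> axis i 1)" for i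
    proof (rule integrable_compact_support[OF gw(3)])
      show "continuous_on UNIV (\<lambda>x. (p x $ i *\<^sub>R grad w x + w x *\<^sub>R p' i x) \<bullet> axis i 1)"
        by (intro continuous_intros cp gw(2) cw continuous_on_Polys[OF p'(1)])
      show "(p x $ i *\<^sub>R grad w x + w x *\<^sub>R p' i x) \<bullet> axis i 1 = 0" if "x \<notin> closure {x. w x \<noteq> 0}" for x
        using test_function_support[OF w that] by simp
    qed (use U in auto)
    ultimately have "(LINT x|lebesgue_on U. (\<Sum>i\<in>UNIV. (p x $ i *\<^sub>R grad w x + w x *\<^sub>R p' i x) \<bullet> axis i 1)) = 0"
      by (subst Bochner_Integration.integral_sum) auto
    moreover have "(\<Sum>i\<in>UNIV. (p x $ i *\<^sub>R grad w x + w x *\<^sub>R p' i x) \<bullet> axis i 1) = p x \<bullet> grad w x + D x * w x" for x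
    proof -
      have "(\<Sum>i\<in>UNIV. (p x $ i *\<^sub>R grad w x + w x *\<^sub>R p' i x) \<bullet> axis i 1) =
          (\<Sum>i\<in>UNIV. p x $ i * grad w x $ i + p' i x $ i * w x)"
        by (rule sum.cong) (simp_all add: inner_add_left inner_axis)
      also have "\<dots> = p x \<bullet> grad w x + D x * w x"
        by (simp only: sum.distrib inner_vec_def D_def sum_distrib_right inner_real_def)
      finally show ?thesis .
    qed
    ultimately show "(LINT x|lebesgue_on U. p x \<bullet> grad w x + D x * w x) = 0" by simp
  qed
qed

context mesh begin

text \<open>
  Testing with functions supported in the interior of a simplex identifies the weak divergence there
  with the classical divergence of the polynomial piece.
\<close>

lemma weak_div_V_h:
  assumes v: "v \<in> V_h k \<Omega> \<T>"
  shows "weak_div \<Omega> v \<in> broken_polys k \<Omega> \<T>"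
proof -
  obtain g where "is_weak_div \<Omega> v g" and vL: "v \<in> L2 \<Omega>"
    using v by (auto simp: V_h_def H0_div_def H_div_def)
  then have wd: "is_weak_div \<Omega> v (weak_div \<Omega> v)" using is_weak_div_weak_div by blast
  then have gL: "weak_div \<Omega> v \<in> L2 \<Omega>" by (simp add: is_weak_div_def)
  have "restr_in T (weak_div \<Omega> v) (Polys k UNIV)" if T: "T \<in> \<T>" for T
  proof -
    obtain p where p: "p \<in> Polys (k + 1) UNIV" "AE x in lebesgue_on T. v x = p x"
      using v T by (auto simp: V_h_def restr_in_def)
    obtain D where D: "D \<in> Polys k UNIV"
      "\<And>U w. open U \<Longrightarrow> w \<in> test_functions U \<Longrightarrow> (LINT x|lebesgue_on U. p x \<bullet> grad w x + D x * w x) = 0"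
      using Polys_divergence[OF p(1)] by auto
    define U where "U = interior T"
    have U: "open U" "U \<subseteq> \<Omega>" "U \<subseteq> T" "U \<in> sets lebesgue"
      using interior_T_subset[OF T] interior_subset by (auto simp: U_def)
    have L: "weak_div \<Omega> v \<in> L2 T" "v \<in> L2 T" "p \<in> L2 T" "D \<in> L2 T"
      using L2_restrict[OF T gL] L2_restrict[OF T vL]
        continuous_in_L2[OF compact_T[OF T] continuous_on_subset[OF continuous_on_Polys[OF p(1)] subset_UNIV]]
        continuous_in_L2[OF compact_T[OF T] continuous_on_subset[OF continuous_on_Polys[OF D(1)] subset_UNIV]]
      by blast+
    have hL: "(\<lambda>x. weak_div \<Omega> v x - D x) \<in> L2 T" by (intro L2_diff L)
    have "AE x in lebesgue_on U. weak_div \<Omega> v x - D x = 0"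
    proof (rule fundamental_lemma_variations[OF U(1)])
      have "integrable (lebesgue_on T) (\<lambda>x. weak_div \<Omega> v x - D x)"
        using lmeasurable_compact[OF compact_T[OF T]] hL by (rule L2_integrable)
      then have "integrable lebesgue (\<lambda>x. indicator U x *\<^sub>R (indicator T x *\<^sub>R (weak_div \<Omega> v x - D x)))"
        using measurable_T[OF T] by (intro integrable_mult_indicator[OF U(4)]) (simp add: integrable_lebesgue_on_eq)
      moreover have "(\<lambda>x. indicator U x *\<^sub>R (indicator T x *\<^sub>R (weak_div \<Omega> v x - D x))) = (\<lambda>x. indicator U x *\<^sub>R (weak_div \<Omega> v x - D x))"
        using U(3) by (auto simp: indicator_def fun_eq_iff)
      ultimately show "integrable (lebesgue_on U) (\<lambda>x. weak_div \<Omega> v x - D x)"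
        using U(4) by (simp add: integrable_lebesgue_on_eq)
      fix w assume w: "w \<in> test_functions U"
      have w0: "w x = 0" "grad w x = 0" if "x \<notin> U" for x
        using test_function_support[OF w, of x] test_function_gradient(4)[OF w] that by auto
      have w\<Omega>: "w \<in> test_functions \<Omega>" using w test_functions_mono[OF U(2)] by blast
      have wL: "w \<in> L2 T" "grad w \<in> L2 T"
        by (intro L2_restrict[OF T] test_L2[OF w] grad_test_L2[OF w])+
      have sup: "(LINT x|lebesgue_on S. f x) = (LINT x|lebesgue_on U. f x)"
        if "S = \<Omega> \<or> S = T" "\<And>x. x \<notin> U \<Longrightarrow> f x = 0" for S and f :: "real^'d \<Rightarrow> real"
        by (rule LINT_support) (use that U measurable_T[OF T] in auto)
      have "ip T (\<lambda>x. weak_div \<Omega> v x - D x) w = ip T (weak_div \<Omega> v) w - ip T D w"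
        by (rule ip_diff_left[OF L(1,4) wL(1)])
      also have "ip T (weak_div \<Omega> v) w = ip \<Omega> (weak_div \<Omega> v) w"
        unfolding ip_def by (simp add: sup w0)
      also have "\<dots> = - ip \<Omega> v (grad w)" using wd w\<Omega> by (simp add: is_weak_div_def)
      also have "ip \<Omega> v (grad w) = ip T v (grad w)"
        unfolding ip_def by (simp add: sup w0)
      also have "\<dots> = ip T p (grad w)" by (rule ip_cong_AE[OF p(2)]) (use L wL in auto)
      also have "- ip T p (grad w) - ip T D w = - (LINT x|lebesgue_on T. p x \<bullet> grad w x + D x * w x)"
        using L2_inner_integrable[OF L(3) wL(2)] L2_inner_integrable[OF L(4) wL(1)] by (simp add: ip_def)
      also have "\<dots> = - (LINT x|lebesgue_on U. p x \<bullet> grad w x + D x * w x)"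
        by (simp add: sup w0)
      also have "\<dots> = 0" using D(2)[OF U(1) w] by simp
      finally show "(LINT x|lebesgue_on U. (weak_div \<Omega> v x - D x) * w x) = 0"
        by (simp add: ip_def sup w0)
    qed
    then have "negligible ({x \<in> U. weak_div \<Omega> v x \<noteq> D x} \<union> (T - interior T))"
      using U(4) negligible_boundary_T[OF T] by (simp add: AE_lebesgue_on_iff_negligible)
    then have "negligible {x \<in> T. \<not> weak_div \<Omega> v x = D x}" by (rule negligible_subset) (auto simp: U_def)
    then have "AE x in lebesgue_on T. weak_div \<Omega> v x = D x"
      using measurable_T[OF T] by (simp add: AE_lebesgue_on_iff_negligible)
    then show ?thesis unfolding restr_in_def using D(1) by blast
  qed
  then show ?thesis using gL by (simp add: broken_polys_def)
qed

end

section \<open>Bubble fields on a simplex\<close>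

lemma Polys_id: "(\<lambda>x. x) \<in> Polys 1 (UNIV :: (real^'d) set)"
proof -
  have "(\<lambda>x :: real^'d. x) = (\<lambda>x. \<Sum>i\<in>UNIV. (axis i 1 \<bullet> x) *\<^sub>R axis i 1)"
  proof
    fix x :: "real^'d"
    show "x = (\<Sum>i\<in>UNIV. (axis i 1 \<bullet> x) *\<^sub>R axis i 1)"
      using basis_expansion[of x] by (simp add: inner_axis' scalar_mult_eq_scaleR)
  qed
  also have "\<dots> \<in> Polys 1 UNIV"
  proof (intro Polys_sum finite)
    fix i :: 'd
    have "linear (\<lambda>r. r *\<^sub>R (axis i 1 :: real^'d))" by (rule linear_scaleR_left)
    from Polys_linear[OF this Polys_inner_left[of "axis i 1"]]
    show "(\<lambda>x. (axis i 1 \<bullet> x) *\<^sub>R (axis i 1 :: real^'d)) \<in> Polys 1 UNIV" .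
  qed
  finally show ?thesis .
qed

lemma Polys_affine: "(\<lambda>x. b - n \<bullet> x) \<in> Polys 1 UNIV"
  using Polys_add[OF Polys_const[of b 1] Polys_linear[OF _ Polys_inner_left[of n], of uminus]]
  by (simp add: linear_uminus)

lemma Polys_0_const:
  assumes "p \<in> Polys 0 UNIV" obtains c where "p = (\<lambda>x. c)"
proof -
  have "{\<alpha> :: 'a \<Rightarrow> nat. sum \<alpha> UNIV \<le> 0} = {\<lambda>_. 0}" by (auto simp: fun_eq_iff)
  moreover obtain c where "p = (\<lambda>x. \<Sum>\<alpha>\<in>{\<alpha>. sum \<alpha> UNIV \<le> 0}. monomial \<alpha> x *\<^sub>R c \<alpha>)"
    using assms unfolding Polys_UNIV_iff by blast
  ultimately show ?thesis using that[of "c (\<lambda>_. 0)"] by (simp add: monomial_def)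
qed

lemma convex_hull_eq_apex_cone:
  fixes C :: "'a::euclidean_space set"
  assumes "c \<in> C" "C \<noteq> {c}"
  shows "convex hull C = apex_cone c (convex hull (C - {c}))"
proof -
  have ne: "C - {c} \<noteq> {}" and C: "C = insert c (C - {c})" using assms by auto
  have "convex hull (insert c (C - {c})) = apex_cone c (convex hull (C - {c}))"
    unfolding convex_hull_insert[OF ne]
  proof (intro equalityI subsetI)
    fix x assume "x \<in> {x. \<exists>u\<ge>0. \<exists>v\<ge>0. \<exists>b. u + v = 1 \<and> b \<in> convex hull (C - {c}) \<and> x = u *\<^sub>R c + v *\<^sub>R b}"
    then obtain u v b where "0 \<le> u" "0 \<le> v" "u + v = 1" and b: "b \<in> convex hull (C - {c})" and x: "x = u *\<^sub>R c + v *\<^sub>R b"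
      by blast
    then have "v \<le> 1" "u = 1 - v" by auto
    have "x = c + v *\<^sub>R (b - c)" unfolding x \<open>u = 1 - v\<close> by (simp add: algebra_simps)
    then show "x \<in> apex_cone c (convex hull (C - {c}))"
      unfolding apex_cone_def using b \<open>0 \<le> v\<close> \<open>v \<le> 1\<close> by (intro image_eqI[where x = "(v, b)"]) auto
  next
    fix x assume "x \<in> apex_cone c (convex hull (C - {c}))"
    then obtain v b where "0 \<le> v" "v \<le> 1" "b \<in> convex hull (C - {c})" "x = c + v *\<^sub>R (b - c)"
      by (auto simp: apex_cone_def)
    then show "x \<in> {x. \<exists>u\<ge>0. \<exists>v\<ge>0. \<exists>b. u + v = 1 \<and> b \<in> convex hull (C - {c}) \<and> x = u *\<^sub>R c + v *\<^sub>R b}"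
      by (intro CollectI exI[of _ "1 - v"] conjI exI[of _ v] exI[of _ b]) (auto simp: algebra_simps)
  qed
  then show ?thesis using C by simp
qed

text \<open>
  Up to a factor, \<open>b - n \<bullet> x\<close> is the barycentric coordinate of the vertex \<open>c\<close>: nonnegative on the
  simplex, zero on the facet opposite to \<open>c\<close>, and positive in the interior and at \<open>c\<close>.
\<close>

lemma vertex_functional:
  fixes C :: "'a::euclidean_space set"
  assumes C: "\<not> affine_dependent C" "c \<in> C" "C \<noteq> {c}" and T: "T = convex hull C"
  obtains n b where "\<And>x. x \<in> T \<Longrightarrow> n \<bullet> x \<le> b" "\<And>x. x \<in> convex hull (C - {c}) \<Longrightarrow> n \<bullet> x = b"
    "\<And>x. x \<in> interior T \<Longrightarrow> n \<bullet> x < b" "n \<bullet> c < b"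
proof -
  define F where "F = convex hull (C - {c})"
  have fin: "finite C" using C(1) by (rule aff_independent_finite)
  have "F facet_of T"
    unfolding T facet_of_convex_hull_affine_independent[OF C(1)] F_def using C by auto
  moreover have "polyhedron T" unfolding T using polyhedron_convex_hull[OF fin] .
  ultimately obtain n b where nb: "n \<noteq> 0" "T \<subseteq> {x. n \<bullet> x \<le> b}" "F = T \<inter> {x. n \<bullet> x = b}"
    using facet_of_polyhedron by metis
  have "c \<notin> F"
    using C convex_hull_subset_affine_hull[of "C - {c}"] by (auto simp: affine_dependent_def F_def)
  moreover have "c \<in> T" unfolding T using C(2) hull_inc by metis
  ultimately have "n \<bullet> c < b" using nb by (auto simp: less_le)
  moreover have "interior T \<subseteq> {x. n \<bullet> x < b}"
    using interior_mono[OF nb(2)] interior_halfspace_le[OF nb(1)] by metis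
  moreover have "n \<bullet> x \<le> b" if "x \<in> T" for x using nb(2) that by blast
  moreover have "n \<bullet> x = b" if "x \<in> convex hull (C - {c})" for x
    using nb(3) that unfolding F_def by blast
  ultimately show ?thesis by (intro that[of n b]) blast+
qed

context mesh begin

lemma vertices_T:
  assumes "T \<in> \<T>"
  obtains C where "\<not> affine_dependent C" "T = convex hull C" "\<And>c. c \<in> C \<Longrightarrow> C \<noteq> {c}" "C \<noteq> {}" "finite C"
proof -
  obtain C where C: "\<not> affine_dependent C" "int (card C) = int CARD('d) + 1" "T = convex hull C"
    using simplex_T[OF assms] unfolding simplex_def by blast
  have "card C \<ge> 2" using C(2) zero_less_card_finite[where 'a = 'd] by linarith
  then have "C \<noteq> {c}" "C \<noteq> {}" for c by auto
  then show ?thesis using C aff_independent_finite[OF C(1)] that by blast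
qed

lemma sum_mesh_single: "T \<in> \<T> \<Longrightarrow> (\<Sum>S\<in>\<T>. if S = T then f S else 0) = f T"
  by (simp add: finite_mesh)

text \<open>
  For vertices \<open>a, b\<close> of \<open>T\<close> the field \<open>\<lambda>\<^sub>a \<lambda>\<^sub>b g (b - a)\<close> is tangential to all facets
  except those opposite to \<open>a\<close> and \<open>b\<close>, where it vanishes. Integrating by parts against \<open>\<rho>\<close> with
  \<open>g = \<nabla>\<rho> \<bullet> (b - a)\<close>, which has degree \<open>k - 1\<close>, yields the integral of
  \<open>\<lambda>\<^sub>a \<lambda>\<^sub>b g\<^sup>2\<close>, so \<open>g = 0\<close>. The derivatives along the edges at \<open>a\<close> control
  the derivative along every ray from \<open>a\<close>.
\<close>

lemma orthogonal_to_div_locally_constant: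
  assumes orth: "\<And>v. v \<in> V_h k \<Omega> \<T> \<Longrightarrow> ip \<Omega> (weak_div \<Omega> v) r = 0" and r: "r \<in> L2 \<Omega>"
    and T: "T \<in> \<T>" and \<rho>: "\<rho> \<in> Polys k UNIV" and r\<rho>: "AE x in lebesgue_on T. r x = \<rho> x"
  shows "\<exists>c. \<forall>x\<in>T. \<rho> x = c"
proof (cases "k = 0")
  case True
  then show ?thesis using Polys_0_const[of \<rho>] \<rho> by metis
next
  case False
  obtain C where C: "\<not> affine_dependent C" "T = convex hull C" "\<And>c. c \<in> C \<Longrightarrow> C \<noteq> {c}" "C \<noteq> {}" "finite C"
    using vertices_T[OF T] by metis
  obtain \<rho>' where \<rho>': "\<rho>' \<in> Polys (k - 1) UNIV" "\<And>x. (\<rho> has_derivative (\<lambda>h. \<rho>' x \<bullet> h)) (at x)"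
    using Polys_has_gradient[OF \<rho>] by metis
  have c\<rho>: "continuous_on UNIV \<rho>" "continuous_on UNIV \<rho>'"
    using continuous_on_Polys \<rho> \<rho>'(1) by blast+
  note cT = compact_T[OF T]
  obtain a where a: "a \<in> C" using C(4) by blast
  have edge: "\<rho>' x \<bullet> (b - a) = 0" if b: "b \<in> C" and x: "x \<in> T" for b x
  proof (cases "b = a")
    case False
    define t where "t = b - a"
    obtain n1 b1 where A: "\<And>x. x \<in> T \<Longrightarrow> n1 \<bullet> x \<le> b1" "\<And>x. x \<in> convex hull (C - {a}) \<Longrightarrow> n1 \<bullet> x = b1"
        "\<And>x. x \<in> interior T \<Longrightarrow> n1 \<bullet> x < b1"
      using vertex_functional[OF C(1) a C(3)[OF a] C(2)] by metis
    obtain n2 b2 where B: "\<And>x. x \<in> T \<Longrightarrow> n2 \<bullet> x \<le> b2" "\<And>x. x \<in> convex hull (C - {b}) \<Longrightarrow> n2 \<bullet> x = b2"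
        "\<And>x. x \<in> interior T \<Longrightarrow> n2 \<bullet> x < b2"
      using vertex_functional[OF C(1) b C(3)[OF b] C(2)] by metis
    define g where "g x = \<rho>' x \<bullet> t" for x
    have g: "g \<in> Polys (k - 1) UNIV"
      unfolding g_def[abs_def] by (rule Polys_linear[OF bounded_linear.linear[OF bounded_linear_inner_left] \<rho>'(1)])
    define q where "q x = (b1 - n1 \<bullet> x) *\<^sub>R ((b2 - n2 \<bullet> x) *\<^sub>R g x)" for x
    have "q \<in> Polys (1 + (1 + (k - 1))) UNIV"
      unfolding q_def[abs_def] by (intro Polys_mult Polys_affine g)
    then have q: "q \<in> Polys (k + 1) UNIV" using \<open>k \<noteq> 0\<close> by simp
    obtain q' where q': "q' \<in> Polys k UNIV" "\<And>x. (q has_derivative (\<lambda>h. q' x \<bullet> h)) (at x)"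
      using Polys_has_gradient[OF q] by auto
    have cq: "continuous_on UNIV q" "continuous_on UNIV q'" "continuous_on UNIV g"
      using continuous_on_Polys q q'(1) g by blast+
    have q0: "q y = 0" if "y \<in> convex hull (C - {a}) \<union> convex hull (C - {b})" for y
      using that A(2) B(2) by (auto simp: q_def)
    have flux: "(LINT x|lebesgue_on T. (q x *\<^sub>R w' x + w x *\<^sub>R q' x) \<bullet> t) = 0"
      if w: "\<And>x. (w has_derivative (\<lambda>h. w' x \<bullet> h)) (at x)" and cw': "continuous_on UNIV w'" for w w'
      unfolding t_def
    proof (rule cone_gradient_two_apexes)
      have cw: "continuous_on UNIV w"
        by (rule has_derivative_imp_continuous_on[OF w])
      show "T = apex_cone a (convex hull (C - {a}))" "T = apex_cone b (convex hull (C - {b}))"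
        unfolding C(2) using convex_hull_eq_apex_cone[OF a C(3)[OF a]] convex_hull_eq_apex_cone[OF b C(3)[OF b]] by auto
      show "((\<lambda>x. q x * w x) has_derivative (\<lambda>h. (q x *\<^sub>R w' x + w x *\<^sub>R q' x) \<bullet> h)) (at x)" for x
        by (rule has_derivative_eq_rhs[OF has_derivative_mult[OF q'(2) w]]) (auto simp: inner_add_left algebra_simps)
      show "continuous_on UNIV (\<lambda>x. q x *\<^sub>R w' x + w x *\<^sub>R q' x)"
        by (intro continuous_intros cq cw cw')
      show "q y * w y = 0" if "y \<in> convex hull (C - {a}) \<union> convex hull (C - {b})" for y
        using q0[OF that] by simp
    qed (use C(5) in \<open>auto intro: finite_imp_compact_convex_hull\<close>)
    define P where "P S = (if S = T then (\<lambda>x. q x *\<^sub>R t) else (\<lambda>x. 0))" for S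
    define D where "D S = (if S = T then (\<lambda>x. q' x \<bullet> t) else (\<lambda>x. 0))" for S
    have 1: "P S \<in> Polys (k + 1) UNIV" for S
      using Polys_linear[OF linear_scaleR_left q, of t] by (simp add: P_def Polys_zero)
    have 2: "continuous_on UNIV (D S)" for S
      by (auto simp: D_def intro!: continuous_intros cq)
    have 3: "(\<Sum>S\<in>\<T>. LINT x|lebesgue_on S. P S x \<bullet> grad w x + D S x * w x) = 0"
      if w: "w \<in> test_functions UNIV" for w
    proof -
      have "(\<Sum>S\<in>\<T>. LINT x|lebesgue_on S. P S x \<bullet> grad w x + D S x * w x) =
          (\<Sum>S\<in>\<T>. if S = T then (LINT x|lebesgue_on T. (q x *\<^sub>R grad w x + w x *\<^sub>R q' x) \<bullet> t) else 0)"
      proof (rule sum.cong[OF refl])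
        fix S
        have "(q x *\<^sub>R t) \<bullet> grad w x + (q' x \<bullet> t) * w x = (q x *\<^sub>R grad w x + w x *\<^sub>R q' x) \<bullet> t" for x
          by (simp add: inner_add_left inner_commute[of t] mult.commute)
        then show "(LINT x|lebesgue_on S. P S x \<bullet> grad w x + D S x * w x) =
            (if S = T then (LINT x|lebesgue_on T. (q x *\<^sub>R grad w x + w x *\<^sub>R q' x) \<bullet> t) else 0)"
          by (simp add: P_def D_def)
      qed
      also have "\<dots> = (LINT x|lebesgue_on T. (q x *\<^sub>R grad w x + w x *\<^sub>R q' x) \<bullet> t)"
        by (rule sum_mesh_single[OF T])
      also have "\<dots> = 0" by (rule flux[OF test_function_gradient(1,2)[OF w]])
      finally show ?thesis .
    qed
    note v = V_h_glue(1)[of P k D, OF 1 2 3] V_h_glue(2)[of P k D, OF 1 2 3 r]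
    have cL: "h \<in> L2 T" if "continuous_on UNIV h" for h :: "real^'d \<Rightarrow> real"
      by (rule continuous_in_L2[OF cT continuous_on_subset[OF that subset_UNIV]])
    have rL: "r \<in> L2 T" by (rule L2_restrict[OF T r])
    have \<rho>L: "\<rho> \<in> L2 T" and dL: "(\<lambda>x. q' x \<bullet> t) \<in> L2 T" and qgL: "q \<in> L2 T" "g \<in> L2 T"
      by (rule cL, intro continuous_intros c\<rho> cq)+
    have "(\<Sum>S\<in>\<T>. ip S (D S) r) = (\<Sum>S\<in>\<T>. if S = T then ip T (\<lambda>x. q' x \<bullet> t) r else 0)"
      by (rule sum.cong) (auto simp: D_def ip_def)
    then have "ip T (\<lambda>x. q' x \<bullet> t) r = 0"
      using orth[OF v(1)] v(2) sum_mesh_single[OF T, of "\<lambda>_. ip T (\<lambda>x. q' x \<bullet> t) r"] by simp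
    then have z1: "ip T (\<lambda>x. q' x \<bullet> t) \<rho> = 0"
      using ip_cong_AE[OF _ r\<rho> dL dL rL \<rho>L] by simp
    have "(LINT x|lebesgue_on T. (q x *\<^sub>R \<rho>' x + \<rho> x *\<^sub>R q' x) \<bullet> t) = ip T q g + ip T (\<lambda>x. q' x \<bullet> t) \<rho>"
      using L2_inner_integrable[OF qgL] L2_inner_integrable[OF dL \<rho>L]
      by (simp add: ip_def inner_add_left g_def mult.commute)
    then have z2: "(LINT x|lebesgue_on T. q x * g x) = 0"
      using z1 flux[OF \<rho>'(2) c\<rho>(2)] by (simp add: ip_def)
    have int: "integrable (lebesgue_on T) (\<lambda>x. q x * g x)" using L2_inner_integrable[OF qgL] by simp
    have qg: "q x * g x = (b1 - n1 \<bullet> x) * (b2 - n2 \<bullet> x) * (g x)\<^sup>2" for x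
      by (simp add: q_def power2_eq_square)
    have "AE x in lebesgue_on T. q x * g x = 0"
    proof (rule integral_nonneg_eq_0_iff_AE[THEN iffD1, OF int _ z2])
      show "AE x in lebesgue_on T. 0 \<le> q x * g x"
        using measurable_T[OF T] A(1) B(1) unfolding qg
        by (intro AE_I2) (auto intro!: mult_nonneg_nonneg)
    qed
    then have "negligible ({x \<in> T. q x * g x \<noteq> 0} \<union> (T - interior T))"
      using measurable_T[OF T] negligible_boundary_T[OF T] by (simp add: AE_lebesgue_on_iff_negligible)
    moreover have "{x \<in> T. g x \<noteq> 0} \<subseteq> {x \<in> T. q x * g x \<noteq> 0} \<union> (T - interior T)"
      unfolding qg using A(3) B(3) by fastforce
    ultimately have "negligible {x \<in> T. g x \<noteq> 0}" by (rule negligible_subset)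
    then have ae: "AE x in lebesgue_on T. g x = 0"
      using measurable_T[OF T] by (simp add: AE_lebesgue_on_iff_negligible)
    have "g x = (\<lambda>_. 0) x"
      by (rule continuous_AE_eq_imp_eq[OF convex_T[OF T] interior_T_nonempty[OF T] measurable_T(2)[OF T] cq(3) _ _ x])
         (use ae in auto)
    then show ?thesis by (simp add: g_def t_def)
  qed simp
  have radial: "\<rho>' x \<bullet> (y - a) = 0" if x: "x \<in> T" and y: "y \<in> T" for x y
  proof -
    \<comment> \<open>The points with vanishing derivative in direction \<open>y - a\<close> form a hyperplane, or everything; it
      contains the vertices, hence the simplex.\<close>
    have "{y. \<rho>' x \<bullet> (y - a) = 0} = {y. \<rho>' x \<bullet> y = \<rho>' x \<bullet> a}" by (auto simp: inner_diff_right)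
    then have "convex {y. \<rho>' x \<bullet> (y - a) = 0}" by (simp add: convex_hyperplane)
    then have "T \<subseteq> {y. \<rho>' x \<bullet> (y - a) = 0}" unfolding C(2) by (intro hull_minimal) (use edge[OF _ x] in auto)
    then show ?thesis using y by auto
  qed
  have aT: "a \<in> T" unfolding C(2) using a hull_inc by metis
  have "\<rho> x = \<rho> a" if x: "x \<in> T" for x
  proof -
    note d = has_derivative_along_ray[of \<rho> \<rho>' a, OF \<rho>'(2)]
    obtain s where s: "0 < s" "s < 1" "\<rho> (a + 1 *\<^sub>R (x - a)) - \<rho> (a + 0 *\<^sub>R (x - a)) = (1 - 0) * (\<rho>' (a + s *\<^sub>R (x - a)) \<bullet> (x - a))"
      using MVT2[of 0 1 "\<lambda>s. \<rho> (a + s *\<^sub>R (x - a))" "\<lambda>s. \<rho>' (a + s *\<^sub>R (x - a)) \<bullet> (x - a)"] d by auto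
    have "(1 - s) *\<^sub>R a + s *\<^sub>R x \<in> T" using convexD_alt[OF convex_T[OF T] aT x, of s] s by simp
    then have zT: "a + s *\<^sub>R (x - a) \<in> T" by (simp add: algebra_simps)
    show ?thesis using s(3) radial[OF zT x] by simp
  qed
  then show ?thesis by blast
qed

end

section \<open>Fields crossing a single facet\<close>

lemma lborel_integral_translate:
  fixes f :: "'a::euclidean_space \<Rightarrow> real"
  assumes [measurable]: "f \<in> borel_measurable borel"
  shows "(LINT x|lborel. f (x + t)) = (LINT x|lborel. f x)"
  by (subst (2) lborel_distr_plus[of t, symmetric], subst integral_distr) (auto simp: add.commute)

text \<open>
  Each side is, up to the height of its apex, the integral of \<open>w\<close> over the common base \<open>F\<close>. The two are
  compared by the affine map \<open>\<Phi>\<close> that fixes the hyperplane of \<open>F\<close> pointwise and takes \<open>a'\<close> to \<open>a\<close>.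
  It transports the integral over one cone to the other at the cost of a constant \<open>c\<close>, and replaces \<open>w\<close> by
  \<open>w \<circ> \<Phi>\<close>; since \<open>w \<circ> \<Phi> - w\<close> vanishes on \<open>F\<close>, the cone identity removes the difference. The constant
  function shows that \<open>c\<close> is the ratio of the two volumes.
\<close>

lemma shared_facet_flux:
  fixes a a' :: "'a::euclidean_space"
  assumes F: "compact F" and n: "F \<subseteq> {x. n \<bullet> x = b}" and a: "n \<bullet> a \<noteq> b" "n \<bullet> a' \<noteq> b"
  shows "\<exists>c>0. (LINT x|lebesgue_on (apex_cone a F). 1) = c * (LINT x|lebesgue_on (apex_cone a' F). 1 :: real) \<and>
    (\<forall>w w'. (\<forall>x. (w has_derivative (\<lambda>h. w' x \<bullet> h)) (at x)) \<longrightarrow> continuous_on UNIV w' \<longrightarrow>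
       (LINT x|lebesgue_on (apex_cone a F). real DIM('a) * w x + w' x \<bullet> (x - a)) =
       c * (LINT x|lebesgue_on (apex_cone a' F). real DIM('a) * w x + w' x \<bullet> (x - a')))"
proof -
  define \<mu> where "\<mu> = b - n \<bullet> a'"
  have \<mu>: "\<mu> \<noteq> 0" using a by (simp add: \<mu>_def)
  \<comment> \<open>With \<open>\<mu>\<close> the offset of \<open>a'\<close> from the hyperplane \<open>n \<bullet> x = b\<close> of \<open>F\<close>, the map
    \<open>\<Phi> x = x + (b - n \<bullet> x) e\<close> fixes this hyperplane and moves \<open>a'\<close> to \<open>a\<close>; \<open>L\<close> is its linear part.\<close>
  define e where "e = (1 / \<mu>) *\<^sub>R (a - a')"
  define L where "L x = x - (n \<bullet> x) *\<^sub>R e" for x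
  define \<Phi> where "\<Phi> x = L x + b *\<^sub>R e" for x
  have linL: "linear L" unfolding L_def[abs_def] by (rule linearI) (simp_all add: inner_add_right algebra_simps)
  have inj: "inj L"
  proof (subst linear_injective_0[OF linL], intro allI impI)
    fix x assume "L x = 0"
    then have x: "x = (n \<bullet> x) *\<^sub>R e" by (simp add: L_def)
    have "n \<bullet> x = n \<bullet> ((n \<bullet> x) *\<^sub>R e)" using x by (rule arg_cong)
    then have *: "n \<bullet> x = (n \<bullet> x) * (n \<bullet> e)" by (simp only: inner_scaleR_right)
    have "n \<bullet> e \<noteq> 1"
    proof
      assume "n \<bullet> e = 1"
      moreover have "n \<bullet> e = (n \<bullet> a - n \<bullet> a') / \<mu>" by (simp add: e_def inner_diff_right)
      ultimately have "n \<bullet> a - n \<bullet> a' = \<mu>" using \<mu> by simp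
      then show False using a(1) by (simp add: \<mu>_def)
    qed
    with * have "n \<bullet> x = 0" unfolding mult_cancel_left1 by blast
    with x show "x = 0" by (simp only: scaleR_zero_left)
  qed
  have \<Phi>F: "\<Phi> y = y" if "y \<in> F" for y using n that by (auto simp: \<Phi>_def L_def)
  have \<Phi>a: "\<Phi> a' = a"
  proof -
    have "\<Phi> a' = a' + \<mu> *\<^sub>R e" by (simp add: \<Phi>_def L_def \<mu>_def algebra_simps)
    then show ?thesis using \<mu> by (simp add: e_def)
  qed
  have \<Phi>diff: "\<Phi> x - \<Phi> y = L (x - y)" for x y using linear_diff[OF linL] by (simp add: \<Phi>_def)
  have \<Phi>line: "\<Phi> (a' + r *\<^sub>R (y - a')) = a + r *\<^sub>R (\<Phi> y - a)" for r y
  proof -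
    have "\<Phi> (a' + r *\<^sub>R (y - a')) - \<Phi> a' = r *\<^sub>R (\<Phi> y - \<Phi> a')"
      unfolding \<Phi>diff by (simp add: linear_cmul[OF linL])
    then show ?thesis by (simp add: \<Phi>a algebra_simps)
  qed
  have inj\<Phi>: "inj \<Phi>" using inj by (auto simp: inj_def \<Phi>_def)
  have im: "\<Phi> ` apex_cone a' F = apex_cone a F"
  proof -
    have "\<Phi> ` apex_cone a' F = (\<lambda>(r, y). a + r *\<^sub>R (\<Phi> y - a)) ` ({0..1} \<times> F)"
      unfolding apex_cone_def image_image by (rule image_cong) (auto simp: \<Phi>line)
    also have "\<dots> = apex_cone a F" unfolding apex_cone_def by (rule image_cong) (auto simp: \<Phi>F)
    finally show ?thesis .
  qed
  have ind_cone: "indicator (apex_cone a F) (\<Phi> x) = (indicator (apex_cone a' F) x :: real)" for x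
    using inj\<Phi> unfolding im[symmetric] by (auto simp: indicator_def inj_image_mem_iff)
  have cL: "continuous_on UNIV \<Phi>"
    unfolding \<Phi>_def[abs_def] L_def by (intro continuous_intros)
  note cc = compact_cone[OF F, of a] compact_cone[OF F, of a']
  have [measurable]: "apex_cone a F \<in> sets borel" "apex_cone a' F \<in> sets borel" using cc borel_compact by blast+
  obtain c where c: "c > 0" "\<And>f :: 'a \<Rightarrow> real. f \<in> borel_measurable borel \<Longrightarrow>
      (LINT x|lborel. f x) = c * (LINT x|lborel. f (L x))"
    using lborel_linear_image[OF linL inj] by blast
  have change: "(LINT x|lebesgue_on (apex_cone a F). G x) = c * (LINT x|lebesgue_on (apex_cone a' F). G (\<Phi> x))"
    if G: "continuous_on UNIV G" for G :: "'a \<Rightarrow> real"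
  proof -
    have [measurable]: "G \<in> borel_measurable borel" using G by (rule borel_measurable_continuous_onI)
    have "continuous_on UNIV (\<lambda>x. G (\<Phi> x))" by (rule continuous_on_compose2[OF G cL]) simp
    then have m: "(\<lambda>x. G (\<Phi> x)) \<in> borel_measurable borel" by (rule borel_measurable_continuous_onI)
    define f where "f x = indicator (apex_cone a F) x * G x" for x
    have [measurable]: "f \<in> borel_measurable borel" unfolding f_def[abs_def] by measurable
    have "(LINT x|lebesgue_on (apex_cone a F). G x) = (LINT x|lborel. f x)"
      by (subst LINT_lebesgue_on_lborel) (simp_all add: f_def[abs_def])
    also have "\<dots> = (LINT x|lborel. f (x + b *\<^sub>R e))" by (rule lborel_integral_translate[symmetric]) simp
    also have "\<dots> = c * (LINT x|lborel. f (\<Phi> x))"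
    proof -
      have "(\<lambda>x. f (x + b *\<^sub>R e)) \<in> borel_measurable borel" by measurable
      from c(2)[OF this] show ?thesis unfolding \<Phi>_def .
    qed
    also have "(LINT x|lborel. f (\<Phi> x)) = (LINT x|lebesgue_on (apex_cone a' F). G (\<Phi> x))"
      using m by (subst LINT_lebesgue_on_lborel) (simp_all add: f_def[abs_def] ind_cone)
    finally show ?thesis .
  qed
  show ?thesis
  proof (intro exI[of _ c] conjI allI impI)
    show "c > 0" by fact
    show "(LINT x|lebesgue_on (apex_cone a F). 1) = c * (LINT x|lebesgue_on (apex_cone a' F). 1 :: real)"
      using change[of "\<lambda>_. 1"] by (simp add: continuous_on_const)
    fix w :: "'a \<Rightarrow> real" and w'
    assume "\<forall>x. (w has_derivative (\<lambda>h. w' x \<bullet> h)) (at x)" and cw': "continuous_on UNIV w'"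
    let ?J = "\<lambda>a. LINT x|lebesgue_on (apex_cone a F). real DIM('a) * w x + w' x \<bullet> (x - a)"
    have w: "(w has_derivative (\<lambda>h. w' x \<bullet> h)) (at x)" for x
      using \<open>\<forall>x. (w has_derivative (\<lambda>h. w' x \<bullet> h)) (at x)\<close> by blast
    have cw: "continuous_on UNIV w"
      by (rule has_derivative_imp_continuous_on[OF w])
    have cw\<Phi>: "continuous_on UNIV (\<lambda>x. w (\<Phi> x))" "continuous_on UNIV (\<lambda>x. w' (\<Phi> x))"
      by (rule continuous_on_compose2[OF cw cL] continuous_on_compose2[OF cw' cL]; simp)+
    \<comment> \<open>The gradient of \<open>w \<circ> \<Phi> - w\<close>, with the adjoint of \<open>L\<close> written out.\<close>
    define G' where "G' x = w' (\<Phi> x) - (w' (\<Phi> x) \<bullet> e) *\<^sub>R n - w' x" for x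
    have G'L: "G' x \<bullet> h = w' (\<Phi> x) \<bullet> L h - w' x \<bullet> h" for x h
      by (simp add: G'_def L_def inner_diff_left inner_diff_right)
    have "(LINT x|lebesgue_on (apex_cone a' F). real DIM('a) * (w (\<Phi> x) - w x) + G' x \<bullet> (x - a')) = 0"
    proof (rule cone_divergence[OF F])
      have d\<Phi>: "(\<Phi> has_derivative L) (at x)" for x
        unfolding \<Phi>_def[abs_def]
        by (intro has_derivative_add_const linear_imp_has_derivative linL)
      show "((\<lambda>x. w (\<Phi> x) - w x) has_derivative (\<lambda>h. G' x \<bullet> h)) (at x)" for x
        unfolding G'L by (intro has_derivative_diff w has_derivative_compose[OF d\<Phi> w])
      show "continuous_on UNIV G'"
        unfolding G'_def[abs_def] by (intro continuous_intros cw\<Phi> cw')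
    qed (simp add: \<Phi>F)
    moreover have "real DIM('a) * (w (\<Phi> x) - w x) + G' x \<bullet> (x - a') =
        (real DIM('a) * w (\<Phi> x) + w' (\<Phi> x) \<bullet> (\<Phi> x - a)) - (real DIM('a) * w x + w' x \<bullet> (x - a'))" for x
    proof -
      have "L (x - a') = \<Phi> x - a" using \<Phi>diff[of x a'] by (simp add: \<Phi>a)
      then show ?thesis unfolding G'L by (simp add: right_diff_distrib)
    qed
    moreover have "integrable (lebesgue_on (apex_cone a' F)) (\<lambda>x. real DIM('a) * w (\<Phi> x) + w' (\<Phi> x) \<bullet> (\<Phi> x - a))"
      "integrable (lebesgue_on (apex_cone a' F)) (\<lambda>x. real DIM('a) * w x + w' x \<bullet> (x - a'))"
    proof -
      have ic: "integrable (lebesgue_on (apex_cone a' F)) f" if "continuous_on UNIV f" for f :: "'a \<Rightarrow> real"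
        by (rule integrable_on_compact[OF cc(2) continuous_on_subset[OF that subset_UNIV]])
      show "integrable (lebesgue_on (apex_cone a' F)) (\<lambda>x. real DIM('a) * w (\<Phi> x) + w' (\<Phi> x) \<bullet> (\<Phi> x - a))"
        by (rule ic) (intro continuous_intros cw\<Phi> cL)
      show "integrable (lebesgue_on (apex_cone a' F)) (\<lambda>x. real DIM('a) * w x + w' x \<bullet> (x - a'))"
        by (rule ic) (intro continuous_intros cw cw')
    qed
    ultimately have "(LINT x|lebesgue_on (apex_cone a' F). real DIM('a) * w (\<Phi> x) + w' (\<Phi> x) \<bullet> (\<Phi> x - a)) =
        ?J a'"
      by simp
    moreover have "?J a = c * (LINT x|lebesgue_on (apex_cone a' F). real DIM('a) * w (\<Phi> x) + w' (\<Phi> x) \<bullet> (\<Phi> x - a))"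
      by (rule change) (intro continuous_intros cw cw')
    ultimately show "?J a = c * ?J a'"
      by simp
  qed
qed

context mesh begin

lemma sum_mesh_two:
  assumes "T \<in> \<T>" "T' \<in> \<T>" "T \<noteq> T'"
  shows "(\<Sum>S\<in>\<T>. if S = T then x else if S = T' then y else 0) = x + (y::real)"
proof -
  have "(\<Sum>S\<in>\<T>. if S = T then x else if S = T' then y else 0) =
      (\<Sum>S\<in>\<T>. (if S = T then x else 0) + (if S = T' then y else 0))"
    by (rule sum.cong) (use assms in auto)
  then show ?thesis using assms finite_mesh by (simp add: sum.distrib)
qed

text \<open>
  The Raviart-Thomas field of the facet is \<open>x - a\<close> on one side and \<open>-\<kappa> (x - a')\<close> on the other, with
  \<open>\<kappa>\<close> the ratio of the volumes. Its divergences are constants with opposite integrals over the two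
  simplices, so orthogonality compares the two values of \<open>r\<close>.
\<close>

lemma orthogonal_to_div_across_facet:
  assumes orth: "\<And>v. v \<in> V_h k \<Omega> \<T> \<Longrightarrow> ip \<Omega> (weak_div \<Omega> v) r = 0" and r: "r \<in> L2 \<Omega>"
    and T: "T \<in> \<T>" "T' \<in> \<T>" "T \<noteq> T'" and F: "(T \<inter> T') facet_of T" "(T \<inter> T') facet_of T'"
    and c: "AE x in lebesgue_on T. r x = c" "AE x in lebesgue_on T'. r x = c'"
  shows "c = c'"
proof -
  obtain C where C: "\<not> affine_dependent C" "T = convex hull C" "\<And>c. c \<in> C \<Longrightarrow> C \<noteq> {c}" "C \<noteq> {}" "finite C"
    using vertices_T[OF T(1)] by metis
  obtain C' where C': "\<not> affine_dependent C'" "T' = convex hull C'" "\<And>c. c \<in> C' \<Longrightarrow> C' \<noteq> {c}" "C' \<noteq> {}" "finite C'"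
    using vertices_T[OF T(2)] by metis
  define F where "F = T \<inter> T'"
  have "F facet_of convex hull C" "F facet_of convex hull C'"
    using F unfolding F_def C(2)[symmetric] C'(2)[symmetric] by simp_all
  then obtain a a' where a: "a \<in> C" "F = convex hull (C - {a})" and a': "a' \<in> C'" "F = convex hull (C' - {a'})"
    unfolding facet_of_convex_hull_affine_independent[OF C(1)] facet_of_convex_hull_affine_independent[OF C'(1)]
    by blast
  have Tc: "T = apex_cone a F" "T' = apex_cone a' F"
    using convex_hull_eq_apex_cone[OF a(1) C(3)[OF a(1)]] convex_hull_eq_apex_cone[OF a'(1) C'(3)[OF a'(1)]]
    by (simp_all only: a(2)[symmetric] a'(2)[symmetric] C(2)[symmetric] C'(2)[symmetric])
  have cF: "compact F" unfolding F_def using T compact_T by (simp add: compact_Int)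
  obtain n b where nb: "\<And>x. x \<in> F \<Longrightarrow> n \<bullet> x = b" "n \<bullet> a' < b"
    using vertex_functional[OF C'(1) a'(1) C'(3)[OF a'(1)] C'(2)] a'(2) by metis
  have "n \<noteq> 0"
  proof
    assume "n = 0"
    moreover have "F \<noteq> {}" using F(1) by (auto simp: F_def facet_of_def)
    ultimately show False using nb by auto
  qed
  have "n \<bullet> a \<noteq> b"
  proof
    assume "n \<bullet> a = b"
    then have "C \<subseteq> {x. n \<bullet> x = b}" using nb(1) hull_subset[of "C - {a}" convex] a(2) by auto
    then have "T \<subseteq> {x. n \<bullet> x = b}" unfolding C(2) by (intro hull_minimal convex_hyperplane) auto
    then have "interior T = {}" using interior_mono interior_hyperplane[OF \<open>n \<noteq> 0\<close>, of b] by blast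
    then show False using interior_T_nonempty[OF T(1)] by simp
  qed
  obtain \<kappa> where \<kappa>: "\<kappa> > 0"
    "(LINT x|lebesgue_on T. 1) = \<kappa> * (LINT x|lebesgue_on T'. 1 :: real)"
    and flux: "\<forall>w w'. (\<forall>x. (w has_derivative (\<lambda>h. w' x \<bullet> h)) (at x)) \<longrightarrow> continuous_on UNIV w' \<longrightarrow>
       (LINT x|lebesgue_on T. real DIM(real^'d) * w x + w' x \<bullet> (x - a)) =
       \<kappa> * (LINT x|lebesgue_on T'. real DIM(real^'d) * w x + w' x \<bullet> (x - a'))"
  proof -
    have "n \<bullet> a' \<noteq> b" and "F \<subseteq> {x. n \<bullet> x = b}" using nb by auto
    from shared_facet_flux[OF cF this(2) \<open>n \<bullet> a \<noteq> b\<close> this(1), folded Tc] show ?thesis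
      using that by (elim exE conjE)
  qed
  let ?d = "real DIM(real^'d)"
  define P where "P S = (if S = T then (\<lambda>x. x - a) else if S = T' then (\<lambda>x. (- \<kappa>) *\<^sub>R (x - a')) else (\<lambda>x. 0))" for S
  define D where "D S = (if S = T then (\<lambda>x :: real^'d. ?d) else if S = T' then (\<lambda>x. - \<kappa> * ?d) else (\<lambda>x. 0))" for S
  have Pid: "(\<lambda>x. x - z) \<in> Polys (k + 1) UNIV" for z :: "real^'d"
    using Polys_mono[OF _ Polys_add[OF Polys_id Polys_const[of "- z"]], of "k + 1"] by simp
  have 1: "P S \<in> Polys (k + 1) UNIV" for S
    using Polys_linear[OF linear_scale_self Pid[of a'], of "- \<kappa>"] Pid[of a] by (simp add: P_def Polys_zero)
  have 2: "continuous_on UNIV (D S)" for S by (auto simp: D_def)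
  have 3: "(\<Sum>S\<in>\<T>. LINT x|lebesgue_on S. P S x \<bullet> grad w x + D S x * w x) = 0"
    if w: "w \<in> test_functions UNIV" for w
  proof -
    let ?I = "\<lambda>T a. LINT x|lebesgue_on T. ?d * w x + grad w x \<bullet> (x - a)"
    have "(\<Sum>S\<in>\<T>. LINT x|lebesgue_on S. P S x \<bullet> grad w x + D S x * w x) =
        (\<Sum>S\<in>\<T>. if S = T then ?I T a else if S = T' then - \<kappa> * ?I T' a' else 0)"
    proof (rule sum.cong[OF refl])
      fix S
      have 1: "(x - a) \<bullet> grad w x + ?d * w x = ?d * w x + grad w x \<bullet> (x - a)" for x
        by (simp add: inner_commute)
      have 2: "((- \<kappa>) *\<^sub>R (x - a')) \<bullet> grad w x + (- \<kappa> * ?d) * w x = - \<kappa> * (?d * w x + grad w x \<bullet> (x - a'))" for x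
        by (simp only: inner_commute[of _ "grad w x"] inner_scaleR_right distrib_left mult.assoc add.commute)
      show "(LINT x|lebesgue_on S. P S x \<bullet> grad w x + D S x * w x) =
          (if S = T then ?I T a else if S = T' then - \<kappa> * ?I T' a' else 0)"
        using T(3) by (simp only: P_def D_def 1 2 integral_mult_right_zero if_True if_False split: if_splits) simp
    qed
    also have "\<dots> = ?I T a + - \<kappa> * ?I T' a'" by (rule sum_mesh_two[OF T])
    also have "\<dots> = 0" using flux[rule_format, OF test_function_gradient(1,2)[OF w]] by simp
    finally show ?thesis .
  qed
  have v: "ip \<Omega> (weak_div \<Omega> (glue P)) r = (\<Sum>S\<in>\<T>. ip S (D S) r)"
    by (rule V_h_glue(2)[of P k D, OF 1 2 3 r])
  have zero: "(\<Sum>S\<in>\<T>. ip S (D S) r) = 0"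
    using orth[OF V_h_glue(1)[of P k D, OF 1 2 3]] v by simp
  have const: "ip S (\<lambda>x. e) r = e * z * (LINT x|lebesgue_on S. 1)"
    if "S \<in> \<T>" "AE x in lebesgue_on S. r x = z" for S e z
  proof -
    have L: "(\<lambda>x. y) \<in> L2 S" for y :: real
      by (rule continuous_in_L2[OF compact_T[OF that(1)]]) auto
    have "ip S (\<lambda>x. e) r = ip S (\<lambda>x. e) (\<lambda>x. z)"
      by (rule ip_cong_AE[OF _ that(2) L L L2_restrict[OF that(1) r] L]) simp
    also have "\<dots> = (LINT x|lebesgue_on S. (e * z) * 1)" by (simp add: ip_def)
    also have "\<dots> = (e * z) * (LINT x|lebesgue_on S. 1)" by (rule integral_mult_right_zero)
    finally show ?thesis .
  qed
  have "(\<Sum>S\<in>\<T>. ip S (D S) r) = (\<Sum>S\<in>\<T>. if S = T then ?d * c * (LINT x|lebesgue_on T. 1)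
      else if S = T' then - \<kappa> * ?d * c' * (LINT x|lebesgue_on T'. 1) else 0)"
  proof (rule sum.cong[OF refl])
    fix S
    have "D T = (\<lambda>x. ?d)" "D T' = (\<lambda>x. - \<kappa> * ?d)" "\<And>S. S \<noteq> T \<Longrightarrow> S \<noteq> T' \<Longrightarrow> D S = (\<lambda>x. 0)"
      using T(3) by (auto simp: D_def)
    moreover have "ip S (\<lambda>x. 0) r = 0" by (simp add: ip_def)
    ultimately show "ip S (D S) r = (if S = T then ?d * c * (LINT x|lebesgue_on T. 1)
      else if S = T' then - \<kappa> * ?d * c' * (LINT x|lebesgue_on T'. 1) else 0)"
      using const[OF T(1) c(1), of ?d] const[OF T(2) c(2), of "- \<kappa> * ?d"] by metis
  qed
  also have "\<dots> = ?d * c * (LINT x|lebesgue_on T. 1) + - \<kappa> * ?d * c' * (LINT x|lebesgue_on T'. 1)"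
    by (rule sum_mesh_two[OF T])
  finally have "?d * c * (LINT x|lebesgue_on T. 1) + - \<kappa> * ?d * c' * (LINT x|lebesgue_on T'. 1) = 0"
    unfolding zero by (rule sym)
  then have "?d * \<kappa> * (LINT x|lebesgue_on T'. 1) * (c - c') = 0"
    unfolding \<kappa>(2) by (simp add: algebra_simps)
  moreover have "(LINT x|lebesgue_on T'. 1 :: real) \<noteq> 0"
  proof
    assume 0: "(LINT x|lebesgue_on T'. 1 :: real) = 0"
    have "AE x in lebesgue_on T'. (1::real) = 0"
    proof (rule integral_nonneg_eq_0_iff_AE[THEN iffD1, OF _ _ 0])
      show "integrable (lebesgue_on T') (\<lambda>x. 1 :: real)" by (rule integrable_on_compact[OF compact_T[OF T(2)]]) simp
    qed simp
    then have "negligible T'" using measurable_T[OF T(2)] by (simp add: AE_lebesgue_on_iff_negligible)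
    then have "negligible (interior T')" using interior_subset negligible_subset by blast
    then show False using interior_T_nonempty[OF T(2)] open_not_negligible[OF open_interior] by blast
  qed
  ultimately show ?thesis using \<kappa>(1) by simp
qed

end

context mesh begin

section \<open>Walking through the mesh\<close>

text \<open>
  If two classes of values occurred, they would meet at some point of the connected domain. Near that
  point, join generic points of one simplex of each class by a segment. Intersections of simplices of
  dimension at most \<open>d - 2\<close> together with the starting point \<open>y\<close> span negligible affine sets, so a generic
  endpoint avoids them, and the segment passes from one class to the other inside an intersection of
  dimension \<open>d - 1\<close>, that is, through a facet.
\<close>

lemma constant_on_mesh:
  assumes f: "\<And>T T'. T \<in> \<T> \<Longrightarrow> T' \<in> \<T> \<Longrightarrow> T \<noteq> T' \<Longrightarrow> (T \<inter> T') facet_of T \<Longrightarrow> (T \<inter> T') facet_of T' \<Longrightarrow> f T = f T'"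
    and T0: "T0 \<in> \<T>" and T: "T \<in> \<T>"
  shows "f T = f T0"
proof (rule ccontr)
  assume ne: "f T \<noteq> f T0"
  define A where "A = {S \<in> \<T>. f S = f T0}"
  define B where "B = {S \<in> \<T>. f S \<noteq> f T0}"
  have closedAB: "closed (\<Union>A)" "closed (\<Union>B)"
    using finite_mesh compact_T compact_imp_closed by (auto simp: A_def B_def intro!: closed_Union)
  have cover: "\<Omega> \<subseteq> \<Union>A \<union> \<Union>B" using domain_covered by (auto simp: A_def B_def)
  have meets: "\<Union>X \<inter> \<Omega> \<noteq> {}" if "S \<in> X" "S \<in> \<T>" for X S
    using interior_T_nonempty[OF that(2)] interior_T_subset[OF that(2)] interior_subset[of S] that(1) by blast
  have "\<Union>A \<inter> \<Omega> \<noteq> {}" "\<Union>B \<inter> \<Omega> \<noteq> {}"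
    using meets[of T0 A] meets[of T B] T T0 ne by (auto simp: A_def B_def)
  then have "\<Union>A \<inter> \<Union>B \<inter> \<Omega> \<noteq> {}"
    using connected_domain closedAB cover unfolding connected_closed by metis
  then obtain x T1 T2 where x: "x \<in> \<Omega>" "x \<in> T1" "T1 \<in> A" "x \<in> T2" "T2 \<in> B" by blast
  then have T12: "T1 \<in> \<T>" "T2 \<in> \<T>" by (auto simp: A_def B_def)
  obtain \<epsilon> where \<epsilon>: "\<epsilon> > 0" "ball x \<epsilon> \<subseteq> \<Omega>" using open_domain x(1) open_contains_ball by blast
  \<comment> \<open>Everything happens in a ball inside \<open>\<Omega>\<close>: its convexity keeps the segment in the domain.\<close>
  have near: "interior S \<inter> ball x \<epsilon> \<noteq> {}" if "S \<in> \<T>" "x \<in> S" for S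
  proof -
    have "x \<in> closure (interior S)"
      using convex_closure_interior[OF convex_T interior_T_nonempty, OF that(1) that(1)] closure_subset that(2) by blast
    moreover have "x \<in> ball x \<epsilon>" using \<epsilon> by simp
    ultimately show ?thesis using open_Int_closure_eq_empty[of "ball x \<epsilon>" "interior S"] by blast
  qed
  have generic: "\<exists>z. z \<in> interior S \<inter> ball x \<epsilon> \<and> z \<notin> N" if "S \<in> \<T>" "x \<in> S" "negligible N" for S N
  proof (rule ccontr)
    assume "\<not> ?thesis"
    then have "interior S \<inter> ball x \<epsilon> \<subseteq> N" by blast
    then have "negligible (interior S \<inter> ball x \<epsilon>)" using that(3) negligible_subset by blast
    moreover have "open (interior S \<inter> ball x \<epsilon>)" by (intro open_Int open_interior open_ball)
    ultimately show False using near[OF that(1,2)] open_not_negligible by blast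
  qed
  \<comment> \<open>The starting point \<open>y\<close> is put outside all simplices other than \<open>T1\<close>, so that the crossing point \<open>p\<close>
    found below differs from \<open>y\<close>.\<close>
  have "negligible (\<Union>S\<in>\<T> - {T1}. T1 \<inter> S)"
    using finite_mesh negligible_T_Int T12(1) by (intro negligible_finite_UN) auto
  from generic[OF T12(1) x(2) this]
  obtain y where y: "y \<in> interior T1" "y \<in> ball x \<epsilon>" "\<And>S. S \<in> \<T> \<Longrightarrow> S \<noteq> T1 \<Longrightarrow> y \<notin> S"
    using interior_subset[of T1] by blast
  define low where "low = {(S, S') \<in> \<T> \<times> \<T>. aff_dim (S \<inter> S') \<le> int CARD('d) - 2}"
  have "negligible (\<Union>(S, S')\<in>low. affine hull (insert y (S \<inter> S')))"
  proof (rule negligible_finite_UN)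
    show "finite low" unfolding low_def by (rule finite_subset[OF _ finite_cartesian_product[OF finite_mesh finite_mesh]]) auto
    fix i assume "i \<in> low"
    then obtain S S' where i: "i = (S, S')" "aff_dim (S \<inter> S') \<le> int CARD('d) - 2" by (auto simp: low_def)
    have "aff_dim (affine hull (insert y (S \<inter> S'))) < int DIM(real^'d)"
      using i(2) by (simp add: aff_dim_insert)
    then show "negligible (case i of (S, S') \<Rightarrow> affine hull (insert y (S \<inter> S')))"
      unfolding i by (simp only: prod.case negligible_if_aff_dim_less)
  qed
  then obtain z where z0: "z \<in> interior T2 \<inter> ball x \<epsilon>" "z \<notin> (\<Union>(S, S')\<in>low. affine hull (insert y (S \<inter> S')))"
    using generic[OF T12(2) x(4)] by metis
  then have z: "z \<in> interior T2" "z \<in> ball x \<epsilon>" by auto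
  have z_low: "z \<notin> affine hull (insert y (S \<inter> S'))" if l: "(S, S') \<in> low" for S S'
    using z0(2) UN_I[OF l, of z "\<lambda>(S, S'). affine hull (insert y (S \<inter> S'))"] by auto
  have seg: "closed_segment y z \<subseteq> \<Omega>"
    using \<epsilon>(2) closed_segment_subset[OF y(2) z(2) convex_ball] by blast
  have "y \<in> T1" using y(1) interior_subset by (rule rev_subsetD)
  moreover have "z \<in> T2" using z(1) interior_subset by (rule rev_subsetD)
  ultimately have "y \<in> \<Union>A" "z \<in> \<Union>B" using x(3,5) by auto
  moreover have "y \<in> closed_segment y z" "z \<in> closed_segment y z" by auto
  ultimately have "\<Union>A \<inter> closed_segment y z \<noteq> {}" "\<Union>B \<inter> closed_segment y z \<noteq> {}" by blast+
  moreover have "closed_segment y z \<subseteq> \<Union>A \<union> \<Union>B" using seg cover by blast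
  ultimately have "\<Union>A \<inter> \<Union>B \<inter> closed_segment y z \<noteq> {}"
    using closedAB connected_segment(1)[of y z] unfolding connected_closed by metis
  then obtain p S S' where p: "p \<in> closed_segment y z" "p \<in> S" "S \<in> A" "p \<in> S'" "S' \<in> B" by blast
  then have S: "S \<in> \<T>" "S' \<in> \<T>" "S \<noteq> S'" "f S \<noteq> f S'" by (auto simp: A_def B_def)
  have "S' \<noteq> T1" using p(5) x(3) by (auto simp: A_def B_def)
  then have "p \<noteq> y" using y(3)[OF S(2)] p(4) by auto
  have "(S, S') \<notin> low"
  proof
    assume l: "(S, S') \<in> low"
    obtain s where s: "0 \<le> s" "s \<le> 1" "p = (1 - s) *\<^sub>R y + s *\<^sub>R z" using p(1) by (auto simp: in_segment)
    then have "s \<noteq> 0" using \<open>p \<noteq> y\<close> by auto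
    have "s *\<^sub>R z = p - (1 - s) *\<^sub>R y" using s(3) by simp
    then have "(1 / s) *\<^sub>R (s *\<^sub>R z) = (1 / s) *\<^sub>R (p - (1 - s) *\<^sub>R y)" by simp
    then have z1: "z = (1 / s) *\<^sub>R p - (1 / s * (1 - s)) *\<^sub>R y"
      using \<open>s \<noteq> 0\<close> by (simp add: scaleR_diff_right)
    have c: "1 / s * (1 - s) = 1 / s - 1" using \<open>s \<noteq> 0\<close> by (simp add: field_simps)
    \<comment> \<open>If the segment hit a low-dimensional intersection at \<open>p\<close>, then \<open>z\<close> would lie on the line
      through \<open>y\<close> and \<open>p\<close>.\<close>
    have z_eq: "z = (1 - 1 / s) *\<^sub>R y + (1 / s) *\<^sub>R p" using z1 unfolding c by (simp add: algebra_simps)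
    have hulls: "y \<in> affine hull (insert y (S \<inter> S'))" "p \<in> affine hull (insert y (S \<inter> S'))"
      using p by (auto intro: hull_inc)
    have "z \<in> affine hull (insert y (S \<inter> S'))"
      unfolding z_eq using affine_alt[THEN iffD1, OF affine_affine_hull, rule_format, OF hulls] .
    then show False using z_low[OF l] by blast
  qed
  then have "aff_dim (S \<inter> S') = int CARD('d) - 1"
    using aff_dim_T_Int[OF S(1-3)] S(1,2) by (auto simp: low_def)
  moreover have "S \<inter> S' \<noteq> {}" using p by blast
  ultimately have "(S \<inter> S') facet_of S" "(S \<inter> S') facet_of S'"
    using face_Int[OF S(1,2)] face_Int[OF S(2,1)] aff_dim_simplex[OF simplex_T[OF S(1)]] aff_dim_simplex[OF simplex_T[OF S(2)]]
    by (auto simp: facet_of_def Int_commute)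
  then show False using f[OF S(1-3)] S(4) by blast
qed

section \<open>Broken polynomials and their orthogonal projection\<close>

lemma restr_in_add: "restr_in T f (Polys k UNIV) \<Longrightarrow> restr_in T g (Polys k UNIV) \<Longrightarrow> restr_in T (\<lambda>x. f x + g x) (Polys k UNIV)"
proof -
  assume "restr_in T f (Polys k UNIV)" "restr_in T g (Polys k UNIV)"
  then obtain p q where p: "p \<in> Polys k UNIV" "AE x in lebesgue_on T. f x = p x"
    and q: "q \<in> Polys k UNIV" "AE x in lebesgue_on T. g x = q x" by (auto simp: restr_in_def)
  have "AE x in lebesgue_on T. f x + g x = p x + q x" using p(2) q(2) by eventually_elim simp
  then show ?thesis unfolding restr_in_def using Polys_add[OF p(1) q(1)] by (intro bexI[of _ "\<lambda>x. p x + q x"])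
qed

lemma broken_polys_add: "f \<in> broken_polys k \<Omega> \<T> \<Longrightarrow> g \<in> broken_polys k \<Omega> \<T> \<Longrightarrow> (\<lambda>x. f x + g x) \<in> broken_polys k \<Omega> \<T>"
  by (simp add: broken_polys_def L2_add restr_in_add)

lemma broken_polys_cmult: assumes "f \<in> broken_polys k \<Omega> \<T>" shows "(\<lambda>x. c * f x) \<in> broken_polys k \<Omega> \<T>"
proof -
  have "restr_in T (\<lambda>x. c * f x) (Polys k UNIV)" if f: "restr_in T f (Polys k UNIV)" for T
  proof -
    obtain p where p: "p \<in> Polys k UNIV" "AE x in lebesgue_on T. f x = p x" using f by (auto simp: restr_in_def)
    have "AE x in lebesgue_on T. c * f x = c * p x" using p(2) by eventually_elim simp
    moreover have "(\<lambda>x. c * p x) \<in> Polys k UNIV"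
      using Polys_linear[OF linear_scale_self p(1), of c] by simp
    ultimately show ?thesis unfolding restr_in_def by (intro bexI[of _ "\<lambda>x. c * p x"])
  qed
  then show ?thesis using assms by (simp add: broken_polys_def L2_cmult)
qed

lemma broken_polys_diff: "f \<in> broken_polys k \<Omega> \<T> \<Longrightarrow> g \<in> broken_polys k \<Omega> \<T> \<Longrightarrow> (\<lambda>x. f x - g x) \<in> broken_polys k \<Omega> \<T>"
  using broken_polys_add[of f k "\<lambda>x. (-1) * g x"] broken_polys_cmult[of g k "-1"] by simp

lemma broken_polys_const: "(\<lambda>x. c) \<in> broken_polys k \<Omega> \<T>"
  by (auto simp: broken_polys_def restr_in_def intro!: L2_const bexI[of _ "\<lambda>x. c"] Polys_const)

lemma broken_polys_sum: "finite I \<Longrightarrow> (\<And>i. i \<in> I \<Longrightarrow> f i \<in> broken_polys k \<Omega> \<T>) \<Longrightarrow> (\<lambda>x. \<Sum>i\<in>I. f i x) \<in> broken_polys k \<Omega> \<T>"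
  by (induction I rule: finite_induct) (auto intro: broken_polys_const broken_polys_add)

text \<open>
  The broken polynomials are spanned, up to null sets, by the finitely many monomials cut off to single
  simplices, so the projection exists and the choice in its definition is meaningful.
\<close>

lemma Q_proj_broken_polys:
  assumes \<phi>: "\<phi> \<in> L2 \<Omega>"
  shows "Q_proj k \<Omega> \<T> \<phi> \<in> broken_polys k \<Omega> \<T>"
    and "q \<in> broken_polys k \<Omega> \<T> \<Longrightarrow> ip \<Omega> (\<lambda>x. \<phi> x - Q_proj k \<Omega> \<T> \<phi> x) q = 0"
proof -
  define E where "E = {\<alpha> :: 'd \<Rightarrow> nat. sum \<alpha> UNIV \<le> k}"
  have finE: "finite E" by (simp add: E_def)
  define m where "m = (\<lambda>(T :: (real^'d) set, \<alpha>) x. indicator T x * monomial \<alpha> x)"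
  define B where "B = m ` (\<T> \<times> E)"
  have finB: "finite B" using finite_mesh finE by (simp add: B_def)
  have mB: "m (T, \<alpha>) \<in> broken_polys k \<Omega> \<T>" if "T \<in> \<T>" "\<alpha> \<in> E" for T \<alpha>
  proof -
    define P where "P S = (if S = T then monomial \<alpha> else (\<lambda>x. 0))" for S
    have P: "P S \<in> Polys k UNIV" for S
      using Polys_monomial[of \<alpha> k "1::real"] that(2) by (simp add: P_def E_def Polys_zero)
    have eq: "m (T, \<alpha>) = glue P"
    proof
      fix x
      have "glue P x = (\<Sum>S\<in>\<T>. if S = T then indicator T x * monomial \<alpha> x else 0)"
        by (rule sum.cong) (auto simp: P_def)
      then show "m (T, \<alpha>) x = glue P x"
        using that(1) finite_mesh by (simp add: m_def)
    qed
    have "m (T, \<alpha>) \<in> L2 \<Omega>" unfolding eq by (rule glue_L2[OF continuous_on_Polys[OF P]])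
    moreover have "restr_in S (m (T, \<alpha>)) (Polys k UNIV)" if "S \<in> \<T>" for S
      unfolding restr_in_def eq using glue_AE[OF that, of P] P[of S] by (intro bexI[of _ "P S"])
    ultimately show ?thesis by (simp add: broken_polys_def)
  qed
  have Bb: "b \<in> broken_polys k \<Omega> \<T>" if "b \<in> B" for b using that mB by (auto simp: B_def)
  have BL: "B \<subseteq> L2 \<Omega>" using Bb by (auto simp: broken_polys_def)
  obtain c where c: "\<forall>b\<in>B. ip \<Omega> (\<lambda>x. \<phi> x - (\<Sum>b\<in>B. c b * b x)) b = 0"
    using ex_orthogonal_projection[OF finB BL \<phi>] by blast
  define r where "r x = (\<Sum>b\<in>B. c b * b x)" for x
  have rb: "r \<in> broken_polys k \<Omega> \<T>"
    unfolding r_def[abs_def] by (intro broken_polys_sum finB broken_polys_cmult Bb)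
  have hL: "(\<lambda>x. \<phi> x - r x) \<in> L2 \<Omega>" using rb by (intro L2_diff \<phi>) (simp add: broken_polys_def)
  have orth: "ip \<Omega> (\<lambda>x. \<phi> x - r x) q = 0" if q: "q \<in> broken_polys k \<Omega> \<T>" for q
  proof -
    have "\<exists>a. AE x in lebesgue_on T. q x = (\<Sum>\<alpha>\<in>E. monomial \<alpha> x * a \<alpha>)" if T: "T \<in> \<T>" for T
    proof -
      obtain p where p: "p \<in> Polys k UNIV" "AE x in lebesgue_on T. q x = p x"
        using q T by (auto simp: broken_polys_def restr_in_def)
      obtain a where "p = (\<lambda>x. \<Sum>\<alpha>\<in>E. monomial \<alpha> x *\<^sub>R a \<alpha>)"
        using p(1) unfolding Polys_UNIV_iff E_def by blast
      then show ?thesis using p(2) by (intro exI[of _ a]) simp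
    qed
    then have "\<forall>T\<in>\<T>. \<exists>a. AE x in lebesgue_on T. q x = (\<Sum>\<alpha>\<in>E. monomial \<alpha> x * a \<alpha>)" by blast
    from bchoice[OF this]
    obtain a where a: "\<forall>T\<in>\<T>. AE x in lebesgue_on T. q x = (\<Sum>\<alpha>\<in>E. monomial \<alpha> x * a T \<alpha>)" by blast
    have L: "(\<lambda>x. a T \<alpha> * m (T, \<alpha>) x) \<in> L2 \<Omega>" if "T \<in> \<T>" "\<alpha> \<in> E" for T \<alpha>
      using mB[OF that] by (simp add: broken_polys_def L2_cmult)
    define q' where "q' x = (\<Sum>T\<in>\<T>. \<Sum>\<alpha>\<in>E. a T \<alpha> * m (T, \<alpha>) x)" for x
    have q'L: "q' \<in> L2 \<Omega>" unfolding q'_def[abs_def] by (intro L2_sum finite_mesh finE L)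
    have "AE x in lebesgue_on \<Omega>. q x = q' x"
      unfolding AE_domain_iff
    proof
      fix T assume T: "T \<in> \<T>"
      have "q' x = (\<Sum>T\<in>\<T>. indicator T x *\<^sub>R (\<Sum>\<alpha>\<in>E. monomial \<alpha> x * a T \<alpha>))" for x
        by (simp add: q'_def m_def sum_distrib_left mult_ac)
      then show "AE x in lebesgue_on T. q x = q' x"
        using bspec[OF a T] glue_AE[OF T, of "\<lambda>T x. \<Sum>\<alpha>\<in>E. monomial \<alpha> x * a T \<alpha>"] by (elim AE_mp) (auto intro!: AE_I2)
    qed
    then have "ip \<Omega> (\<lambda>x. \<phi> x - r x) q = ip \<Omega> (\<lambda>x. \<phi> x - r x) q'"
      by (intro ip_cong_AE) (use q hL q'L in \<open>auto simp: broken_polys_def\<close>)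
    also have "\<dots> = (\<Sum>T\<in>\<T>. ip \<Omega> (\<lambda>x. \<phi> x - r x) (\<lambda>x. \<Sum>\<alpha>\<in>E. a T \<alpha> * m (T, \<alpha>) x))"
      unfolding q'_def[abs_def] by (intro ip_sum_right finite_mesh hL L2_sum finE L)
    also have "\<dots> = (\<Sum>T\<in>\<T>. \<Sum>\<alpha>\<in>E. ip \<Omega> (\<lambda>x. \<phi> x - r x) (\<lambda>x. a T \<alpha> * m (T, \<alpha>) x))"
      by (intro sum.cong refl ip_sum_right finE hL L)
    also have "\<dots> = 0"
    proof (intro sum.neutral ballI)
      fix T \<alpha> assume "T \<in> \<T>" "\<alpha> \<in> E"
      then have "ip \<Omega> (\<lambda>x. \<phi> x - r x) (m (T, \<alpha>)) = 0" using c by (auto simp: B_def r_def[abs_def])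
      then show "ip \<Omega> (\<lambda>x. \<phi> x - r x) (\<lambda>x. a T \<alpha> * m (T, \<alpha>) x) = 0"
        using ip_scaleR_left[of \<Omega> "a T \<alpha>" "m (T, \<alpha>)" "\<lambda>x. \<phi> x - r x"] by (simp add: ip_commute[of \<Omega> "\<lambda>x. \<phi> x - r x"])
    qed
    finally show ?thesis .
  qed
  have "Q_proj k \<Omega> \<T> \<phi> \<in> broken_polys k \<Omega> \<T> \<and>
     (\<forall>q\<in>broken_polys k \<Omega> \<T>. ip \<Omega> (\<lambda>x. \<phi> x - Q_proj k \<Omega> \<T> \<phi> x) q = 0)"
    unfolding Q_proj_def by (rule someI[where x = r]) (use rb orth in blast)
  then show "Q_proj k \<Omega> \<T> \<phi> \<in> broken_polys k \<Omega> \<T>"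
    and "q \<in> broken_polys k \<Omega> \<T> \<Longrightarrow> ip \<Omega> (\<lambda>x. \<phi> x - Q_proj k \<Omega> \<T> \<phi> x) q = 0" by blast+
qed

section \<open>Piecewise polynomials orthogonal to all divergences\<close>

lemma measure_domain_nonzero: "measure lebesgue \<Omega> \<noteq> 0"
  using open_not_negligible[OF open_domain domain_nonempty] negligible_iff_measure[of \<Omega>] by simp

lemma orthogonal_to_div_AE_zero:
  assumes r: "r \<in> Q_h k \<Omega> \<T>" and orth: "\<And>v. v \<in> V_h k \<Omega> \<T> \<Longrightarrow> ip \<Omega> (weak_div \<Omega> v) r = 0"
  shows "AE x in lebesgue_on \<Omega>. r x = 0"
proof -
  have rL: "r \<in> L2 \<Omega>" and mean: "(LINT x|lebesgue_on \<Omega>. r x) = 0"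
    using r by (auto simp: Q_h_def L2_mean_zero_def)
  have "\<exists>c. AE x in lebesgue_on T. r x = c" if T: "T \<in> \<T>" for T
  proof -
    obtain \<rho> where \<rho>: "\<rho> \<in> Polys k UNIV" "AE x in lebesgue_on T. r x = \<rho> x"
      using r T by (auto simp: Q_h_def restr_in_def)
    obtain c where "\<forall>x\<in>T. \<rho> x = c"
      using orthogonal_to_div_locally_constant[OF orth rL T \<rho>] by blast
    moreover have "AE x in lebesgue_on T. x \<in> T"
      using measurable_T[OF T] by (intro AE_I2) simp
    ultimately show ?thesis using \<rho>(2) by (intro exI[of _ c]) (auto elim: AE_mp)
  qed
  then obtain c where c: "\<And>T. T \<in> \<T> \<Longrightarrow> AE x in lebesgue_on T. r x = c T" by metis
  obtain T0 where T0: "T0 \<in> \<T>" using domain_covered domain_nonempty by blast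
  have "c T = c T0" if "T \<in> \<T>" for T
    by (rule constant_on_mesh[OF _ T0 that]) (rule orthogonal_to_div_across_facet[OF orth rL _ _ _ _ _ c c])
  then have ae: "AE x in lebesgue_on \<Omega>. r x = c T0"
    unfolding AE_domain_iff using c by metis
  have "(LINT x|lebesgue_on \<Omega>. r x) = (LINT x|lebesgue_on \<Omega>. c T0)"
    by (rule integral_cong_AE) (use ae rL in \<open>auto simp: L2_def\<close>)
  also have "\<dots> = c T0 * measure lebesgue \<Omega>" by (simp add: measure_restrict_space)
  finally have "c T0 = 0 \<or> measure lebesgue \<Omega> = 0" using mean by simp
  then have "c T0 = 0" using measure_domain_nonzero by blast
  then show ?thesis using ae by simp
qed

end

context mesh begin

section \<open>Stresses are square integrable\<close>

text \<open>
  The barycentric coordinate is read off from any functional that vanishes on the opposite facet.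
  The vertices span the whole space affinely, so the description in the definition is proper at all
  points, inside and outside of \<open>T\<close>.
\<close>

lemma bary_affine:
  assumes T: "T \<in> \<T>" and c: "c \<in> verts T"
  obtains g b where "\<And>x. bary T c x = g \<bullet> x + b"
proof -
  obtain C where C: "\<not> affine_dependent C" "T = convex hull C" "\<And>c. c \<in> C \<Longrightarrow> C \<noteq> {c}" "C \<noteq> {}" "finite C"
    using vertices_T[OF T] by metis
  have vC: "verts T = C"
    unfolding verts_def C(2) using extreme_point_of_convex_hull_affine_independent[OF C(1)] by auto
  have cC: "c \<in> C" using c vC by simp
  obtain n b where n: "\<And>x. x \<in> convex hull (C - {c}) \<Longrightarrow> n \<bullet> x = b" "n \<bullet> c < b"
    using vertex_functional[OF C(1) cC C(3)[OF cC] C(2)] by metis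
  have "aff_dim C = int DIM(real^'d)"
    using aff_dim_simplex[OF simplex_T[OF T]] by (simp add: C(2) aff_dim_convex_hull)
  then have full: "affine hull C = UNIV" by (rule aff_dim_eq_full[THEN iffD1])
  have val: "u c = (b - n \<bullet> x) / (b - n \<bullet> c)" if u: "sum u C = 1" "(\<Sum>w\<in>C. u w *\<^sub>R w) = x" for u x
  proof -
    have "b - n \<bullet> x = (\<Sum>w\<in>C. u w * (b - n \<bullet> w))"
      using u(1) by (simp add: u(2)[symmetric] inner_sum_right right_diff_distrib sum_subtractf sum_distrib_right[symmetric])
    also have "\<dots> = (\<Sum>w\<in>C. if w = c then u c * (b - n \<bullet> c) else 0)"
      using n(1) hull_inc[of _ "C - {c}" convex] by (intro sum.cong) auto
    also have "\<dots> = u c * (b - n \<bullet> c)" using C(5) cC by simp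
    finally show ?thesis using n(2) by simp
  qed
  have "bary T c x = (b - n \<bullet> x) / (b - n \<bullet> c)" for x
    unfolding bary_def vC
  proof (rule the_equality)
    obtain u where "sum u C = 1" "(\<Sum>w\<in>C. u w *\<^sub>R w) = x"
      using full affine_hull_finite[OF C(5)] by blast
    then show "\<exists>u. sum u C = 1 \<and> (\<Sum>w\<in>C. u w *\<^sub>R w) = x \<and> (b - n \<bullet> x) / (b - n \<bullet> c) = u c"
      using val by metis
  qed (use val in metis)
  then have "bary T c x = ((- 1 / (b - n \<bullet> c)) *\<^sub>R n) \<bullet> x + b / (b - n \<bullet> c)" for x
    by (simp add: diff_divide_distrib)
  then show ?thesis by (rule that)
qed

lemma grad_bary_const:
  assumes T: "T \<in> \<T>" and c: "c \<in> verts T"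
  obtains g where "\<And>x. grad (bary T c) x = g"
proof -
  obtain g b where gb: "\<And>x. bary T c x = g \<bullet> x + b" using bary_affine[OF T c] by metis
  have "grad (bary T c) x = g" for x
  proof -
    have "(bary T c has_derivative (\<lambda>h. g \<bullet> h)) (at x)"
      unfolding gb[abs_def] by (auto intro!: derivative_eq_intros)
    then have "grad (bary T c) x $ i = g $ i" for i
      by (simp add: grad_nth_eq inner_axis)
    then show ?thesis by (simp add: vec_eq_iff)
  qed
  then show ?thesis by (rule that)
qed

text \<open>
  Gradients of barycentric coordinates are constant, so the lowest order enrichment is affine.
\<close>

lemma continuous_on_E_fun:
  assumes T: "T \<in> \<T>" shows "continuous_on UNIV (E_fun j T l A)"
proof -
  have "continuous_on UNIV (\<lambda>x. ((j l - i) \<bullet> (A *v x_facet T (opp_facet T l) x)) *\<^sub>R dev (outer (grad (bary T i) x) (l - i)))"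
    if i: "i \<in> verts T" for i
  proof -
    obtain g where "\<And>x. grad (bary T i) x = g" using grad_bary_const[OF T i] by metis
    moreover have "continuous_on UNIV (x_facet T (opp_facet T l))"
      unfolding x_facet_def[abs_def] tang_proj_def by (intro continuous_intros)
    ultimately show ?thesis
      by (simp only:) (intro continuous_intros bounded_linear.continuous_on[OF matrix_vector_mul_bounded_linear])
  qed
  then show ?thesis unfolding E_fun_def[abs_def] by (intro continuous_on_sum) auto
qed

lemma continuous_on_Sigma_plus:
  assumes T: "T \<in> \<T>" and \<tau>: "\<tau> \<in> Sigma_plus k j T" shows "continuous_on UNIV \<tau>"
proof -
  have P0: "continuous_on UNIV a" if a: "a \<in> P0_plus j T" for a
  proof -
    obtain a0 b where ab: "a = (\<lambda>x. a0 x + b x)" "a0 \<in> Polys 0 traceless_mats"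
        "b \<in> fun_span {E_fun j T l A | l A. l \<in> verts T \<and> A \<in> skew_facet T (opp_facet T l)}"
      using a unfolding P0_plus_def fun_sum_def by blast
    obtain S c where S: "b = (\<lambda>x. \<Sum>e\<in>S. c e *\<^sub>R e x)" "S \<subseteq> {E_fun j T l A | l A. l \<in> verts T \<and> A \<in> skew_facet T (opp_facet T l)}"
      using ab(3) unfolding fun_span_def by blast
    have "continuous_on UNIV e" if "e \<in> S" for e using S(2) that continuous_on_E_fun[OF T] by blast
    then have "continuous_on UNIV b" unfolding S(1) by (intro continuous_intros) auto
    then show ?thesis unfolding ab(1) by (intro continuous_intros continuous_on_Polys[OF ab(2)])
  qed
  obtain a b where ab: "\<tau> = (\<lambda>x. a x + b x)" "a \<in> (if k = 0 then P0_plus j T else Polys k traceless_mats)" "b \<in> B_tn (k + 1) T"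
    using \<tau> unfolding Sigma_plus_def fun_sum_def by blast
  have "continuous_on UNIV a"
    using ab(2) P0 continuous_on_Polys by (cases "k = 0") auto
  moreover have "continuous_on UNIV b" using ab(3) continuous_on_Polys unfolding B_tn_def by blast
  ultimately show ?thesis unfolding ab(1) by (intro continuous_intros)
qed

text \<open>
  Needed to expand inner products of stresses: without integrability the integrals would be default
  values.
\<close>

lemma Sigma_h_L2: "\<sigma> \<in> Sigma_h k j nF \<T> \<Longrightarrow> \<sigma> \<in> L2 \<Omega>"
proof (rule piecewise_continuous_L2)
  fix T assume "\<sigma> \<in> Sigma_h k j nF \<T>" and T: "T \<in> \<T>"
  then obtain p where "p \<in> Sigma_plus k (j T) T" "AE x in lebesgue_on T. \<sigma> x = p x"
    by (auto simp: Sigma_h_def restr_in_def)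
  then show "\<exists>p. continuous_on UNIV p \<and> (AE x in lebesgue_on T. \<sigma> x = p x)"
    using continuous_on_Sigma_plus[OF T] by blast
qed

section \<open>The invariance of the discrete solution\<close>

text \<open>
  Subtracting its mean \<open>c\<close> from the divergence gives a discrete pressure \<open>m\<close>. As \<open>m\<close> is orthogonal to the
  divergence and to constants, it is orthogonal to itself; so the divergence is constant, and \<open>\<phi>\<close> is
  orthogonal to constants.
\<close>

lemma weak_div_orthogonal_mean_zero:
  assumes u: "u \<in> V_h k \<Omega> \<T>" and orth: "\<And>q. q \<in> Q_h k \<Omega> \<T> \<Longrightarrow> ip \<Omega> (weak_div \<Omega> u) q = 0"
    and \<phi>: "\<phi> \<in> L2_mean_zero \<Omega>"
  shows "ip \<Omega> \<phi> (weak_div \<Omega> u) = 0"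
proof -
  define g where "g = weak_div \<Omega> u"
  have g: "g \<in> broken_polys k \<Omega> \<T>" unfolding g_def by (rule weak_div_V_h[OF u])
  then have gL: "g \<in> L2 \<Omega>" by (simp add: broken_polys_def)
  have cL: "(\<lambda>x. c) \<in> L2 \<Omega>" for c :: real by (rule L2_const) simp
  define c where "c = (LINT x|lebesgue_on \<Omega>. g x) / measure lebesgue \<Omega>"
  define m where "m x = g x - c" for x
  have m: "m \<in> broken_polys k \<Omega> \<T>" unfolding m_def[abs_def] by (intro broken_polys_diff g broken_polys_const)
  then have mL: "m \<in> L2 \<Omega>" by (simp add: broken_polys_def)
  have mean: "(LINT x|lebesgue_on \<Omega>. m x) = 0"
  proof -
    have "(LINT x|lebesgue_on \<Omega>. m x) = (LINT x|lebesgue_on \<Omega>. g x) - (LINT x|lebesgue_on \<Omega>. c)"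
      unfolding m_def by (intro Bochner_Integration.integral_diff L2_integrable gL cL) auto
    also have "(LINT x|lebesgue_on \<Omega>. c) = c * measure lebesgue \<Omega>" by (simp add: measure_restrict_space)
    finally show ?thesis using measure_domain_nonzero by (simp add: c_def)
  qed
  have "m \<in> Q_h k \<Omega> \<T>" using m mean by (auto simp: Q_h_def L2_mean_zero_def broken_polys_def)
  then have "ip \<Omega> g m = 0" using orth by (simp add: g_def)
  moreover have "ip \<Omega> m m = ip \<Omega> g m - ip \<Omega> (\<lambda>x. c) m"
    using ip_diff_left[OF gL cL mL, of c] by (simp add: m_def[abs_def])
  moreover have "ip \<Omega> (\<lambda>x. c) m = 0" using mean by (simp add: ip_def)
  ultimately have "AE x in lebesgue_on \<Omega>. m x = 0" by (intro ip_self_zero_imp_AE_zero mL) simp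
  then have "AE x in lebesgue_on \<Omega>. g x = c" by eventually_elim (simp add: m_def)
  moreover have \<phi>L: "\<phi> \<in> L2 \<Omega>" using \<phi> by (simp add: L2_mean_zero_def)
  ultimately have "ip \<Omega> \<phi> g = ip \<Omega> \<phi> (\<lambda>x. c)"
    by (intro ip_cong_AE gL cL) auto
  also have "\<dots> = 0" using \<phi> by (simp add: ip_def L2_mean_zero_def)
  finally show ?thesis by (simp add: g_def)
qed

end

lemma b_h_split: "b_h \<Omega> \<T> \<tau> q v = b_h \<Omega> \<T> \<tau> (\<lambda>x. 0) v - ip \<Omega> (weak_div \<Omega> v) q"
  by (simp add: b_h_def ip_def)

text \<open>
  The two choices are made from the same predicate, so the results are equal everywhere and not only
  almost everywhere.
\<close>

lemma poly_on_cong_AE: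
  assumes "AE x in lebesgue_on T. f x = g x" shows "poly_on T f = poly_on T g"
proof -
  have "(AE x in lebesgue_on T. f x = p x) \<longleftrightarrow> (AE x in lebesgue_on T. g x = p x)" for p
    using assms by (auto elim: AE_mp)
  then show ?thesis unfolding poly_on_def by simp
qed

theorem corollary4p5:
  fixes \<Omega> :: "(real^'d) set" and \<T> :: "(real^'d) set set"
    and j :: "(real^'d) set \<Rightarrow> real^'d \<Rightarrow> real^'d"
    and nF :: "(real^'d) set \<Rightarrow> real^'d"
    and k :: nat and \<nu> :: real
    and f :: "real^'d \<Rightarrow> real^'d" and \<phi> :: "real^'d \<Rightarrow> real"
    and \<sigma> \<sigma>\<phi> :: "real^'d \<Rightarrow> real^'d^'d"
    and u u\<phi> :: "real^'d \<Rightarrow> real^'d"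
    and p p\<phi> :: "real^'d \<Rightarrow> real"
  assumes dim: "CARD('d) \<ge> 2"
    and nu: "0 < \<nu>" "\<nu> \<le> 1"
    and domain: "polytopal_domain \<Omega>"
    and mesh: "simplicial_mesh \<Omega> \<T>"
    and normals: "\<forall>F\<in>interior_facets \<T>. unit_normal F (nF F)"
    and choice: "\<forall>T\<in>\<T>. \<forall>l\<in>verts T. j T l \<in> verts T - {l}"
    and f: "f \<in> L2 \<Omega>"
    and phi: "\<phi> \<in> L2_mean_zero \<Omega>"
    and spaces: "\<sigma> \<in> Sigma_h k j nF \<T>" "u \<in> V_h k \<Omega> \<T>" "p \<in> Q_h k \<Omega> \<T>"
    and eq1: "\<forall>\<tau>\<in>Sigma_h k j nF \<T>. \<forall>q\<in>Q_h k \<Omega> \<T>.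
                inverse \<nu> * ip \<Omega> \<sigma> \<tau> + b_h \<Omega> \<T> \<tau> q u = 0"
    and eq2: "\<forall>v\<in>V_h k \<Omega> \<T>. b_h \<Omega> \<T> \<sigma> p v - ip \<Omega> u v = - ip \<Omega> f v"
    and spaces_phi: "\<sigma>\<phi> \<in> Sigma_h k j nF \<T>" "u\<phi> \<in> V_h k \<Omega> \<T>" "p\<phi> \<in> Q_h k \<Omega> \<T>"
    and eq1_phi: "\<forall>\<tau>\<in>Sigma_h k j nF \<T>. \<forall>q\<in>Q_h k \<Omega> \<T>.
                inverse \<nu> * ip \<Omega> \<sigma>\<phi> \<tau> + b_h \<Omega> \<T> \<tau> q u\<phi> = 0"
    and eq2_phi: "\<forall>v\<in>V_h k \<Omega> \<T>. b_h \<Omega> \<T> \<sigma>\<phi> p\<phi> v - ip \<Omega> u\<phi> v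
                    = - ip \<Omega> f v + ip \<Omega> \<phi> (weak_div \<Omega> v)"
  shows "(AE x in lebesgue_on \<Omega>. \<sigma>\<phi> x = \<sigma> x) \<and>
         (AE x in lebesgue_on \<Omega>. u\<phi> x = u x) \<and>
         (AE x in lebesgue_on \<Omega>. p\<phi> x = p x - Q_proj k \<Omega> \<T> \<phi> x)"
proof -
  interpret mesh \<Omega> \<T> using domain mesh by unfold_locales
  let ?z = "\<lambda>x :: real^'d. 0 :: real"
  define a where "a \<tau> v = b_h \<Omega> \<T> \<tau> ?z v" for \<tau> v
  have b: "b_h \<Omega> \<T> \<tau> q v = a \<tau> v - ip \<Omega> (weak_div \<Omega> v) q" for \<tau> q v
    unfolding a_def by (rule b_h_split)
  have z: "?z \<in> Q_h k \<Omega> \<T>"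
    using broken_polys_const[of 0 k] by (auto simp: Q_h_def L2_mean_zero_def broken_polys_def)
  have E1: "inverse \<nu> * ip \<Omega> \<sigma> \<tau> + a \<tau> u = 0" "inverse \<nu> * ip \<Omega> \<sigma>\<phi> \<tau> + a \<tau> u\<phi> = 0"
    if "\<tau> \<in> Sigma_h k j nF \<T>" for \<tau>
    using eq1[rule_format, OF that z] eq1_phi[rule_format, OF that z] by (simp_all add: a_def)
  \<comment> \<open>The form depends on \<open>q\<close> through \<open>(div u, q)\<close> only, so the equations for \<open>q\<close> and for \<open>0\<close> are subtracted.\<close>
  have du: "ip \<Omega> (weak_div \<Omega> u) q = 0" and du\<phi>: "ip \<Omega> (weak_div \<Omega> u\<phi>) q = 0" if "q \<in> Q_h k \<Omega> \<T>" for q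
    using eq1[rule_format, OF spaces(1) that] eq1_phi[rule_format, OF spaces(1) that] E1[OF spaces(1)] by (simp_all add: b)
  have \<phi>0: "ip \<Omega> \<phi> (weak_div \<Omega> u) = 0" "ip \<Omega> \<phi> (weak_div \<Omega> u\<phi>) = 0"
    using weak_div_orthogonal_mean_zero[OF spaces(2) du phi] weak_div_orthogonal_mean_zero[OF spaces_phi(2) du\<phi> phi] by auto
  \<comment> \<open>The pressures drop out by \<open>du\<close>, the additional load by \<open>\<phi>0\<close>.\<close>
  have E2: "a \<sigma> u - ip \<Omega> u u = - ip \<Omega> f u" "a \<sigma> u\<phi> - ip \<Omega> u u\<phi> = - ip \<Omega> f u\<phi>"
      "a \<sigma>\<phi> u - ip \<Omega> u\<phi> u = - ip \<Omega> f u" "a \<sigma>\<phi> u\<phi> - ip \<Omega> u\<phi> u\<phi> = - ip \<Omega> f u\<phi>"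
    using eq2[rule_format, OF spaces(2)] eq2[rule_format, OF spaces_phi(2)]
      eq2_phi[rule_format, OF spaces(2)] eq2_phi[rule_format, OF spaces_phi(2)]
      du[OF spaces(3)] du[OF spaces_phi(3)] du\<phi>[OF spaces(3)] du\<phi>[OF spaces_phi(3)] \<phi>0 by (simp_all add: b)
  have \<sigma>L: "\<sigma> \<in> L2 \<Omega>" "\<sigma>\<phi> \<in> L2 \<Omega>" using Sigma_h_L2 spaces(1) spaces_phi(1) by blast+
  have uL: "u \<in> L2 \<Omega>" "u\<phi> \<in> L2 \<Omega>" using spaces(2) spaces_phi(2) by (auto simp: V_h_def H0_div_def H_div_def)
  define s where "s x = \<sigma>\<phi> x - \<sigma> x" for x
  define w where "w x = u\<phi> x - u x" for x
  have sL: "s \<in> L2 \<Omega>" and wL: "w \<in> L2 \<Omega>" unfolding s_def[abs_def] w_def[abs_def] using \<sigma>L uL L2_diff by blast+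
  have ss: "ip \<Omega> s s = ip \<Omega> \<sigma>\<phi> \<sigma>\<phi> - ip \<Omega> \<sigma>\<phi> \<sigma> - ip \<Omega> \<sigma> \<sigma>\<phi> + ip \<Omega> \<sigma> \<sigma>"
  proof -
    have "ip \<Omega> s s = ip \<Omega> \<sigma>\<phi> s - ip \<Omega> \<sigma> s" using ip_diff_left[OF \<sigma>L(2,1) sL] by (simp add: s_def[abs_def])
    then show ?thesis using ip_diff_right[OF \<sigma>L(2,1) \<sigma>L(1)] ip_diff_right[OF \<sigma>L(2,1) \<sigma>L(2)] by (simp add: s_def[abs_def])
  qed
  have ww: "ip \<Omega> w w = ip \<Omega> u\<phi> u\<phi> - ip \<Omega> u\<phi> u - ip \<Omega> u u\<phi> + ip \<Omega> u u"
  proof -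
    have "ip \<Omega> w w = ip \<Omega> u\<phi> w - ip \<Omega> u w" using ip_diff_left[OF uL(2,1) wL] by (simp add: w_def[abs_def])
    then show ?thesis using ip_diff_right[OF uL(2,1) uL(1)] ip_diff_right[OF uL(2,1) uL(2)] by (simp add: w_def[abs_def])
  qed
  have "inverse \<nu> * ip \<Omega> s s + ip \<Omega> w w = 0"
    using E1[OF spaces(1)] E1[OF spaces_phi(1)] E2 unfolding ss ww by (simp add: algebra_simps)
  moreover have "inverse \<nu> * ip \<Omega> s s \<ge> 0" using nu ip_self_nonneg[of \<Omega> s] by simp
  ultimately have "inverse \<nu> * ip \<Omega> s s = 0" "ip \<Omega> w w = 0" using ip_self_nonneg[of \<Omega> w] by linarith+
  then have "AE x in lebesgue_on \<Omega>. s x = 0" "AE x in lebesgue_on \<Omega>. w x = 0"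
    using ip_self_zero_imp_AE_zero sL wL nu by auto
  then have same: "AE x in lebesgue_on \<Omega>. \<sigma>\<phi> x = \<sigma> x" "AE x in lebesgue_on \<Omega>. u\<phi> x = u x"
    by (simp_all add: s_def w_def)
  have "poly_on T \<sigma>\<phi> = poly_on T \<sigma>" if "T \<in> \<T>" for T
    using same(1) that unfolding AE_domain_iff by (intro poly_on_cong_AE) blast
  then have a_same: "a \<sigma>\<phi> v = a \<sigma> v" for v unfolding a_def b_h_def by simp
  define Q where "Q = Q_proj k \<Omega> \<T> \<phi>"
  have \<phi>L: "\<phi> \<in> L2 \<Omega>" and \<phi>m: "(LINT x|lebesgue_on \<Omega>. \<phi> x) = 0" using phi by (auto simp: L2_mean_zero_def)
  have Q: "Q \<in> broken_polys k \<Omega> \<T>" "\<And>q. q \<in> broken_polys k \<Omega> \<T> \<Longrightarrow> ip \<Omega> (\<lambda>x. \<phi> x - Q x) q = 0"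
    using Q_proj_broken_polys[OF \<phi>L] by (auto simp: Q_def)
  then have QL: "Q \<in> L2 \<Omega>" by (simp add: broken_polys_def)
  have Q\<phi>: "ip \<Omega> Q q = ip \<Omega> \<phi> q" if "q \<in> broken_polys k \<Omega> \<T>" for q
    using Q(2)[OF that] ip_diff_left[OF \<phi>L QL] that by (simp add: broken_polys_def)
  have pb: "p \<in> broken_polys k \<Omega> \<T>" "p\<phi> \<in> broken_polys k \<Omega> \<T>" and pm: "ip \<Omega> p (\<lambda>x. 1) = 0" "ip \<Omega> p\<phi> (\<lambda>x. 1) = 0"
    using spaces(3) spaces_phi(3) by (auto simp: Q_h_def broken_polys_def L2_mean_zero_def ip_def)
  then have pL: "p \<in> L2 \<Omega>" "p\<phi> \<in> L2 \<Omega>" by (auto simp: broken_polys_def)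
  define r where "r x = (p\<phi> x - p x) + Q x" for x
  have rb: "r \<in> broken_polys k \<Omega> \<T>" unfolding r_def[abs_def] by (intro broken_polys_add broken_polys_diff pb Q(1))
  \<comment> \<open>Adding \<open>Q\<close> to the difference of the pressures corresponds to the additional load.\<close>
  have ipr: "ip \<Omega> r g = ip \<Omega> p\<phi> g - ip \<Omega> p g + ip \<Omega> Q g" if g: "g \<in> L2 \<Omega>" for g
    unfolding r_def[abs_def] using ip_add_left[OF L2_diff[OF pL(2,1)] QL g] ip_diff_left[OF pL(2,1) g] by simp
  have "(LINT x|lebesgue_on \<Omega>. r x) = 0"
    using ipr[OF L2_const[of \<Omega> 1]] pm Q\<phi>[OF broken_polys_const[of 1 k]] \<phi>m by (simp add: ip_def)
  then have rQ: "r \<in> Q_h k \<Omega> \<T>" using rb by (auto simp: Q_h_def L2_mean_zero_def broken_polys_def)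
  have "AE x in lebesgue_on \<Omega>. r x = 0"
  proof (rule orthogonal_to_div_AE_zero[OF rQ])
    fix v assume v: "v \<in> V_h k \<Omega> \<T>"
    have vL: "v \<in> L2 \<Omega>" using v by (auto simp: V_h_def H0_div_def H_div_def)
    have d: "weak_div \<Omega> v \<in> broken_polys k \<Omega> \<T>" by (rule weak_div_V_h[OF v])
    then have dL: "weak_div \<Omega> v \<in> L2 \<Omega>" by (simp add: broken_polys_def)
    have "ip \<Omega> u\<phi> v = ip \<Omega> u v" by (rule ip_cong_AE[OF same(2) _ uL(2,1) vL vL]) simp
    then have "- ip \<Omega> (weak_div \<Omega> v) p\<phi> + ip \<Omega> (weak_div \<Omega> v) p = ip \<Omega> \<phi> (weak_div \<Omega> v)"
      using eq2[rule_format, OF v] eq2_phi[rule_format, OF v] by (simp add: b a_same)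
    then show "ip \<Omega> (weak_div \<Omega> v) r = 0"
      using ipr[OF dL] Q\<phi>[OF d] by (simp add: ip_commute[of \<Omega> "weak_div \<Omega> v"])
  qed
  then have "AE x in lebesgue_on \<Omega>. p\<phi> x = p x - Q_proj k \<Omega> \<T> \<phi> x"
    by eventually_elim (simp add: r_def Q_def)
  then show ?thesis using same by blast
qed

end
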